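(* Assume that $f_i$ is convex and $L$-smooth for all $i=1,\dots,n$, $f$ is $\mu$-quasi strongly convex, $\mu\ge0$, and the expected smoothness condition of the context holds with constant $\mathcal L$. Consider EC-SGDsr-DIANA with $$0<\gamma\le\min\left\{\frac1{4\mathcal L},\ \frac{\delta}{4\sqrt{6L\left(4L+3\delta(\mathcal L+L)+\frac{16(3\mathcal L+4L)}{1-\alpha}\right)}}\right\},\qquad0<\alpha\le\frac1{\omega+1}.$$ Then EC-SGDsr-DIANA satisfies the parametric assumption of the context with $A=2L$, $\widetilde A=3(\mathcal L+L)$, $A'=2\mathcal L$, $B_1=2$, $\widetilde B_1=B_1'=B_2'=B_2=\widetilde B_2=0$, $\widetilde D_1=\frac3n\sum_{i=1}^n\mathbf E_{\mathcal D_i}\|\nabla f_{\xi_i}(x^* )-\nabla f_i(x^* )\|^2$, $\sigma_{1,k}^2=\sigma_k^2=\frac1n\sum_{i=1}^n\|h_i^k-\nabla f_i(x^* )\|^2$, $\sigma_{2,k}^2\equiv0$, $D_1=0$, $D_1'=\frac2{3n}\widetilde D_1$, $D_2=\alpha^2(\omega+1)\widetilde D_1$, $\rho_1=\alpha$, $\rho_2=1$, $C_1=2\alpha(3\mathcal L+4L)$, $C_2=0$, $G=0$, $$F_1=\frac{96L\gamma^2}{\delta^2\alpha\left(1-\min\{\frac{\gamma\mu}2,\frac\alpha4\}\right)},\quad F_2=0,\quad D_3=\frac{6L\gamma}\delta\left(\frac{4\alpha(\omega+1)}\delta+1\right)\widetilde D_1,$$ and with $M_1=M_2=0$, where $M_1=\frac{4B_1'}{3\rho_1}$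 and $M_2=\frac{4(B_2'+\frac43G)}{3\rho_2}$. Moreover, for all $K\ge0$ $$\mathbf E[f(\bar x^K)-f(x^* )]\le\left(1-\min\left\{\frac{\gamma\mu}2,\frac\alpha4\right\}\right)^K\frac{4(\|x^0-x^*\|^2+\gamma F_1\sigma_0^2)}\gamma+4\gamma(D_1'+D_3)$$ when $\mu>0$, and $$\mathbf E[f(\bar x^K)-f(x^* )]\le\frac{4(\|x^0-x^*\|^2+\gamma F_1\sigma_0^2)}{\gamma K}+4\gamma(D_1'+D_3)$$ when $\mu=0$ (right-hand side read as $+\infty$ for $K=0$).
   Context: $f(x)=\frac1n\sum_{i=1}^nf_i(x)$, $f_i(x)=\frac1m\sum_{j=1}^mf_{ij}(x)$ on $\mathbb R^d$, $f_{ij}$ differentiable. A function is $L$-smooth if it is differentiable with $L$-Lipschitz gradient. $f$ is $\mu$-quasi strongly convex if it has a unique minimizer $x^*$ and $f(x^* )\ge f(x)+\langle\nabla f(x),x^*-x\rangle+\frac\mu2\|x-x^*\|^2$ for all $x$. Stochastic reformulation: $\xi_i=(\xi_{i1},\dots,\xi_{im})$ is a random vector with distribution $\mathcal D_i$, $\mathbf E_{\mathcal D_i}[\xi_{ij}]=1$ for all $i,j$, and $f_{\xi_i}(x)=\frac1m\sum_{j=1}^m\xi_{ij}f_{ij}(x)$. Expected smoothness: for all $i$ and $x$, $\mathbf E_{\mathcal D_i}\|\nabla f_{\xi_i}(x)-\nabla f_{\xi_i}(x^* )\|^2\le2\mathcal LD_{f_i}(x,x^* )$, where $D_h(x,y)=h(x)-h(y)-\langle\nabla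 h(y),x-y\rangle$. Operators: $\mathcal C$ is a (possibly randomized) compression operator with $\mathbf E\|\mathcal C(x)-x\|^2\le(1-\delta)\|x\|^2$ for all $x$, $\delta\in(0,1]$; $Q$ is a randomized quantization operator with $\mathbf E[Q(x)]=x$, $\mathbf E\|Q(x)-x\|^2\le\omega\|x\|^2$ for all $x$, $\omega>0$; every application uses fresh independent randomness. EC-SGDsr-DIANA: given initial vectors $x^0,h_1^0,\dots,h_n^0\in\mathbb R^d$ and $e_i^0=0$; at iteration $k\ge0$ each worker $i$ samples $\xi_i^k\sim\mathcal D_i$ (independently over $i$ and $k$), sets $\hat g_i^k=\nabla f_{\xi_i^k}(x^k)$, $g_i^k=\hat g_i^k-h_i^k+h^k$ with $h^k=\frac1n\sum_ih_i^k$, $v_i^k=\mathcal C(e_i^k+\gamma g_i^k)$, $e_i^{k+1}=e_i^k+\gamma g_i^k-v_i^k$, $h_i^{k+1}=h_i^k+\alpha Q(\hat g_i^k-h_i^k)$; then $x^{k+1}=x^k-\frac1n\sum_iv_i^k$. Parametric assumption: let $g^k=\frac1n\sum_ig_i^k$, $e^k=\frac1n\sum_ie_i^k$, $\mathbf E_k$ the conditional expectation given all randomness generated before iteration $k$, $\bar g_i^k=\mathbf E_k[g_i^k]$. For all $k,K\ge0$: $\mathbf E_k[g^k]=\nabla f(x^k)$; $\frac1n\sum_i\|\bar g_i^k\|^2\le2A(f(x^k)-f(x^* ))+B_1\sigma_{1,k}^2+B_2\sigma_{2,k}^2+D_1$; $\frac1n\sum_i\mathbf E_k\|g_i^k-\bar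 g_i^k\|^2\le2\widetilde A(f(x^k)-f(x^* ))+\widetilde B_1\sigma_{1,k}^2+\widetilde B_2\sigma_{2,k}^2+\widetilde D_1$; $\mathbf E_k\|g^k\|^2\le2A'(f(x^k)-f(x^* ))+B_1'\sigma_{1,k}^2+B_2'\sigma_{2,k}^2+D_1'$; $\mathbf E_k[\sigma_{1,k+1}^2]\le(1-\rho_1)\sigma_{1,k}^2+2C_1(f(x^k)-f(x^* ))+G\rho_1\sigma_{2,k}^2+D_2$; $\mathbf E_k[\sigma_{2,k+1}^2]\le(1-\rho_2)\sigma_{2,k}^2+2C_2(f(x^k)-f(x^* ))$; $3L\sum_{k=0}^Kw_k\mathbf E\|e^k\|^2\le\frac14\sum_{k=0}^Kw_k\mathbf E[f(x^k)-f(x^* )]+F_1\sigma_{1,0}^2+F_2\sigma_{2,0}^2+\gamma D_3W_K$, where $w_k=(1-\eta)^{-(k+1)}$, $W_K=\sum_{k=0}^Kw_k$, $\eta=\min\{\frac{\gamma\mu}2,\frac{\rho_1}4,\frac{\rho_2}4\}$. Also $\bar x^K=\frac1{W_K}\sum_{k=0}^Kw_kx^k$. *)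

theory Defs
  imports "HOL-Probability.Probability"
begin

section \<open>Functions on a Euclidean space\<close>

definition grad :: "('a::euclidean_space \<Rightarrow> real) \<Rightarrow> 'a \<Rightarrow> 'a" where
  "grad h x = (THE D. GDERIV h x :> D)"

definition L_smooth :: "real \<Rightarrow> ('a::euclidean_space \<Rightarrow> real) \<Rightarrow> bool" where
  "L_smooth L h \<longleftrightarrow> (\<forall>x. h differentiable (at x)) \<and> L-lipschitz_on UNIV (grad h)"

definition bregman :: "('a::euclidean_space \<Rightarrow> real) \<Rightarrow> 'a \<Rightarrow> 'a \<Rightarrow> real" where
  "bregman h x y = h x - h y - grad h y \<bullet> (x - y)"

definition unique_minimizer :: "('a \<Rightarrow> real) \<Rightarrow> 'a \<Rightarrow> bool" where
  "unique_minimizer h xs \<longleftrightarrow> (\<forall>x. h xs \<le> h x) \<and> (\<forall>y. (\<forall>x. h y \<le> h x) \<longrightarrow> y = xs)"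

definition quasi_strongly_convex :: "real \<Rightarrow> ('a::euclidean_space \<Rightarrow> real) \<Rightarrow> 'a \<Rightarrow> bool" where
  "quasi_strongly_convex \<mu> h xs \<longleftrightarrow> unique_minimizer h xs \<and>
     (\<forall>x. h xs \<ge> h x + grad h x \<bullet> (xs - x) + \<mu> / 2 * (norm (x - xs))\<^sup>2)"

section \<open>The finite sum and its stochastic reformulation\<close>

text \<open>Workers and local summands are indexed by finite types \<open>'n\<close> and \<open>'m\<close>, so that
  \<open>n = CARD('n)\<close> and \<open>m = CARD('m)\<close>; the function \<open>F i j\<close> is the \<open>j\<close>-th summand of worker \<open>i\<close>.\<close>

definition mean :: "('i::finite \<Rightarrow> 'b::real_vector) \<Rightarrow> 'b" where
  "mean a = (1 / real CARD('i)) *\<^sub>R (\<Sum>i\<in>UNIV. a i)"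

definition f_loc :: "('n \<Rightarrow> 'm::finite \<Rightarrow> 'a \<Rightarrow> real) \<Rightarrow> 'n \<Rightarrow> 'a \<Rightarrow> real" where
  "f_loc F i x = mean (\<lambda>j. F i j x)"

definition f_glob :: "('n::finite \<Rightarrow> 'm::finite \<Rightarrow> 'a \<Rightarrow> real) \<Rightarrow> 'a \<Rightarrow> real" where
  "f_glob F x = mean (\<lambda>i. f_loc F i x)"

definition f_smp :: "('n \<Rightarrow> 'm::finite \<Rightarrow> 'a \<Rightarrow> real) \<Rightarrow> 'n \<Rightarrow> real^'m \<Rightarrow> 'a \<Rightarrow> real" where
  "f_smp F i u x = mean (\<lambda>j. u $ j * F i j x)"

definition sampling_distr :: "('n \<Rightarrow> (real^'m) measure) \<Rightarrow> bool" where
  "sampling_distr \<D> \<longleftrightarrow> (\<forall>i. prob_space (\<D> i) \<and> sets (\<D> i) = sets borel \<and>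
     (\<forall>j. has_bochner_integral (\<D> i) (\<lambda>u. u $ j) 1))"

text \<open>Here and below, second moments in hypotheses are Lebesgue integrals in \<open>[0,\<infinity>]\<close>, so that the
  bounds include finiteness.\<close>

definition expected_smoothness ::
  "real \<Rightarrow> ('n \<Rightarrow> 'm::finite \<Rightarrow> 'a::euclidean_space \<Rightarrow> real) \<Rightarrow> ('n \<Rightarrow> (real^'m) measure) \<Rightarrow> 'a \<Rightarrow> bool"
where
  "expected_smoothness \<L> F \<D> xs \<longleftrightarrow> (\<forall>i x.
     (\<integral>\<^sup>+u. ennreal ((norm (grad (f_smp F i u) x - grad (f_smp F i u) xs))\<^sup>2) \<partial>\<D> i)
       \<le> ennreal (2 * \<L> * bregman (f_loc F i) x xs))"

section \<open>Compression and quantization\<close>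

text \<open>A randomized operator is a jointly measurable function of a random seed and of its argument.
  A deterministic operator is one that ignores its seed.\<close>

definition compression :: "real \<Rightarrow> 'c measure \<Rightarrow> ('c \<Rightarrow> 'a::euclidean_space \<Rightarrow> 'a) \<Rightarrow> bool" where
  "compression \<delta> SC C \<longleftrightarrow> 0 < \<delta> \<and> \<delta> \<le> 1 \<and> prob_space SC \<and>
     (\<lambda>(s, x). C s x) \<in> SC \<Otimes>\<^sub>M borel \<rightarrow>\<^sub>M borel \<and>
     (\<forall>x. (\<integral>\<^sup>+s. ennreal ((norm (C s x - x))\<^sup>2) \<partial>SC) \<le> ennreal ((1 - \<delta>) * (norm x)\<^sup>2))"

definition quantization :: "real \<Rightarrow> 'q measure \<Rightarrow> ('q \<Rightarrow> 'a::euclidean_space \<Rightarrow> 'a) \<Rightarrow> bool" where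
  "quantization \<omega> SQ Q \<longleftrightarrow> 0 < \<omega> \<and> prob_space SQ \<and>
     (\<lambda>(s, x). Q s x) \<in> SQ \<Otimes>\<^sub>M borel \<rightarrow>\<^sub>M borel \<and>
     (\<forall>x. has_bochner_integral SQ (\<lambda>s. Q s x) x \<and>
          (\<integral>\<^sup>+s. ennreal ((norm (Q s x - x))\<^sup>2) \<partial>SQ) \<le> ennreal (\<omega> * (norm x)\<^sup>2))"

section \<open>Randomness of the method\<close>

text \<open>Iteration \<open>k\<close> of worker \<open>i\<close> uses the sample \<open>\<xi> k i\<close> and the seeds \<open>\<zeta> k i\<close> (compression) and
  \<open>\<theta> k i\<close> (quantization). Mutual independence of all these variables, which have three different
  types, is expressed by independence of the triples together with the product law of each triple.\<close>

definition draw_space ::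
  "('n \<Rightarrow> 'u measure) \<Rightarrow> 'c measure \<Rightarrow> 'q measure \<Rightarrow> 'n \<Rightarrow> ('u \<times> 'c \<times> 'q) measure" where
  "draw_space \<D> SC SQ i = \<D> i \<Otimes>\<^sub>M (SC \<Otimes>\<^sub>M SQ)"

definition draw ::
  "(nat \<Rightarrow> 'n \<Rightarrow> 'z \<Rightarrow> 'u) \<Rightarrow> (nat \<Rightarrow> 'n \<Rightarrow> 'z \<Rightarrow> 'c) \<Rightarrow> (nat \<Rightarrow> 'n \<Rightarrow> 'z \<Rightarrow> 'q) \<Rightarrow>
   nat \<Rightarrow> 'n \<Rightarrow> 'z \<Rightarrow> 'u \<times> 'c \<times> 'q" where
  "draw \<xi> \<zeta> \<theta> k i z = (\<xi> k i z, \<zeta> k i z, \<theta> k i z)"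

definition fresh_draws ::
  "'z measure \<Rightarrow> ('n \<Rightarrow> 'u measure) \<Rightarrow> 'c measure \<Rightarrow> 'q measure \<Rightarrow>
   (nat \<Rightarrow> 'n \<Rightarrow> 'z \<Rightarrow> 'u) \<Rightarrow> (nat \<Rightarrow> 'n \<Rightarrow> 'z \<Rightarrow> 'c) \<Rightarrow> (nat \<Rightarrow> 'n \<Rightarrow> 'z \<Rightarrow> 'q) \<Rightarrow> bool" where
  "fresh_draws M \<D> SC SQ \<xi> \<zeta> \<theta> \<longleftrightarrow>
     prob_space.indep_vars M (\<lambda>(k, i). draw_space \<D> SC SQ i) (\<lambda>(k, i). draw \<xi> \<zeta> \<theta> k i) UNIV \<and>
     (\<forall>k i. distr M (draw_space \<D> SC SQ i) (draw \<xi> \<zeta> \<theta> k i) = draw_space \<D> SC SQ i)"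

text \<open>The sigma-algebra generated by the variables \<open>U l i\<close> with \<open>l < k\<close>.\<close>

definition history ::
  "'z measure \<Rightarrow> ('n \<Rightarrow> 'u measure) \<Rightarrow> (nat \<Rightarrow> 'n \<Rightarrow> 'z \<Rightarrow> 'u) \<Rightarrow> nat \<Rightarrow> 'z measure" where
  "history M N U k = sigma (space M) {U l i -` B \<inter> space M | l i B. l < k \<and> B \<in> sets (N i)}"

text \<open>The library has conditional expectations of real random variables only; vectors are treated
  coordinatewise.\<close>

definition vec_cond_exp :: "'z measure \<Rightarrow> 'z measure \<Rightarrow> ('z \<Rightarrow> 'a::euclidean_space) \<Rightarrow> 'z \<Rightarrow> 'a" where
  "vec_cond_exp M G X z = (\<Sum>b\<in>Basis. real_cond_exp M G (\<lambda>z. X z \<bullet> b) z *\<^sub>R b)"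

section \<open>EC-SGDsr-DIANA\<close>

text \<open>Holds iff \<open>x, gh, g, v, e, h\<close> are the processes generated by the method from \<open>x0\<close> and
  \<open>h0\<close>; \<open>gh\<close> is the stochastic gradient before the shift by \<open>h\<close>.\<close>

definition EC_SGDsr_DIANA ::
  "('n::finite \<Rightarrow> 'm::finite \<Rightarrow> 'a::euclidean_space \<Rightarrow> real) \<Rightarrow> ('c \<Rightarrow> 'a \<Rightarrow> 'a) \<Rightarrow> ('q \<Rightarrow> 'a \<Rightarrow> 'a) \<Rightarrow>
   real \<Rightarrow> real \<Rightarrow> 'a \<Rightarrow> ('n \<Rightarrow> 'a) \<Rightarrow> 'z measure \<Rightarrow>
   (nat \<Rightarrow> 'n \<Rightarrow> 'z \<Rightarrow> real^'m) \<Rightarrow> (nat \<Rightarrow> 'n \<Rightarrow> 'z \<Rightarrow> 'c) \<Rightarrow> (nat \<Rightarrow> 'n \<Rightarrow> 'z \<Rightarrow> 'q) \<Rightarrow>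
   (nat \<Rightarrow> 'z \<Rightarrow> 'a) \<Rightarrow> (nat \<Rightarrow> 'n \<Rightarrow> 'z \<Rightarrow> 'a) \<Rightarrow> (nat \<Rightarrow> 'n \<Rightarrow> 'z \<Rightarrow> 'a) \<Rightarrow>
   (nat \<Rightarrow> 'n \<Rightarrow> 'z \<Rightarrow> 'a) \<Rightarrow> (nat \<Rightarrow> 'n \<Rightarrow> 'z \<Rightarrow> 'a) \<Rightarrow> (nat \<Rightarrow> 'n \<Rightarrow> 'z \<Rightarrow> 'a) \<Rightarrow> bool"
where
  "EC_SGDsr_DIANA F C Q \<gamma> \<alpha> x0 h0 M \<xi> \<zeta> \<theta> x gh g v e h \<longleftrightarrow> (\<forall>z\<in>space M.
     x 0 z = x0 \<and>
     (\<forall>i. e 0 i z = 0 \<and> h 0 i z = h0 i) \<and>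
     (\<forall>k i. gh k i z = grad (f_smp F i (\<xi> k i z)) (x k z) \<and>
            g k i z = gh k i z - h k i z + mean (\<lambda>l. h k l z) \<and>
            v k i z = C (\<zeta> k i z) (e k i z + \<gamma> *\<^sub>R g k i z) \<and>
            e (Suc k) i z = e k i z + \<gamma> *\<^sub>R g k i z - v k i z \<and>
            h (Suc k) i z = h k i z + \<alpha> *\<^sub>R Q (\<theta> k i z) (gh k i z - h k i z)) \<and>
     (\<forall>k. x (Suc k) z = x k z - mean (\<lambda>i. v k i z)))"

section \<open>The parametric assumption\<close>

text \<open>Primes are part of the names; the suffix \<open>t\<close> stands for a tilde.\<close>

record ec_params =
  pA :: real
  pAt :: real
  pA' :: real
  pB1 :: real
  pB2 :: real
  pB1t :: real
  pB2t :: real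
  pB1' :: real
  pB2' :: real
  pC1 :: real
  pC2 :: real
  pD1 :: real
  pD1t :: real
  pD1' :: real
  pD2 :: real
  pD3 :: real
  pF1 :: real
  pF2 :: real
  pG :: real
  p\<rho>1 :: real
  p\<rho>2 :: real

definition rate :: "real \<Rightarrow> real \<Rightarrow> ec_params \<Rightarrow> real" where
  "rate \<gamma> \<mu> p = min (\<gamma> * \<mu> / 2) (min (p\<rho>1 p / 4) (p\<rho>2 p / 4))"

definition wt :: "real \<Rightarrow> nat \<Rightarrow> real" where
  "wt \<eta> k = 1 / (1 - \<eta>) ^ (k + 1)"

definition Wt :: "real \<Rightarrow> nat \<Rightarrow> real" where
  "Wt \<eta> K = (\<Sum>k\<le>K. wt \<eta> k)"

definition wavg :: "real \<Rightarrow> (nat \<Rightarrow> 'z \<Rightarrow> 'a::real_vector) \<Rightarrow> nat \<Rightarrow> 'z \<Rightarrow> 'a" where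
  "wavg \<eta> x K z = (1 / Wt \<eta> K) *\<^sub>R (\<Sum>k\<le>K. wt \<eta> k *\<^sub>R x k z)"

definition M1 :: "ec_params \<Rightarrow> real" where
  "M1 p = 4 * pB1' p / (3 * p\<rho>1 p)"

definition M2 :: "ec_params \<Rightarrow> real" where
  "M2 p = 4 * (pB2' p + 4 / 3 * pG p) / (3 * p\<rho>2 p)"

text \<open>\<open>H k\<close> is the sigma-algebra of everything generated before iteration \<open>k\<close>; the functions
  \<open>\<sigma>1\<close> and \<open>\<sigma>2\<close> stand for the squares \<open>\<sigma>\<^sub>1\<^sup>2\<close> and \<open>\<sigma>\<^sub>2\<^sup>2\<close>. (Conditional) expectations of
  non-integrable functions are junk values in the library, so integrability of every integrand
  is part of the assumption.\<close>

definition parametric_assumption ::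
  "'z measure \<Rightarrow> (nat \<Rightarrow> 'z measure) \<Rightarrow> ('a::euclidean_space \<Rightarrow> real) \<Rightarrow> 'a \<Rightarrow> real \<Rightarrow> real \<Rightarrow> real \<Rightarrow>
   (nat \<Rightarrow> 'z \<Rightarrow> 'a) \<Rightarrow> (nat \<Rightarrow> 'n::finite \<Rightarrow> 'z \<Rightarrow> 'a) \<Rightarrow> (nat \<Rightarrow> 'n \<Rightarrow> 'z \<Rightarrow> 'a) \<Rightarrow>
   (nat \<Rightarrow> 'z \<Rightarrow> real) \<Rightarrow> (nat \<Rightarrow> 'z \<Rightarrow> real) \<Rightarrow> ec_params \<Rightarrow> bool"
where
  "parametric_assumption M H f xs L \<mu> \<gamma> x g e \<sigma>1 \<sigma>2 p \<longleftrightarrow>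
    (let gm = (\<lambda>k z. mean (\<lambda>i. g k i z));
         em = (\<lambda>k z. mean (\<lambda>i. e k i z));
         gb = (\<lambda>k i. vec_cond_exp M (H k) (g k i));
         gap = (\<lambda>k z. f (x k z) - f xs);
         \<eta> = rate \<gamma> \<mu> p
     in
      (\<forall>k. (\<forall>i. integrable M (g k i) \<and> integrable M (\<lambda>z. (norm (g k i z - gb k i z))\<^sup>2)) \<and>
           integrable M (\<lambda>z. (norm (gm k z))\<^sup>2) \<and>
           integrable M (\<lambda>z. (norm (em k z))\<^sup>2) \<and>
           integrable M (gap k) \<and> integrable M (\<sigma>1 k) \<and> integrable M (\<sigma>2 k)) \<and>
      (\<forall>k. AE z in M.
           vec_cond_exp M (H k) (gm k) z = grad f (x k z) \<and>
           mean (\<lambda>i. (norm (gb k i z))\<^sup>2)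
             \<le> 2 * pA p * gap k z + pB1 p * \<sigma>1 k z + pB2 p * \<sigma>2 k z + pD1 p \<and>
           mean (\<lambda>i. real_cond_exp M (H k) (\<lambda>z. (norm (g k i z - gb k i z))\<^sup>2) z)
             \<le> 2 * pAt p * gap k z + pB1t p * \<sigma>1 k z + pB2t p * \<sigma>2 k z + pD1t p \<and>
           real_cond_exp M (H k) (\<lambda>z. (norm (gm k z))\<^sup>2) z
             \<le> 2 * pA' p * gap k z + pB1' p * \<sigma>1 k z + pB2' p * \<sigma>2 k z + pD1' p \<and>
           real_cond_exp M (H k) (\<sigma>1 (Suc k)) z
             \<le> (1 - p\<rho>1 p) * \<sigma>1 k z + 2 * pC1 p * gap k z + pG p * p\<rho>1 p * \<sigma>2 k z + pD2 p \<and>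
           real_cond_exp M (H k) (\<sigma>2 (Suc k)) z
             \<le> (1 - p\<rho>2 p) * \<sigma>2 k z + 2 * pC2 p * gap k z) \<and>
      (\<forall>K. AE z in M.
           3 * L * (\<Sum>k\<le>K. wt \<eta> k * (\<integral>y. (norm (em k y))\<^sup>2 \<partial>M))
             \<le> 1 / 4 * (\<Sum>k\<le>K. wt \<eta> k * (\<integral>y. gap k y \<partial>M))
               + pF1 p * \<sigma>1 0 z + pF2 p * \<sigma>2 0 z + \<gamma> * pD3 p * Wt \<eta> K))"

end

theory Submission
  imports Defs
begin

text \<open>
  The method is analysed through the virtual iterate \<open>x k - mean (e k)\<close>, which moves by exactly
  \<open>- \<gamma> *\<^sub>R mean (g k)\<close>, that is, by a plain SGD step with an unbiased gradient; the error \<open>e\<close> is what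
  compression has kept back so far (\<open>virtual_iterate_step\<close>). One step decreases the expected squared
  distance of the virtual iterate to \<open>xs\<close> by a multiple of the functional gap, up to the gradient
  noise and a term \<open>5 * \<gamma> * L * (norm e)\<^sup>2\<close> for evaluating the gradient at \<open>x\<close> instead of at the
  virtual iterate (\<open>descent_perturbed\<close>, \<open>exp_dist_step\<close>). It remains to control the accumulated error.

  Given the past, the error of a worker contracts by \<open>1 - \<delta> / 2\<close> and is fed by the squared norm of
  the conditional mean of \<open>g\<close> and by its variance (\<open>one_step_error\<close>). The conditional mean is small when the
  gap is small and the shifts \<open>h\<close> are close to the gradients at \<open>xs\<close>: their mean squared distance \<open>\<sigma>\<close> contracts by
  \<open>1 - \<alpha>\<close> and is fed by the gap and by the noise at \<open>xs\<close> (\<open>one_step_shift\<close>). Taking expectations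
  gives two coupled linear recursions driven by the expected gap. Summing them with the
  geometric weights \<open>wt \<eta>\<close> gives \<open>accumulated_error\<close>, where the second bound on \<open>\<gamma>\<close> makes the
  coefficient of the gap small enough to be absorbed (\<open>weighted_sum_coupled\<close>, \<open>gamma_sq\<close>).

  Two points need care. The constant noise terms have to be separated from the recursions
  before the weighted summation: pointwise in \<open>k\<close> they contribute only the fixed point of the
  contraction, and this is the constant \<open>D3\<close>. And at \<open>\<gamma> = 1 / (4 * \<L>)\<close> the descent inequality keeps
  only half of the gap, so the error sum must be bounded with more precise constants than those of the
  parametric assumption. They come from bounding the variance of a stochastic gradient by
  its second moment around the gradient at \<open>xs\<close> (\<open>Var_bound\<close>), which costs \<open>4 * \<L>\<close> times the gap and two thirds
  of \<open>Dt1\<close>; the error sum then satisfies the required bound with \<open>1 / 16\<close> instead of \<open>1 / 4\<close>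
  and with \<open>2 / 3\<close> of \<open>F1\<close> and \<open>D3\<close>.

  On the probabilistic side, the draws of iteration \<open>k\<close> are independent of the history up to
  \<open>k\<close>, and the state at \<open>k\<close> is measurable with respect to that history. Conditional expectations
  are therefore integrals over the draws with the state frozen (\<open>cond_exp_freeze\<close>), so every conditional
  statement reduces to a computation from a fixed state.
\<close>

section \<open>Averages over a finite index type\<close>

lemma mean_add: "mean (\<lambda>i. a i + b i) = mean a + mean b"
  by (simp add: mean_def sum.distrib scaleR_add_right)

lemma mean_diff: "mean (\<lambda>i. a i - b i) = mean a - mean b"
  by (simp add: mean_def sum_subtractf scaleR_diff_right)

lemma mean_scaleR: "mean (\<lambda>i. c *\<^sub>R a i) = c *\<^sub>R mean a"
  by (simp add: mean_def scaleR_sum_right[symmetric])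

lemma mean_mult: "mean (\<lambda>i. c * a i) = c * mean a" for a :: "'i::finite \<Rightarrow> real"
  by (simp add: mean_def sum_distrib_left[symmetric])

lemma mean_const [simp]: "mean (\<lambda>i::'i::finite. c) = c"
  by (simp add: mean_def sum_constant_scaleR)

lemma mean_inner: "mean a \<bullet> b = mean (\<lambda>i. a i \<bullet> b)"
  by (simp add: mean_def inner_sum_left)

lemma mean_mono: "(\<And>i. a i \<le> b i) \<Longrightarrow> mean a \<le> mean b" for a :: "'i::finite \<Rightarrow> real"
  unfolding mean_def by (intro scaleR_left_mono sum_mono) auto

lemma mean_nonneg: "(\<And>i. 0 \<le> a i) \<Longrightarrow> 0 \<le> mean a" for a :: "'i::finite \<Rightarrow> real"
  using mean_mono[of "\<lambda>_. 0" a] by simp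

lemma mean_sq_deviation:
  fixes a :: "'i::finite \<Rightarrow> 'a::real_inner"
  shows "mean (\<lambda>i. (norm (a i - c))\<^sup>2)
    = mean (\<lambda>i. (norm (a i))\<^sup>2) - 2 * (mean a \<bullet> c) + (norm c)\<^sup>2"
proof -
  have "(norm (a i - c))\<^sup>2 = (norm (a i))\<^sup>2 - 2 * (a i \<bullet> c) + (norm c)\<^sup>2" for i
    by (simp add: power2_norm_eq_inner inner_diff_left inner_diff_right inner_commute)
  then show ?thesis
    by (simp add: mean_add mean_diff mean_mult mean_inner)
qed

lemma norm_mean_sq_le:
  fixes a :: "'i::finite \<Rightarrow> 'a::real_inner"
  shows "(norm (mean a))\<^sup>2 \<le> mean (\<lambda>i. (norm (a i))\<^sup>2)"
  using mean_sq_deviation[of a "mean a"]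
    mean_nonneg[of "\<lambda>i. (norm (a i - mean a))\<^sup>2"]
  by (simp add: power2_norm_eq_inner)

lemma mean_sq_centered_le:
  fixes a :: "'i::finite \<Rightarrow> 'a::real_inner"
  shows "mean (\<lambda>i. (norm (a i - mean a))\<^sup>2) \<le> mean (\<lambda>i. (norm (a i))\<^sup>2)"
  using mean_sq_deviation[of a "mean a"] by (simp add: power2_norm_eq_inner)

lemma norm_add_sq_le: "(norm (a + b))\<^sup>2 \<le> 2 * (norm a)\<^sup>2 + 2 * (norm b)\<^sup>2"
  for a b :: "'a::real_inner"
  using zero_le_power2[of "norm (a - b)"]
  by (simp add: power2_norm_eq_inner inner_add_left inner_add_right
      inner_diff_left inner_diff_right inner_commute)

lemma young_inner: "0 < c \<Longrightarrow> 2 * (a \<bullet> b) \<le> c * (norm a)\<^sup>2 + (norm b)\<^sup>2 / c"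
  for a b :: "'a::real_inner"
proof -
  assume c: "0 < c"
  have "0 \<le> (norm (c *\<^sub>R a - b))\<^sup>2 / c" using c by simp
  also have "\<dots> = c * (norm a)\<^sup>2 + (norm b)\<^sup>2 / c - 2 * (a \<bullet> b)"
    using c by (simp only: power2_norm_eq_inner)
      (simp add: inner_diff_left inner_diff_right inner_commute field_simps power2_eq_square)
  finally show ?thesis by simp
qed

section \<open>Gradients of smooth convex functions\<close>

lemma GDERIV_unique:
  assumes "GDERIV h x :> D" "GDERIV h x :> D'"
  shows "D = D'"
proof -
  have "(\<lambda>v. v \<bullet> D) = (\<lambda>v. v \<bullet> D')"
    using assms unfolding gderiv_def by (rule has_derivative_unique)
  then show ?thesis by (metis inner_commute vector_eq_rdot)
qed

lemma grad_eqI: "GDERIV h x :> D \<Longrightarrow> grad h x = D"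
  unfolding grad_def by (blast intro: the_equality GDERIV_unique)

lemma differentiable_GDERIV:
  fixes h :: "'a::euclidean_space \<Rightarrow> real"
  assumes "h differentiable (at x)"
  shows "GDERIV h x :> grad h x"
proof -
  obtain h' where h': "(h has_derivative h') (at x)"
    using assms unfolding differentiable_def by blast
  then interpret bounded_linear h' by (rule has_derivative_bounded_linear)
  define D where "D = (\<Sum>b\<in>Basis. h' b *\<^sub>R b)"
  have "h' v = v \<bullet> D" for v
  proof -
    have "h' v = h' (\<Sum>b\<in>Basis. (v \<bullet> b) *\<^sub>R b)" by (simp add: euclidean_representation)
    also have "\<dots> = v \<bullet> D" by (simp add: sum scaleR D_def inner_sum_right mult.commute)
    finally show ?thesis .
  qed
  then have "h' = (\<lambda>v. v \<bullet> D)" by blast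
  then have "GDERIV h x :> D" using h' unfolding gderiv_def by simp
  then show ?thesis by (simp add: grad_eqI)
qed

lemma GDERIV_mean:
  assumes "\<And>j. GDERIV (F j) x :> D j"
  shows "GDERIV (\<lambda>x. mean (\<lambda>j. F j x)) x :> mean D"
  using assms unfolding gderiv_def mean_def
  by (auto intro!: derivative_eq_intros simp: inner_sum_right fun_eq_iff)

lemma DERIV_along_line:
  fixes h :: "'a::euclidean_space \<Rightarrow> real"
  assumes "h differentiable (at (x + t *\<^sub>R d))"
  shows "DERIV (\<lambda>t. h (x + t *\<^sub>R d)) t :> grad h (x + t *\<^sub>R d) \<bullet> d"
proof -
  have "((\<lambda>t. h (x + t *\<^sub>R d)) has_derivative (\<lambda>s. (s *\<^sub>R d) \<bullet> grad h (x + t *\<^sub>R d))) (at t)"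
  proof (rule has_derivative_compose[of "\<lambda>t. x + t *\<^sub>R d" _ t UNIV h])
    show "((\<lambda>t. x + t *\<^sub>R d) has_derivative (\<lambda>s. s *\<^sub>R d)) (at t)"
      by (auto intro!: derivative_eq_intros)
    show "(h has_derivative (\<lambda>v. v \<bullet> grad h (x + t *\<^sub>R d))) (at (x + t *\<^sub>R d))"
      using differentiable_GDERIV[OF assms] unfolding gderiv_def .
  qed
  moreover have "(\<lambda>s. (s *\<^sub>R d) \<bullet> grad h (x + t *\<^sub>R d)) = (*) (grad h (x + t *\<^sub>R d) \<bullet> d)"
    by (simp add: fun_eq_iff inner_commute)
  ultimately show ?thesis unfolding has_field_derivative_def by simp
qed

text \<open>Along the segment from \<open>x\<close> to \<open>y\<close> the slope of \<open>h\<close> exceeds its initial value by at most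
  \<open>t * L * (norm (y - x))\<^sup>2\<close>; integrating this over \<open>t\<close> gives the quadratic upper model.\<close>

lemma bregman_le:
  fixes h :: "'a::euclidean_space \<Rightarrow> real"
  assumes "L_smooth L h"
  shows "bregman h y x \<le> L / 2 * (norm (y - x))\<^sup>2"
proof -
  define d where "d = y - x"
  define \<psi> where "\<psi> t = h (x + t *\<^sub>R d) - t * (grad h x \<bullet> d) - L / 2 * (norm d)\<^sup>2 * t\<^sup>2" for t :: real
  have deriv: "DERIV \<psi> t :> (grad h (x + t *\<^sub>R d) - grad h x) \<bullet> d - L * (norm d)\<^sup>2 * t" for t
  proof -
    have "DERIV (\<lambda>t. h (x + t *\<^sub>R d)) t :> grad h (x + t *\<^sub>R d) \<bullet> d"
      using assms by (intro DERIV_along_line) (simp add: L_smooth_def)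
    then show ?thesis
      unfolding \<psi>_def by (auto intro!: derivative_eq_intros simp: inner_diff_left)
  qed
  have slope: "(grad h (x + t *\<^sub>R d) - grad h x) \<bullet> d - L * (norm d)\<^sup>2 * t \<le> 0" if "0 \<le> t" for t
  proof -
    have "(grad h (x + t *\<^sub>R d) - grad h x) \<bullet> d \<le> norm (grad h (x + t *\<^sub>R d) - grad h x) * norm d"
      by (rule norm_cauchy_schwarz)
    also have "\<dots> \<le> (L * norm (t *\<^sub>R d)) * norm d"
      using assms lipschitz_onD[of L UNIV "grad h" "x + t *\<^sub>R d" x]
      by (intro mult_right_mono) (auto simp: L_smooth_def dist_norm)
    finally show ?thesis using that by (simp add: power2_eq_square algebra_simps)
  qed
  have "\<psi> 1 \<le> \<psi> 0"
  proof (rule DERIV_nonpos_imp_nonincreasing[where f = \<psi>])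
    show "(0::real) \<le> 1" by simp
  next
    fix t :: real assume "0 \<le> t" "t \<le> 1"
    with deriv[of t] slope[of t] show "\<exists>y. DERIV \<psi> t :> y \<and> y \<le> 0" by blast
  qed
  then show ?thesis by (simp add: \<psi>_def d_def bregman_def)
qed

text \<open>On a line, the derivative at the base point is the limit of secant slopes that are bounded by
  the slope over the whole segment.\<close>

lemma bregman_nonneg:
  fixes h :: "'a::euclidean_space \<Rightarrow> real"
  assumes "convex_on UNIV h" "h differentiable (at x)"
  shows "0 \<le> bregman h y x"
proof -
  define \<phi> where "\<phi> t = h (x + t *\<^sub>R (y - x))" for t :: real
  have conv: "convex_on UNIV \<phi>"
  proof (rule convex_onI)
    fix t a b :: real
    assume t: "0 < t" "t < 1"
    have "x + ((1 - t) *\<^sub>R a + t *\<^sub>R b) *\<^sub>R (y - x)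
        = (1 - t) *\<^sub>R (x + a *\<^sub>R (y - x)) + t *\<^sub>R (x + b *\<^sub>R (y - x))"
      by (simp add: algebra_simps)
    then show "\<phi> ((1 - t) *\<^sub>R a + t *\<^sub>R b) \<le> (1 - t) * \<phi> a + t * \<phi> b"
      unfolding \<phi>_def using convex_onD[OF assms(1), of t] t by simp
  qed simp
  have "DERIV \<phi> 0 :> grad h x \<bullet> (y - x)"
    unfolding \<phi>_def using DERIV_along_line[of h x 0 "y - x"] assms(2) by simp
  then have "(grad h x \<bullet> (y - x)) * (1 - 0) \<le> \<phi> 1 - \<phi> 0"
    by (intro convex_on_imp_above_tangent[OF conv]) simp_all
  then show ?thesis by (simp add: bregman_def \<phi>_def)
qed

text \<open>\<open>bregman h \<sqdot> y\<close> is nonnegative, and by \<open>bregman_le\<close> a gradient step of length \<open>1 / L\<close> from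
  \<open>x\<close> lowers it by at least \<open>(norm (grad h x - grad h y))\<^sup>2 / (2 * L)\<close>.\<close>

lemma grad_diff_sq_le_bregman:
  fixes h :: "'a::euclidean_space \<Rightarrow> real"
  assumes "convex_on UNIV h" "L_smooth L h" "0 < L"
  shows "(norm (grad h x - grad h y))\<^sup>2 \<le> 2 * L * bregman h x y"
proof -
  define G where "G = grad h x - grad h y"
  define w where "w = x - (1 / L) *\<^sub>R G"
  have "0 \<le> bregman h w y"
    using assms by (intro bregman_nonneg) (auto simp: L_smooth_def)
  also have "bregman h w y = bregman h x y + bregman h w x + G \<bullet> (w - x)"
    by (simp add: bregman_def G_def inner_diff_left inner_diff_right)
  also have "bregman h w x \<le> L / 2 * (norm (w - x))\<^sup>2"
    by (rule bregman_le[OF assms(2)])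
  also have "L / 2 * (norm (w - x))\<^sup>2 = (norm G)\<^sup>2 / (2 * L)"
    using assms(3) by (simp add: w_def power_divide power2_eq_square)
  also have "G \<bullet> (w - x) = - (norm G)\<^sup>2 / L"
    by (simp add: w_def power2_norm_eq_inner)
  finally show ?thesis using assms(3) by (simp add: G_def field_simps)
qed

lemma differentiable_imp_borel_measurable:
  fixes h :: "'a::euclidean_space \<Rightarrow> real"
  assumes "\<And>x. h differentiable (at x)"
  shows "h \<in> borel_measurable borel"
proof -
  have "continuous (at x) h" for x by (rule differentiable_imp_continuous_within) (rule assms)
  then show ?thesis
    by (intro borel_measurable_continuous_onI continuous_at_imp_continuous_on) blast
qed

text \<open>Each partial derivative is a pointwise limit of difference quotients.\<close>

lemma borel_measurable_grad:
  fixes h :: "'a::euclidean_space \<Rightarrow> real"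
  assumes diff: "\<And>x. h differentiable (at x)"
  shows "grad h \<in> borel_measurable borel"
proof (subst borel_measurable_euclidean_space, rule ballI)
  fix b :: 'a assume "b \<in> Basis"
  note meas = differentiable_imp_borel_measurable[OF diff]
  define t :: "nat \<Rightarrow> real" where "t n = 1 / real (Suc n)" for n
  show "(\<lambda>x. grad h x \<bullet> b) \<in> borel_measurable borel"
  proof (rule borel_measurable_LIMSEQ_real)
    fix x
    have "(\<lambda>s. (h (x + s *\<^sub>R b) - h x) / s) \<midarrow>0\<rightarrow> grad h x \<bullet> b"
      using DERIV_along_line[of h x 0 b] diff unfolding DERIV_def by simp
    moreover have "t \<longlonglongrightarrow> 0" unfolding t_def by (rule LIMSEQ_Suc[OF lim_1_over_n])
    moreover have "t n \<noteq> 0" for n by (simp add: t_def)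
    ultimately show "(\<lambda>n. (h (x + t n *\<^sub>R b) - h x) / t n) \<longlonglongrightarrow> grad h x \<bullet> b"
      unfolding LIMSEQ_SEQ_conv[symmetric] by blast
  next
    fix n
    show "(\<lambda>x. (h (x + t n *\<^sub>R b) - h x) / t n) \<in> borel_measurable borel"
      by (intro borel_measurable_divide borel_measurable_diff borel_measurable_const meas
          measurable_compose[OF _ meas]) simp_all
  qed
qed

section \<open>Second moments\<close>

lemma vec_cond_exp_measurable: "vec_cond_exp M H X \<in> borel_measurable M"
  unfolding vec_cond_exp_def
  by (intro borel_measurable_sum borel_measurable_scaleR borel_measurable_const
      borel_measurable_cond_exp2)

context prob_space
begin

lemma integrable_of_square_integrable:
  fixes X :: "'a \<Rightarrow> 'b::{banach, second_countable_topology}"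
  assumes "X \<in> borel_measurable M" "integrable M (\<lambda>z. (norm (X z))\<^sup>2)"
  shows "integrable M X"
proof (rule Bochner_Integration.integrable_bound)
  show "integrable M (\<lambda>z. 1 + (norm (X z))\<^sup>2)" using assms(2) by simp
  have "norm (X z) \<le> 1 + (norm (X z))\<^sup>2" for z
  proof -
    have "2 * norm (X z) \<le> 1 + (norm (X z))\<^sup>2"
      using zero_le_power2[of "norm (X z) - 1"] unfolding power2_diff by simp
    then show ?thesis using norm_ge_zero[of "X z"] by linarith
  qed
  then show "AE z in M. norm (X z) \<le> norm (1 + (norm (X z))\<^sup>2)" by (simp add: abs_of_nonneg)
qed (fact assms(1))

text \<open>Bias-variance decomposition of an affine image: the cross term
  \<open>2 * t * ((a + t *\<^sub>R m) \<bullet> (X - m))\<close> integrates to zero.\<close>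

lemma second_moment_affine:
  fixes X :: "'a \<Rightarrow> 'b::euclidean_space"
  assumes X: "has_bochner_integral M X m"
    and sq: "integrable M (\<lambda>z. (norm (X z - m))\<^sup>2)"
  shows "integrable M (\<lambda>z. (norm (a + t *\<^sub>R X z))\<^sup>2)"
    and "(\<integral>z. (norm (a + t *\<^sub>R X z))\<^sup>2 \<partial>M)
      = (norm (a + t *\<^sub>R m))\<^sup>2 + t\<^sup>2 * (\<integral>z. (norm (X z - m))\<^sup>2 \<partial>M)"
proof -
  have int: "integrable M X" and m: "(\<integral>z. X z \<partial>M) = m"
    using X by (auto simp: has_bochner_integral_iff)
  have split: "(norm (a + t *\<^sub>R X z))\<^sup>2
      = (norm (a + t *\<^sub>R m))\<^sup>2 + 2 * t * ((X z - m) \<bullet> (a + t *\<^sub>R m)) + t\<^sup>2 * (norm (X z - m))\<^sup>2" for z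
  proof -
    have "a + t *\<^sub>R X z = (a + t *\<^sub>R m) + t *\<^sub>R (X z - m)" by (simp add: algebra_simps)
    then show ?thesis
      by (simp only: power2_norm_eq_inner)
        (simp add: inner_add_left inner_add_right inner_diff_left inner_diff_right
          inner_commute algebra_simps power2_eq_square)
  qed
  have int': "integrable M (\<lambda>z. (X z - m) \<bullet> (a + t *\<^sub>R m))"
    using int by (intro integrable_inner_left) auto
  show "integrable M (\<lambda>z. (norm (a + t *\<^sub>R X z))\<^sup>2)"
    unfolding split using int' sq by simp
  have "(\<integral>z. (X z - m) \<bullet> (a + t *\<^sub>R m) \<partial>M) = 0"
    using int m by (subst integral_inner_left) (simp_all add: prob_space)
  then show "(\<integral>z. (norm (a + t *\<^sub>R X z))\<^sup>2 \<partial>M)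
      = (norm (a + t *\<^sub>R m))\<^sup>2 + t\<^sup>2 * (\<integral>z. (norm (X z - m))\<^sup>2 \<partial>M)"
    unfolding split using int' sq by (simp add: prob_space)
qed

section \<open>Freezing the past in a conditional expectation\<close>

text \<open>Independence of a sigma-algebra \<open>H\<close> and a random variable \<open>U\<close>, stated for sets of events because the
  points of \<open>M\<close> and the values of \<open>U\<close> have different types.\<close>

definition indep_of :: "'a measure \<Rightarrow> 'b measure \<Rightarrow> ('a \<Rightarrow> 'b) \<Rightarrow> bool" where
  "indep_of H N U \<longleftrightarrow> (\<lambda>z. z) \<in> M \<rightarrow>\<^sub>M H \<and> U \<in> M \<rightarrow>\<^sub>M N \<and>
     indep_set (sets H) {U -` B \<inter> space M | B. B \<in> sets N}"

lemma indep_of_distr_eq: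
  assumes ind: "indep_of H N U" and space: "space H = space M"
  shows "distr M H (\<lambda>z. z) \<Otimes>\<^sub>M distr M N U = distr M (H \<Otimes>\<^sub>M N) (\<lambda>z. (z, U z))"
proof -
  have H: "(\<lambda>z. z) \<in> M \<rightarrow>\<^sub>M H" and U: "U \<in> M \<rightarrow>\<^sub>M N"
    and set: "indep_set (sets H) {U -` B \<inter> space M | B. B \<in> sets N}"
    using ind by (auto simp: indep_of_def)
  interpret H: prob_space "distr M H (\<lambda>z. z)" by (rule prob_space_distr) fact
  interpret N: prob_space "distr M N U" by (rule prob_space_distr) fact
  show ?thesis
  proof (rule pair_measure_eqI)
    fix A B assume "A \<in> sets (distr M H (\<lambda>z. z))" "B \<in> sets (distr M N U)"
    then have A: "A \<in> sets H" and B: "B \<in> sets N" by simp_all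
    have AM: "A \<inter> space M = A" using sets.sets_into_space[OF A] space by auto
    have "emeasure (distr M (H \<Otimes>\<^sub>M N) (\<lambda>z. (z, U z))) (A \<times> B)
        = emeasure M ((\<lambda>z. (z, U z)) -` (A \<times> B) \<inter> space M)"
      using A B by (intro emeasure_distr measurable_Pair H U) auto
    also have "(\<lambda>z. (z, U z)) -` (A \<times> B) \<inter> space M = A \<inter> (U -` B \<inter> space M)"
      using AM by auto
    also have "emeasure M (A \<inter> (U -` B \<inter> space M)) = emeasure M A * emeasure M (U -` B \<inter> space M)"
    proof -
      have "U -` B \<inter> space M \<in> {U -` B \<inter> space M | B. B \<in> sets N}" using B by blast
      then show ?thesis
        using indep_setD[OF set A] by (simp add: emeasure_eq_measure ennreal_mult)
    qed
    also have "\<dots> = emeasure (distr M H (\<lambda>z. z)) A * emeasure (distr M N U) B"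
      using A B H U AM by (simp add: emeasure_distr)
    finally show "emeasure (distr M H (\<lambda>z. z)) A * emeasure (distr M N U) B
        = emeasure (distr M (H \<Otimes>\<^sub>M N) (\<lambda>z. (z, U z))) (A \<times> B)" by simp
  next
    show "sets (distr M H (\<lambda>z. z) \<Otimes>\<^sub>M distr M N U) = sets (distr M (H \<Otimes>\<^sub>M N) (\<lambda>z. (z, U z)))"
      unfolding sets_distr by (rule sets_pair_measure_cong) (rule sets_distr)+
  qed unfold_locales
qed

text \<open>If \<open>U\<close> is independent of the sigma-algebra \<open>H\<close>, the pair \<open>(z, U z)\<close> is distributed like
  \<open>(z, U y)\<close> with \<open>y\<close> drawn independently of \<open>z\<close>. Hence integrating over \<open>U\<close> with the \<open>H\<close>-measurable
  part held fixed computes conditional expectations given \<open>H\<close>.\<close>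

lemma nn_integral_freeze:
  assumes ind: "indep_of H N U" and space: "space H = space M"
    and \<phi>: "case_prod \<phi> \<in> borel_measurable (H \<Otimes>\<^sub>M N)"
  shows "(\<integral>\<^sup>+z. \<phi> z (U z) \<partial>M) = (\<integral>\<^sup>+z. (\<integral>\<^sup>+y. \<phi> z (U y) \<partial>M) \<partial>M)"
proof -
  have H: "(\<lambda>z. z) \<in> M \<rightarrow>\<^sub>M H" and U: "U \<in> M \<rightarrow>\<^sub>M N"
    and eq: "distr M H (\<lambda>z. z) \<Otimes>\<^sub>M distr M N U = distr M (H \<Otimes>\<^sub>M N) (\<lambda>z. (z, U z))"
    using ind by (auto simp: indep_of_def intro!: indep_of_distr_eq space)
  have \<phi>': "case_prod \<phi> \<in> borel_measurable (distr M H (\<lambda>z. z) \<Otimes>\<^sub>M distr M N U)"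
    using \<phi> measurable_cong_sets[OF sets_pair_measure_cong[OF sets_distr sets_distr] refl] by blast
  interpret N: prob_space "distr M N U" by (rule prob_space_distr) fact
  have "(\<integral>\<^sup>+z. \<phi> z (U z) \<partial>M) = (\<integral>\<^sup>+w. case_prod \<phi> w \<partial>distr M (H \<Otimes>\<^sub>M N) (\<lambda>z. (z, U z)))"
    using \<phi> H U by (subst nn_integral_distr) auto
  also have "\<dots> = (\<integral>\<^sup>+w. case_prod \<phi> w \<partial>(distr M H (\<lambda>z. z) \<Otimes>\<^sub>M distr M N U))"
    by (simp only: eq)
  also have "\<dots> = (\<integral>\<^sup>+z. (\<integral>\<^sup>+u. \<phi> z u \<partial>distr M N U) \<partial>distr M H (\<lambda>z. z))"
    by (subst N.nn_integral_fst[OF \<phi>', symmetric]) simp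
  also have "\<dots> = (\<integral>\<^sup>+z. (\<integral>\<^sup>+u. \<phi> z u \<partial>distr M N U) \<partial>M)"
    using N.borel_measurable_nn_integral[OF \<phi>'] by (subst nn_integral_distr[OF H]) simp_all
  also have "\<dots> = (\<integral>\<^sup>+z. (\<integral>\<^sup>+y. \<phi> z (U y) \<partial>M) \<partial>M)"
  proof (rule nn_integral_cong)
    fix z assume "z \<in> space M"
    then have z: "z \<in> space H" using measurable_space[OF H] by simp
    show "(\<integral>\<^sup>+u. \<phi> z u \<partial>distr M N U) = (\<integral>\<^sup>+y. \<phi> z (U y) \<partial>M)"
      using measurable_compose[OF measurable_Pair1'[OF z] \<phi>]
      by (subst nn_integral_distr[OF U]) (simp_all add: comp_def)
  qed
  finally show ?thesis .
qed

lemma expectation_freeze: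
  fixes \<phi> :: "'a \<Rightarrow> 'b \<Rightarrow> real"
  assumes ind: "indep_of H N U" and space: "space H = space M"
    and \<phi>: "case_prod \<phi> \<in> borel_measurable (H \<Otimes>\<^sub>M N)"
    and int: "integrable M (\<lambda>z. \<phi> z (U z))"
  shows "integrable M (\<lambda>z. \<integral>y. \<phi> z (U y) \<partial>M)"
    and "(\<lambda>z. \<integral>y. \<phi> z (U y) \<partial>M) \<in> borel_measurable H"
    and "(\<integral>z. \<phi> z (U z) \<partial>M) = (\<integral>z. (\<integral>y. \<phi> z (U y) \<partial>M) \<partial>M)"
proof -
  have H: "(\<lambda>z. z) \<in> M \<rightarrow>\<^sub>M H" and U: "U \<in> M \<rightarrow>\<^sub>M N"
    and eq: "distr M H (\<lambda>z. z) \<Otimes>\<^sub>M distr M N U = distr M (H \<Otimes>\<^sub>M N) (\<lambda>z. (z, U z))"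
    using ind by (auto simp: indep_of_def intro!: indep_of_distr_eq space)
  have \<phi>': "case_prod \<phi> \<in> borel_measurable (distr M H (\<lambda>z. z) \<Otimes>\<^sub>M distr M N U)"
    using \<phi> measurable_cong_sets[OF sets_pair_measure_cong[OF sets_distr sets_distr] refl] by blast
  interpret N: prob_space "distr M N U" by (rule prob_space_distr) fact
  interpret H: prob_space "distr M H (\<lambda>z. z)" by (rule prob_space_distr) fact
  interpret P: pair_prob_space "distr M H (\<lambda>z. z)" "distr M N U" ..
  have inner: "(\<integral>u. \<phi> z u \<partial>distr M N U) = (\<integral>y. \<phi> z (U y) \<partial>M)" if "z \<in> space H" for z
    using measurable_compose[OF measurable_Pair1'[OF that] \<phi>]
    by (subst integral_distr[OF U]) (simp_all add: comp_def)
  have meas: "(\<lambda>z. \<integral>u. \<phi> z u \<partial>distr M N U) \<in> borel_measurable H"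
    using N.borel_measurable_lebesgue_integral[OF \<phi>'] by simp
  show H_meas: "(\<lambda>z. \<integral>y. \<phi> z (U y) \<partial>M) \<in> borel_measurable H"
    using meas by (simp add: inner cong: measurable_cong)
  have prod: "integrable (distr M H (\<lambda>z. z) \<Otimes>\<^sub>M distr M N U) (case_prod \<phi>)"
    unfolding eq using \<phi> H U int by (subst integrable_distr_eq) auto
  have "integrable (distr M H (\<lambda>z. z)) (\<lambda>z. \<integral>u. \<phi> z u \<partial>distr M N U)"
    using P.integrable_fst'[OF prod] by simp
  then have "integrable M (\<lambda>z. \<integral>u. \<phi> z u \<partial>distr M N U)"
    using H meas by (subst (asm) integrable_distr_eq) auto
  moreover have sp: "z \<in> space H" if "z \<in> space M" for z
    using measurable_space[OF H that] .
  ultimately show "integrable M (\<lambda>z. \<integral>y. \<phi> z (U y) \<partial>M)"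
    by (subst (asm) Bochner_Integration.integrable_cong[OF refl inner]) auto
  have "(\<integral>z. \<phi> z (U z) \<partial>M) = (\<integral>w. case_prod \<phi> w \<partial>distr M (H \<Otimes>\<^sub>M N) (\<lambda>z. (z, U z)))"
    using \<phi> H U by (subst integral_distr) auto
  also have "\<dots> = (\<integral>z. (\<integral>u. \<phi> z u \<partial>distr M N U) \<partial>distr M H (\<lambda>z. z))"
    unfolding eq[symmetric] using P.integral_fst'[OF prod] by simp
  also have "\<dots> = (\<integral>z. (\<integral>u. \<phi> z u \<partial>distr M N U) \<partial>M)"
    using H meas by (subst integral_distr) auto
  also have "\<dots> = (\<integral>z. (\<integral>y. \<phi> z (U y) \<partial>M) \<partial>M)"
    by (rule Bochner_Integration.integral_cong) (simp_all add: inner sp)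
  finally show "(\<integral>z. \<phi> z (U z) \<partial>M) = (\<integral>z. (\<integral>y. \<phi> z (U y) \<partial>M) \<partial>M)" .
qed

lemma subalgebra_sigma_finite:
  "subalgebra M H \<Longrightarrow> sigma_finite_subalgebra M H"
  by (intro finite_measure_subalgebra_is_sigma_finite finite_measure_subalgebra.intro
      finite_measure_subalgebra_axioms.intro finite_measure_axioms)

lemma cond_exp_freeze:
  fixes \<phi> :: "'a \<Rightarrow> 'b \<Rightarrow> real"
  assumes sub: "subalgebra M H"
    and ind: "indep_of H N U"
    and \<phi>: "case_prod \<phi> \<in> borel_measurable (H \<Otimes>\<^sub>M N)"
    and int: "integrable M (\<lambda>z. \<phi> z (U z))"
  shows "AE z in M. real_cond_exp M H (\<lambda>z. \<phi> z (U z)) z = (\<integral>y. \<phi> z (U y) \<partial>M)"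
proof -
  have space: "space H = space M" using sub by (simp add: subalgebra_def)
  interpret S: sigma_finite_subalgebra M H by (rule subalgebra_sigma_finite[OF sub])
  show ?thesis
  proof (rule S.real_cond_exp_charact)
    fix A assume A: "A \<in> sets H"
    then have AM: "A \<in> sets M" using sub by (auto simp: subalgebra_def)
    let ?\<psi> = "\<lambda>z u. indicator A z * \<phi> z u"
    have "case_prod ?\<psi> \<in> borel_measurable (H \<Otimes>\<^sub>M N)"
    proof -
      have "(\<lambda>w. indicator A (fst w) * case_prod \<phi> w) \<in> borel_measurable (H \<Otimes>\<^sub>M N)"
        by (intro borel_measurable_times \<phi> measurable_compose[OF measurable_fst])
          (use A in simp)
      then show ?thesis by (simp add: case_prod_unfold)
    qed
    moreover have "integrable M (\<lambda>z. ?\<psi> z (U z))"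
      using integrable_mult_indicator[OF AM int] by simp
    ultimately have "(\<integral>z. ?\<psi> z (U z) \<partial>M) = (\<integral>z. (\<integral>y. ?\<psi> z (U y) \<partial>M) \<partial>M)"
      by (rule expectation_freeze(3)[OF ind space])
    then show "(\<integral>z\<in>A. \<phi> z (U z) \<partial>M) = (\<integral>z\<in>A. (\<integral>y. \<phi> z (U y) \<partial>M) \<partial>M)"
      by (simp add: set_lebesgue_integral_def)
  qed (use int expectation_freeze[OF ind space \<phi> int] in auto)
qed

text \<open>Boundedness of the frozen integral by an integrable function already yields integrability, by
  Tonelli. This is how square integrability passes from one iterate to the next.\<close>

lemma freeze_bound:
  fixes \<phi> :: "'a \<Rightarrow> 'b \<Rightarrow> real"
  assumes sub: "subalgebra M H"
    and ind: "indep_of H N U"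
    and \<phi>: "case_prod \<phi> \<in> borel_measurable (H \<Otimes>\<^sub>M N)"
    and X: "\<And>z. z \<in> space M \<Longrightarrow> X z = \<phi> z (U z)"
    and nonneg: "\<And>z u. 0 \<le> \<phi> z u"
    and r: "integrable M r" "\<And>z. 0 \<le> r z"
    and bound: "\<And>z. z \<in> space M \<Longrightarrow> (\<integral>\<^sup>+y. ennreal (\<phi> z (U y)) \<partial>M) \<le> ennreal (r z)"
  shows "integrable M X"
    and "AE z in M. real_cond_exp M H X z \<le> r z"
    and "(\<integral>z. X z \<partial>M) \<le> (\<integral>z. r z \<partial>M)"
proof -
  interpret S: sigma_finite_subalgebra M H by (rule subalgebra_sigma_finite[OF sub])
  have HU: "(\<lambda>z. z) \<in> M \<rightarrow>\<^sub>M H" "U \<in> M \<rightarrow>\<^sub>M N"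
    using ind by (auto simp: indep_of_def)
  have space: "space H = space M" using sub by (simp add: subalgebra_def)
  have meas: "(\<lambda>z. \<phi> z (U z)) \<in> borel_measurable M"
    using measurable_compose[OF measurable_Pair[OF HU] \<phi>] by simp
  have X_meas: "X \<in> borel_measurable M"
    using meas by (subst measurable_cong[OF X])
  have "(\<integral>\<^sup>+z. ennreal (\<phi> z (U z)) \<partial>M) = (\<integral>\<^sup>+z. (\<integral>\<^sup>+y. ennreal (\<phi> z (U y)) \<partial>M) \<partial>M)"
    using \<phi> by (intro nn_integral_freeze[OF ind space]) (simp add: case_prod_unfold)
  also have "\<dots> \<le> (\<integral>\<^sup>+z. ennreal (r z) \<partial>M)"
    by (rule nn_integral_mono) (rule bound)
  also have "\<dots> = ennreal (\<integral>z. r z \<partial>M)"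
    using r by (intro nn_integral_eq_integral) auto
  finally have le: "(\<integral>\<^sup>+z. ennreal (\<phi> z (U z)) \<partial>M) \<le> ennreal (\<integral>z. r z \<partial>M)" .
  have int: "integrable M (\<lambda>z. \<phi> z (U z))"
    using le nonneg meas by (intro integrableI_nonneg) (auto intro: le_less_trans)
  then show "integrable M X"
    by (subst Bochner_Integration.integrable_cong[OF refl X])
  have "(\<integral>z. \<phi> z (U z) \<partial>M) \<le> (\<integral>z. r z \<partial>M)"
    using le r(2) by (intro integral_real_bounded Bochner_Integration.integral_nonneg) auto
  then show "(\<integral>z. X z \<partial>M) \<le> (\<integral>z. r z \<partial>M)"
    by (subst Bochner_Integration.integral_cong[OF refl X])
  have "(\<integral>y. \<phi> z (U y) \<partial>M) \<le> r z" if "z \<in> space M" for z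
    using bound[OF that] r(2) by (intro integral_real_bounded)
  then have "AE z in M. (\<integral>y. \<phi> z (U y) \<partial>M) \<le> r z" by (rule AE_I2)
  moreover have "AE z in M. real_cond_exp M H X z = real_cond_exp M H (\<lambda>z. \<phi> z (U z)) z"
    by (rule S.real_cond_exp_cong[OF AE_I2[OF X] X_meas meas])
  ultimately show "AE z in M. real_cond_exp M H X z \<le> r z"
    using cond_exp_freeze[OF sub ind \<phi> int] by eventually_elim simp
qed

text \<open>The vector version works coordinatewise; the almost sure statements for the finitely many basis
  vectors combine.\<close>

lemma vec_cond_exp_freeze:
  fixes \<phi> :: "'a \<Rightarrow> 'b \<Rightarrow> 'v::euclidean_space"
  assumes sub: "subalgebra M H"
    and ind: "indep_of H N U"
    and \<phi>: "case_prod \<phi> \<in> borel_measurable (H \<Otimes>\<^sub>M N)"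
    and X: "\<And>z. z \<in> space M \<Longrightarrow> X z = \<phi> z (U z)"
    and int: "integrable M X"
    and m: "\<And>z. z \<in> space M \<Longrightarrow> has_bochner_integral M (\<lambda>y. \<phi> z (U y)) (m z)"
  shows "AE z in M. vec_cond_exp M H X z = m z"
proof -
  interpret S: sigma_finite_subalgebra M H by (rule subalgebra_sigma_finite[OF sub])
  have "AE z in M. real_cond_exp M H (\<lambda>z. X z \<bullet> b) z = m z \<bullet> b" for b
  proof -
    have int\<phi>: "integrable M (\<lambda>z. \<phi> z (U z))"
      using int by (subst (asm) Bochner_Integration.integrable_cong[OF refl X])
    then have int': "integrable M (\<lambda>z. \<phi> z (U z) \<bullet> b)" by simp
    have \<phi>': "case_prod (\<lambda>z u. \<phi> z u \<bullet> b) \<in> borel_measurable (H \<Otimes>\<^sub>M N)"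
      using \<phi> by (simp add: case_prod_unfold)
    have "AE z in M. (\<integral>y. \<phi> z (U y) \<bullet> b \<partial>M) = m z \<bullet> b"
    proof (rule AE_I2)
      fix z assume "z \<in> space M"
      then have "has_bochner_integral M (\<lambda>y. \<phi> z (U y) \<bullet> b) (m z \<bullet> b)"
        by (intro has_bochner_integral_inner_left m)
      then show "(\<integral>y. \<phi> z (U y) \<bullet> b \<partial>M) = m z \<bullet> b" by (simp add: has_bochner_integral_iff)
    qed
    moreover have "AE z in M. real_cond_exp M H (\<lambda>z. X z \<bullet> b) z
        = real_cond_exp M H (\<lambda>z. \<phi> z (U z) \<bullet> b) z"
      using X int int' by (intro S.real_cond_exp_cong AE_I2) auto
    ultimately show ?thesis
      using cond_exp_freeze[OF sub ind \<phi>' int'] by eventually_elim simp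
  qed
  then have "AE z in M. \<forall>b\<in>Basis. real_cond_exp M H (\<lambda>z. X z \<bullet> b) z = m z \<bullet> b"
    by (intro AE_finite_allI) auto
  then show ?thesis
    by eventually_elim (simp add: vec_cond_exp_def euclidean_representation)
qed

lemma real_cond_exp_mean:
  fixes f :: "'i::finite \<Rightarrow> 'a \<Rightarrow> real"
  assumes sub: "subalgebra M H" and int: "\<And>i. integrable M (f i)"
  shows "AE z in M. real_cond_exp M H (\<lambda>z. mean (\<lambda>i. f i z)) z = mean (\<lambda>i. real_cond_exp M H (f i) z)"
proof -
  interpret S: sigma_finite_subalgebra M H by (rule subalgebra_sigma_finite[OF sub])
  have "AE z in M. real_cond_exp M H (\<lambda>z. (1 / real CARD('i)) * (\<Sum>i\<in>UNIV. f i z)) z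
      = (1 / real CARD('i)) * real_cond_exp M H (\<lambda>z. \<Sum>i\<in>UNIV. f i z) z"
    using int by (intro S.real_cond_exp_cmult) auto
  moreover have "AE z in M. real_cond_exp M H (\<lambda>z. \<Sum>i\<in>UNIV. f i z) z
      = (\<Sum>i\<in>UNIV. real_cond_exp M H (f i) z)"
    using int by (rule S.real_cond_exp_sum)
  ultimately show ?thesis
    by eventually_elim (simp add: mean_def)
qed

end

section \<open>The history and the draws of the current iteration\<close>

lemma space_history [simp]: "space (history M N U k) = space M"
  unfolding history_def by (rule space_measure_of) auto

lemma sets_history:
  "sets (history M N U k)
    = sigma_sets (space M) {U l i -` B \<inter> space M | l i B. l < k \<and> B \<in> sets (N i)}"
  unfolding history_def by (rule sets_measure_of) auto

lemma history_mono: "k \<le> l \<Longrightarrow> sets (history M N U k) \<subseteq> sets (history M N U l)"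
  unfolding sets_history by (rule sigma_sets_mono') (use order_less_le_trans in blast)

lemma measurable_history:
  assumes "U l i \<in> M \<rightarrow>\<^sub>M N i" "l < k"
  shows "U l i \<in> history M N U k \<rightarrow>\<^sub>M N i"
  using assms by (intro measurableI) (auto simp: sets_history measurable_space)

lemma subalgebra_history:
  assumes "\<And>l i. U l i \<in> M \<rightarrow>\<^sub>M N i"
  shows "subalgebra M (history M N U k)"
  unfolding subalgebra_def sets_history
  using measurable_sets[OF assms] by (auto intro!: sets.sigma_sets_subset)

text \<open>The draws of round \<open>k\<close> are indexed by pairs \<open>(k, i)\<close>, as in the independent family, so that the past and
  the present are restrictions of one family to disjoint index sets.\<close>

definition round_space :: "('n \<Rightarrow> 'u measure) \<Rightarrow> nat \<Rightarrow> (nat \<times> 'n \<Rightarrow> 'u) measure" where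
  "round_space N k = PiM ({k} \<times> UNIV) (\<lambda>(l, i). N i)"

definition round_draws :: "(nat \<Rightarrow> 'n \<Rightarrow> 'z \<Rightarrow> 'u) \<Rightarrow> nat \<Rightarrow> 'z \<Rightarrow> nat \<times> 'n \<Rightarrow> 'u" where
  "round_draws U k z = restrict (\<lambda>(l, i). U l i z) ({k} \<times> UNIV)"

lemma round_draws_apply [simp]: "round_draws U k z (k, i) = U k i z"
  by (simp add: round_draws_def)

lemma measurable_round_component: "(\<lambda>u. u (k, i)) \<in> round_space N k \<rightarrow>\<^sub>M N i"
  unfolding round_space_def
  using measurable_component_singleton[of "(k, i)" "{k} \<times> UNIV" "\<lambda>(l, i). N i"] by simp

text \<open>Both sides are built from disjoint groups of the independent family \<open>U l i\<close>: the history up to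
  \<open>k\<close> is contained in the sigma-algebra generated by the joint variable of the earlier rounds.\<close>

lemma (in prob_space) indep_history_round:
  fixes N :: "'n \<Rightarrow> 'u measure" and U :: "nat \<Rightarrow> 'n \<Rightarrow> 'a \<Rightarrow> 'u"
  assumes ind: "indep_vars (\<lambda>(k, i). N i) (\<lambda>(k, i). U k i) UNIV"
  shows "indep_of (history M N U k) (round_space N k) (round_draws U k)"
proof -
  let ?N = "\<lambda>(k::nat, i). N i" and ?U = "\<lambda>(k, i). U k i"
  let ?A = "{..<k} \<times> (UNIV :: 'n set)" and ?B = "{k} \<times> (UNIV :: 'n set)"
  let ?past = "\<lambda>z. restrict (\<lambda>p. ?U p z) ?A" and ?now = "\<lambda>z. restrict (\<lambda>p. ?U p z) ?B"
  have U: "U l i \<in> M \<rightarrow>\<^sub>M N i" for l i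
    using ind unfolding indep_vars_def by (auto dest!: bspec[of _ _ "(l, i)"])
  have iv: "indep_var (PiM ?A ?N) ?past (PiM ?B ?N) ?now"
    by (rule indep_var_restrict[OF ind]) auto
  have round_eq: "round_draws U k = ?now"
    by (auto simp: round_draws_def fun_eq_iff restrict_def)
  define \<A> where "\<A> = sigma_sets (space M) {?past -` B \<inter> space M | B. B \<in> sets (PiM ?A ?N)}"
  define \<B> where "\<B> = sigma_sets (space M) {?now -` B \<inter> space M | B. B \<in> sets (PiM ?B ?N)}"
  have "random_variable (PiM ?A ?N) ?past" "random_variable (PiM ?B ?N) ?now" "indep_set \<A> \<B>"
    using iv unfolding indep_var_eq \<A>_def \<B>_def by auto
  note rv = this(1,2) and ind_set = this(3)
  have "{U l i -` B \<inter> space M | l i B. l < k \<and> B \<in> sets (N i)} \<subseteq> \<A>"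
  proof safe
    fix l i B assume l: "l < k" and B: "B \<in> sets (N i)"
    have "(\<lambda>u. u (l, i)) -` B \<inter> space (PiM ?A ?N) \<in> sets (PiM ?A ?N)"
      using l B measurable_component_singleton[of "(l, i)" ?A ?N]
      by (intro measurable_sets[where A = "N i"]) auto
    then have "?past -` ((\<lambda>u. u (l, i)) -` B \<inter> space (PiM ?A ?N)) \<inter> space M \<in> \<A>"
      unfolding \<A>_def by blast
    moreover have "?past -` ((\<lambda>u. u (l, i)) -` B \<inter> space (PiM ?A ?N)) \<inter> space M
        = U l i -` B \<inter> space M"
      using l measurable_space[OF rv(1)] by auto
    ultimately show "U l i -` B \<inter> space M \<in> \<A>" by simp
  qed
  then have sub: "sets (history M N U k) \<subseteq> \<A>"
    unfolding sets_history by (subst \<A>_def, intro sigma_sets_mono) (simp add: \<A>_def)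
  have sub': "{?now -` B \<inter> space M | B. B \<in> sets (PiM ?B ?N)} \<subseteq> \<B>"
    unfolding \<B>_def by (rule sigma_sets_superset_generator)
  have "indep_set (sets (history M N U k)) {?now -` B \<inter> space M | B. B \<in> sets (PiM ?B ?N)}"
    using ind_set sub sub' unfolding indep_sets2_eq by blast
  moreover have "(\<lambda>z. z) \<in> M \<rightarrow>\<^sub>M history M N U k"
    using subalgebra_history[of U M N k, OF U] by (intro measurableI) (auto simp: subalgebra_def)
  ultimately show ?thesis
    using rv(2) unfolding indep_of_def round_eq round_space_def by blast
qed

section \<open>Weighted sums of linear recursions\<close>

lemma wt_pos: "\<eta> < 1 \<Longrightarrow> 0 < wt \<eta> k"
  by (simp add: wt_def)

lemma wt_Suc: "\<eta> < 1 \<Longrightarrow> (1 - \<eta>) * wt \<eta> (Suc k) = wt \<eta> k"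
  by (simp add: wt_def)

lemma Wt_pos: "\<eta> < 1 \<Longrightarrow> 0 < Wt \<eta> K"
  unfolding Wt_def by (intro sum_pos) (auto simp: wt_pos)

lemma wt_le_Wt: "\<eta> < 1 \<Longrightarrow> wt \<eta> K \<le> Wt \<eta> K"
  unfolding Wt_def by (intro member_le_sum) (auto simp: wt_pos less_imp_le)

text \<open>The weights are chosen so that \<open>wt \<eta> k * u (Suc k)\<close> and \<open>(1 - \<eta>) * wt \<eta> k * u k\<close> are
  consecutive terms of one sequence, so the sum of their differences telescopes.\<close>

lemma weighted_telescope:
  fixes u c b :: "nat \<Rightarrow> real"
  assumes \<eta>: "\<eta> < 1" and u: "\<And>k. 0 \<le> u k"
    and rec: "\<And>k. u (Suc k) \<le> (1 - \<eta>) * u k - c k + b k"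
  shows "(\<Sum>k\<le>K. wt \<eta> k * c k) \<le> u 0 + (\<Sum>k\<le>K. wt \<eta> k * b k)"
proof -
  have step: "wt \<eta> k * u (Suc k) \<le> (1 - \<eta>) * wt \<eta> k * u k - wt \<eta> k * c k + wt \<eta> k * b k" for k
    using mult_left_mono[OF rec[of k], of "wt \<eta> k"] wt_pos[OF \<eta>, of k]
    by (simp add: algebra_simps)
  have "wt \<eta> K * u (Suc K) + (\<Sum>k\<le>K. wt \<eta> k * c k) \<le> u 0 + (\<Sum>k\<le>K. wt \<eta> k * b k)"
  proof (induction K)
    case 0
    have "(1 - \<eta>) * wt \<eta> 0 = 1" using \<eta> by (simp add: wt_def)
    then show ?case using step[of 0] by simp
  next
    case (Suc K)
    then show ?case using step[of "Suc K"] wt_Suc[OF \<eta>, of K] by simp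
  qed
  moreover have "0 \<le> wt \<eta> K * u (Suc K)" using u wt_pos[OF \<eta>, of K] by simp
  ultimately show ?thesis by simp
qed

text \<open>A contraction by \<open>1 - r\<close> leaves the factor \<open>r - \<eta>\<close> after the growth of the weights.\<close>

lemma weighted_sum_contraction:
  fixes u b :: "nat \<Rightarrow> real"
  assumes "\<eta> < 1" "\<And>k. 0 \<le> u k" "\<And>k. u (Suc k) \<le> (1 - r) * u k + b k"
  shows "(r - \<eta>) * (\<Sum>k\<le>K. wt \<eta> k * u k) \<le> u 0 + (\<Sum>k\<le>K. wt \<eta> k * b k)"
proof -
  have "(\<Sum>k\<le>K. wt \<eta> k * ((r - \<eta>) * u k)) \<le> u 0 + (\<Sum>k\<le>K. wt \<eta> k * b k)"
    using assms by (intro weighted_telescope) (auto simp: algebra_simps)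
  then show ?thesis by (simp add: sum_distrib_left mult.left_commute)
qed

primrec driven :: "real \<Rightarrow> real \<Rightarrow> (nat \<Rightarrow> real) \<Rightarrow> nat \<Rightarrow> real" where
  "driven r u0 b 0 = u0"
| "driven r u0 b (Suc k) = (1 - r) * driven r u0 b k + b k"

lemma driven_nonneg: "r \<le> 1 \<Longrightarrow> 0 \<le> u0 \<Longrightarrow> (\<And>k. 0 \<le> b k) \<Longrightarrow> 0 \<le> driven r u0 b k"
  by (induction k) auto

text \<open>Removing the constant inputs from a contraction changes it by at most their fixed point
  \<open>c / r\<close>. This is a pointwise bound, so the weights do not enlarge it.\<close>

lemma le_driven_plus_fixed_point:
  assumes r: "0 < r" "r \<le> 1" and c: "0 \<le> c"
    and rec: "\<And>k. u (Suc k) \<le> (1 - r) * u k + b k + c"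
  shows "u k \<le> driven r (u 0) b k + c / r"
proof (induction k)
  case 0
  show ?case using r c by simp
next
  case (Suc k)
  have "u (Suc k) \<le> (1 - r) * (driven r (u 0) b k + c / r) + b k + c"
    using rec[of k] mult_left_mono[OF Suc, of "1 - r"] r by simp
  also have "\<dots> = driven r (u 0) b (Suc k) + c / r"
    using r by (simp add: field_simps)
  finally show ?case .
qed

text \<open>Two coupled contractions: \<open>s\<close> is driven by \<open>a\<close>, and \<open>E\<close> by \<open>a\<close> and \<open>s\<close>. The constants \<open>c\<close>
  and \<open>d\<close> enter with the factors \<open>2 / \<delta>\<close> and \<open>1 / \<alpha>\<close> of their fixed points; only the responses to
  \<open>a\<close> and to \<open>s 0\<close> are summed with weights and lose the constants \<open>2\<close> and \<open>4 / 3\<close>.\<close>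

lemma weighted_sum_coupled:
  fixes E s a :: "nat \<Rightarrow> real"
  assumes \<eta>: "\<eta> \<le> \<alpha> / 4" "\<eta> \<le> \<delta> / 4"
    and \<alpha>: "0 < \<alpha>" "\<alpha> \<le> 1" and \<delta>: "0 < \<delta>" "\<delta> \<le> 1"
    and nonneg: "0 \<le> P" "0 \<le> R" "0 \<le> B" "0 \<le> c" "0 \<le> d" "\<And>k. 0 \<le> a k" "0 \<le> s 0"
    and E0: "E 0 = 0"
    and E: "\<And>k. E (Suc k) \<le> (1 - \<delta> / 2) * E k + P * a k + R * s k + c"
    and s: "\<And>k. s (Suc k) \<le> (1 - \<alpha>) * s k + B * a k + d"
  shows "(\<Sum>k\<le>K. wt \<eta> k * E k)
    \<le> 4 / \<delta> * ((P + R * (4 / (3 * \<alpha>) * B)) * (\<Sum>k\<le>K. wt \<eta> k * a k) + R * (4 / (3 * \<alpha>)) * s 0)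
      + 2 / \<delta> * (c + R * (d / \<alpha>)) * Wt \<eta> K"
proof -
  have \<eta>1: "\<eta> < 1" using \<eta>(1) \<alpha>(2) by simp
  define s' where "s' = driven \<alpha> (s 0) (\<lambda>k. B * a k)"
  define E' where "E' = driven (\<delta> / 2) 0 (\<lambda>k. P * a k + R * s' k)"
  define A where "A = (\<Sum>k\<le>K. wt \<eta> k * a k)"
  define S where "S = (\<Sum>k\<le>K. wt \<eta> k * s' k)"
  define T where "T = (\<Sum>k\<le>K. wt \<eta> k * E' k)"
  define e where "e = 2 / \<delta> * (c + R * (d / \<alpha>))"
  have s'0: "0 \<le> s' k" for k
    unfolding s'_def using \<alpha> nonneg by (intro driven_nonneg) auto
  have E'0: "0 \<le> E' k" for k
    unfolding E'_def using \<delta> nonneg s'0 by (intro driven_nonneg) auto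
  have s_le: "s k \<le> s' k + d / \<alpha>" for k
    unfolding s'_def using \<alpha> nonneg s by (intro le_driven_plus_fixed_point) auto
  have E_le: "E k \<le> E' k + e" for k
  proof -
    have "E k \<le> driven (\<delta> / 2) (E 0) (\<lambda>k. P * a k + R * s' k) k + (c + R * (d / \<alpha>)) / (\<delta> / 2)"
    proof (rule le_driven_plus_fixed_point)
      fix k
      show "E (Suc k) \<le> (1 - \<delta> / 2) * E k + (P * a k + R * s' k) + (c + R * (d / \<alpha>))"
        using E[of k] mult_left_mono[OF s_le[of k] nonneg(2)] by (simp add: algebra_simps)
    qed (use \<delta> \<alpha> nonneg in auto)
    then show ?thesis by (simp add: E'_def e_def E0 mult.commute)
  qed
  have A0: "0 \<le> A" unfolding A_def using wt_pos[OF \<eta>1] nonneg by (intro sum_nonneg) (simp add: less_imp_le)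
  have S0: "0 \<le> S" unfolding S_def using wt_pos[OF \<eta>1] s'0 by (intro sum_nonneg) (simp add: less_imp_le)
  have T0: "0 \<le> T" unfolding T_def using wt_pos[OF \<eta>1] E'0 by (intro sum_nonneg) (simp add: less_imp_le)
  have "(\<alpha> - \<eta>) * S \<le> s' 0 + (\<Sum>k\<le>K. wt \<eta> k * (B * a k))"
    unfolding S_def using \<eta>1 s'0 by (intro weighted_sum_contraction) (auto simp: s'_def)
  moreover have "3 * \<alpha> / 4 * S \<le> (\<alpha> - \<eta>) * S"
    using \<eta> S0 by (intro mult_right_mono) auto
  moreover have "(\<Sum>k\<le>K. wt \<eta> k * (B * a k)) = B * A"
    by (simp add: A_def sum_distrib_left mult.left_commute)
  ultimately have "3 * \<alpha> / 4 * S \<le> s 0 + B * A" by (simp add: s'_def)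
  then have S_le: "S \<le> 4 / (3 * \<alpha>) * (s 0 + B * A)" using \<alpha> by (simp add: field_simps)
  have "(\<delta> / 2 - \<eta>) * T \<le> E' 0 + (\<Sum>k\<le>K. wt \<eta> k * (P * a k + R * s' k))"
    unfolding T_def using \<eta>1 E'0 by (intro weighted_sum_contraction) (auto simp: E'_def)
  moreover have "\<delta> / 4 * T \<le> (\<delta> / 2 - \<eta>) * T"
    using \<eta> T0 by (intro mult_right_mono) auto
  moreover have "(\<Sum>k\<le>K. wt \<eta> k * (P * a k + R * s' k)) = P * A + R * S"
    by (simp add: A_def S_def sum_distrib_left sum.distrib algebra_simps)
  ultimately have "\<delta> / 4 * T \<le> P * A + R * S" by (simp add: E'_def)
  also have "\<dots> \<le> P * A + R * (4 / (3 * \<alpha>) * (s 0 + B * A))"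
    using S_le nonneg by (intro add_left_mono mult_left_mono)
  finally have "T \<le> 4 / \<delta> * (P * A + R * (4 / (3 * \<alpha>) * (s 0 + B * A)))"
    using \<delta> by (simp add: field_simps)
  moreover have "(\<Sum>k\<le>K. wt \<eta> k * E k) \<le> (\<Sum>k\<le>K. wt \<eta> k * (E' k + e))"
    using E_le wt_pos[OF \<eta>1] by (intro sum_mono mult_left_mono) (auto simp: less_imp_le)
  moreover have "(\<Sum>k\<le>K. wt \<eta> k * (E' k + e)) = T + e * Wt \<eta> K"
    by (simp add: T_def Wt_def sum.distrib sum_distrib_left algebra_simps)
  ultimately have "(\<Sum>k\<le>K. wt \<eta> k * E k)
      \<le> 4 / \<delta> * (P * A + R * (4 / (3 * \<alpha>) * (s 0 + B * A))) + e * Wt \<eta> K" by linarith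
  also have "P * A + R * (4 / (3 * \<alpha>) * (s 0 + B * A))
      = (P + R * (4 / (3 * \<alpha>) * B)) * A + R * (4 / (3 * \<alpha>)) * s 0"
    by (simp add: algebra_simps add_divide_distrib)
  finally show ?thesis by (simp only: e_def A_def)
qed

section \<open>The problem and its stochastic gradients\<close>

lemma f_glob_eq: "f_glob F = (\<lambda>y. mean (\<lambda>i. f_loc F i y))"
  by (simp add: f_glob_def fun_eq_iff)

lemma convex_on_mean:
  fixes f :: "'i::finite \<Rightarrow> 'a::real_vector \<Rightarrow> real"
  assumes "\<And>i. convex_on UNIV (f i)"
  shows "convex_on UNIV (\<lambda>y. mean (\<lambda>i. f i y))"
proof (rule convex_onI)
  fix t :: real and y z :: 'a
  assume t: "0 < t" "t < 1"
  have "mean (\<lambda>i. f i ((1 - t) *\<^sub>R y + t *\<^sub>R z)) \<le> mean (\<lambda>i. (1 - t) * f i y + t * f i z)"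
    using convex_onD[OF assms, of t] t by (intro mean_mono) simp
  then show "mean (\<lambda>i. f i ((1 - t) *\<^sub>R y + t *\<^sub>R z))
      \<le> (1 - t) * mean (\<lambda>i. f i y) + t * mean (\<lambda>i. f i z)"
    by (simp add: mean_add mean_mult)
qed simp

lemma L_smooth_mean:
  fixes f :: "'i::finite \<Rightarrow> 'a::euclidean_space \<Rightarrow> real"
  assumes "\<And>i. L_smooth L (f i)"
  shows "grad (\<lambda>y. mean (\<lambda>i. f i y)) x = mean (\<lambda>i. grad (f i) x)"
    and "L_smooth L (\<lambda>y. mean (\<lambda>i. f i y))"
proof -
  have gd: "GDERIV (\<lambda>y. mean (\<lambda>i. f i y)) x :> mean (\<lambda>i. grad (f i) x)" for x
    using assms by (intro GDERIV_mean differentiable_GDERIV) (auto simp: L_smooth_def)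
  note gr = grad_eqI[OF this]
  show "grad (\<lambda>y. mean (\<lambda>i. f i y)) x = mean (\<lambda>i. grad (f i) x)" by (rule gr)
  have L: "0 \<le> L" using assms[of undefined] by (auto simp: L_smooth_def dest: lipschitz_on_nonneg)
  have "norm (mean (\<lambda>i. grad (f i) y) - mean (\<lambda>i. grad (f i) z)) \<le> L * norm (y - z)" for y z
  proof -
    have "(norm (mean (\<lambda>i. grad (f i) y) - mean (\<lambda>i. grad (f i) z)))\<^sup>2
        \<le> mean (\<lambda>i. (norm (grad (f i) y - grad (f i) z))\<^sup>2)"
      unfolding mean_diff[symmetric] by (rule norm_mean_sq_le)
    also have "\<dots> \<le> mean (\<lambda>i::'i. (L * norm (y - z))\<^sup>2)"
      using assms lipschitz_onD[of L UNIV "grad (f i)" y z for i]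
      by (intro mean_mono power_mono) (auto simp: L_smooth_def dist_norm)
    finally show ?thesis 
      unfolding mean_const by (rule power2_le_imp_le) (simp add: L)
  qed
  moreover have "(\<lambda>y. mean (\<lambda>i. f i y)) differentiable (at y)" for y
    using gd[of y] unfolding gderiv_def by (rule differentiableI)
  ultimately show "L_smooth L (\<lambda>y. mean (\<lambda>i. f i y))"
    using L by (auto simp: L_smooth_def gr dist_norm intro!: lipschitz_onI)
qed

text \<open>The derivative along the direction \<open>grad h x\<close> is \<open>(norm (grad h x))\<^sup>2\<close> and vanishes at a minimum.\<close>

lemma grad_minimizer_zero:
  fixes h :: "'a::euclidean_space \<Rightarrow> real"
  assumes "h differentiable (at x)" "\<And>y. h x \<le> h y"
  shows "grad h x = 0"
proof -
  have "DERIV (\<lambda>t. h (x + t *\<^sub>R grad h x)) 0 :> grad h x \<bullet> grad h x"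
    using DERIV_along_line[of h x 0 "grad h x"] assms(1) by simp
  then have "grad h x \<bullet> grad h x = 0"
    by (rule DERIV_local_min[of _ _ _ 1]) (use assms(2) in auto)
  then show ?thesis by simp
qed

text \<open>The deterministic part of the setting. Positivity of \<open>L\<close> and \<open>\<L>\<close> is a consequence of the
  two bounds on a positive step size \<open>\<gamma>\<close>, which only enter later.\<close>

locale ec_problem =
  fixes F :: "'n::finite \<Rightarrow> 'm::finite \<Rightarrow> 'a::euclidean_space \<Rightarrow> real"
    and \<D> :: "'n \<Rightarrow> (real^'m) measure"
    and xs :: 'a and L \<L> \<mu> :: real
  assumes diff: "\<And>i j y. F i j differentiable (at y)"
    and conv: "\<And>i. convex_on UNIV (f_loc F i)"
    and smooth: "\<And>i. L_smooth L (f_loc F i)"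
    and qsc: "quasi_strongly_convex \<mu> (f_glob F) xs" and mu: "\<mu> \<ge> 0"
    and sampling: "sampling_distr \<D>"
    and exp_smooth: "expected_smoothness \<L> F \<D> xs"
    and fin_var: "\<And>i. integrable (\<D> i)
          (\<lambda>u. (norm (grad (f_smp F i u) xs - grad (f_loc F i) xs))\<^sup>2)"
    and L_pos: "0 < L" and cL_pos: "0 < \<L>"
begin

definition gap :: "'a \<Rightarrow> real" where
  "gap y = f_glob F y - f_glob F xs"

abbreviation gl :: "'n \<Rightarrow> 'a \<Rightarrow> 'a" where
  "gl i \<equiv> grad (f_loc F i)"

abbreviation gs :: "'n \<Rightarrow> real^'m \<Rightarrow> 'a \<Rightarrow> 'a" where
  "gs i u \<equiv> grad (f_smp F i u)"

lemma gs_eq: "gs i u y = mean (\<lambda>j. (u $ j) *\<^sub>R grad (F i j) y)"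
proof (rule grad_eqI)
  have "GDERIV (\<lambda>y. u $ j * F i j y) y :> (u $ j) *\<^sub>R grad (F i j) y" for j
    using differentiable_GDERIV[OF diff, of i j y] unfolding gderiv_def
    by (auto intro!: derivative_eq_intros simp: mult.commute)
  then show "GDERIV (f_smp F i u) y :> mean (\<lambda>j. (u $ j) *\<^sub>R grad (F i j) y)"
    unfolding f_smp_def by (rule GDERIV_mean)
qed

lemma gl_eq: "gl i y = mean (\<lambda>j. grad (F i j) y)"
proof (rule grad_eqI)
  show "GDERIV (f_loc F i) y :> mean (\<lambda>j. grad (F i j) y)"
    unfolding f_loc_def by (intro GDERIV_mean differentiable_GDERIV diff)
qed

lemma smooth_glob: "L_smooth L (f_glob F)"
  unfolding f_glob_eq by (rule L_smooth_mean(2)) (rule smooth)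

lemma grad_glob: "grad (f_glob F) y = mean (\<lambda>i. gl i y)"
  unfolding f_glob_eq by (rule L_smooth_mean(1)) (rule smooth)

lemma convex_glob: "convex_on UNIV (f_glob F)"
  unfolding f_glob_eq by (rule convex_on_mean) (rule conv)

lemma gap_nonneg: "0 \<le> gap y"
  using qsc by (simp add: gap_def quasi_strongly_convex_def unique_minimizer_def)

lemma grad_glob_xs: "grad (f_glob F) xs = 0"
  using smooth_glob gap_nonneg
  by (intro grad_minimizer_zero) (auto simp: L_smooth_def gap_def)

lemma mean_gl_xs: "mean (\<lambda>i. gl i xs) = 0"
  using grad_glob_xs by (simp add: grad_glob)

lemma bregman_loc_nonneg: "0 \<le> bregman (f_loc F i) y z"
  using conv smooth by (intro bregman_nonneg) (auto simp: L_smooth_def)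

lemma gap_eq_bregman: "gap y = bregman (f_glob F) y xs"
  by (simp add: gap_def bregman_def grad_glob_xs)

lemma gap_eq_mean_bregman: "gap y = mean (\<lambda>i. bregman (f_loc F i) y xs)"
  by (simp add: gap_def bregman_def f_glob_def mean_diff mean_inner[symmetric] mean_gl_xs)

lemma gap_le: "gap y \<le> L / 2 * (norm (y - xs))\<^sup>2"
  unfolding gap_eq_bregman by (rule bregman_le[OF smooth_glob])

lemma grad_glob_sq_le: "(norm (grad (f_glob F) y))\<^sup>2 \<le> 2 * L * gap y"
  using grad_diff_sq_le_bregman[OF convex_glob smooth_glob L_pos, of y xs]
  by (simp add: gap_eq_bregman grad_glob_xs)

text \<open>The Bregman divergences of the workers average to the gap because the linear terms
  average to \<open>grad f xs = 0\<close>.\<close>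

lemma gl_diff_sq_le: "mean (\<lambda>i. (norm (gl i y - gl i xs))\<^sup>2) \<le> 2 * L * gap y"
proof -
  have "mean (\<lambda>i. (norm (gl i y - gl i xs))\<^sup>2) \<le> mean (\<lambda>i. 2 * L * bregman (f_loc F i) y xs)"
    by (intro mean_mono grad_diff_sq_le_bregman conv smooth L_pos)
  then show ?thesis by (simp add: mean_mult gap_eq_mean_bregman)
qed

lemma inner_grad_ge: "gap y + \<mu> / 2 * (norm (y - xs))\<^sup>2 \<le> grad (f_glob F) y \<bullet> (y - xs)"
  using qsc inner_minus_right[of "grad (f_glob F) y" "y - xs"]
  by (auto simp: quasi_strongly_convex_def gap_def dest!: spec[of _ y])

text \<open>Quasi strong convexity bounds \<open>bregman f xs y\<close> from below by \<open>\<mu> / 2 * (norm (y - xs))\<^sup>2\<close>, and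
  smoothness bounds it from above by \<open>L / 2 * (norm (y - xs))\<^sup>2\<close>.\<close>

lemma mu_le_L: "\<mu> \<le> L"
proof -
  obtain b :: 'a where b: "b \<in> Basis" using nonempty_Basis by blast
  have "gap (xs + b) + \<mu> / 2 * (norm b)\<^sup>2 \<le> grad (f_glob F) (xs + b) \<bullet> b"
    using inner_grad_ge[of "xs + b"] by simp
  moreover have "bregman (f_glob F) xs (xs + b) \<le> L / 2 * (norm b)\<^sup>2"
    using bregman_le[OF smooth_glob, of xs "xs + b"] by simp
  ultimately show ?thesis using b by (simp add: bregman_def gap_def)
qed

text \<open>One step of SGD on a perturbed point \<open>y - d\<close>: the perturbation is paid for by half of the
  functional gap and by \<open>norm d\<close> squared.\<close>

lemma descent_perturbed:
  "- 2 * ((y - d - xs) \<bullet> grad (f_glob F) y)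
    \<le> - \<mu> / 2 * (norm (y - d - xs))\<^sup>2 - 3 / 2 * gap y + 5 * L * (norm d)\<^sup>2"
proof -
  let ?G = "grad (f_glob F) y"
  have "2 * (d \<bullet> ?G) \<le> (4 * L) * (norm d)\<^sup>2 + (norm ?G)\<^sup>2 / (4 * L)"
    using L_pos by (intro young_inner) simp
  also have "(norm ?G)\<^sup>2 / (4 * L) \<le> gap y / 2"
    using grad_glob_sq_le[of y] L_pos by (simp add: field_simps)
  finally have young: "2 * (d \<bullet> ?G) \<le> 4 * L * (norm d)\<^sup>2 + gap y / 2" by simp
  have "(norm (y - d - xs))\<^sup>2 \<le> 2 * (norm (y - xs))\<^sup>2 + 2 * (norm d)\<^sup>2"
    using norm_add_sq_le[of "y - xs" "- d"] by (simp add: algebra_simps)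
  then have "\<mu> * (norm (y - d - xs))\<^sup>2 \<le> \<mu> * (2 * (norm (y - xs))\<^sup>2 + 2 * (norm d)\<^sup>2)"
    using mu by (rule mult_left_mono)
  moreover have "\<mu> * (norm d)\<^sup>2 \<le> L * (norm d)\<^sup>2"
    using mu_le_L by (intro mult_right_mono) auto
  moreover have "(y - d - xs) \<bullet> ?G = ?G \<bullet> (y - xs) - d \<bullet> ?G"
    by (simp add: inner_diff_left inner_diff_right inner_commute)
  ultimately show ?thesis using inner_grad_ge[of y] young by (simp add: algebra_simps)
qed

subsection \<open>Moments of the stochastic gradients\<close>

lemma prob_D: "prob_space (\<D> i)"
  and mean_D: "has_bochner_integral (\<D> i) (\<lambda>u. u $ j) 1"
  using sampling by (auto simp: sampling_distr_def)

lemma gl_meas: "gl i \<in> borel_measurable borel"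
  using smooth by (intro borel_measurable_grad) (simp add: L_smooth_def)

lemma f_glob_meas: "f_glob F \<in> borel_measurable borel"
  using smooth_glob by (intro differentiable_imp_borel_measurable) (simp add: L_smooth_def)

lemma gap_meas: "gap \<in> borel_measurable borel"
  unfolding gap_def[abs_def] using f_glob_meas by simp

lemma gs_measurable:
  assumes u: "u \<in> A \<rightarrow>\<^sub>M \<D> i" and y: "y \<in> borel_measurable A"
  shows "(\<lambda>z. gs i (u z) (y z)) \<in> borel_measurable A"
proof -
  have comp: "(\<lambda>z. u z $ j) \<in> borel_measurable A" for j
  proof (rule measurable_compose[OF u])
    show "(\<lambda>u. u $ j) \<in> borel_measurable (\<D> i)"
      using mean_D[of i j] by (auto simp: has_bochner_integral_iff)
  qed
  show ?thesis
    unfolding gs_eq mean_def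
    by (intro borel_measurable_scaleR borel_measurable_const borel_measurable_sum comp
        measurable_compose[OF y] borel_measurable_grad diff)
qed

lemma gs_measurable_D: "(\<lambda>u. gs i u y) \<in> borel_measurable (\<D> i)"
  by (rule gs_measurable) auto

lemma mean_gs: "has_bochner_integral (\<D> i) (\<lambda>u. gs i u y) (gl i y)"
proof -
  have "has_bochner_integral (\<D> i) (\<lambda>u. mean (\<lambda>j. (u $ j) *\<^sub>R grad (F i j) y))
      (mean (\<lambda>j. 1 *\<^sub>R grad (F i j) y))"
    unfolding mean_def
    by (intro has_bochner_integral_scaleR_right has_bochner_integral_sum
        has_bochner_integral_scaleR_left mean_D)
  then show ?thesis by (simp add: gs_eq gl_eq)
qed

lemma expected_smooth:
  "integrable (\<D> i) (\<lambda>u. (norm (gs i u y - gs i u xs))\<^sup>2)"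
  "(\<integral>u. (norm (gs i u y - gs i u xs))\<^sup>2 \<partial>\<D> i) \<le> 2 * \<L> * bregman (f_loc F i) y xs"
proof -
  have le: "(\<integral>\<^sup>+u. ennreal ((norm (gs i u y - gs i u xs))\<^sup>2) \<partial>\<D> i)
      \<le> ennreal (2 * \<L> * bregman (f_loc F i) y xs)"
    using exp_smooth by (simp add: expected_smoothness_def)
  show "integrable (\<D> i) (\<lambda>u. (norm (gs i u y - gs i u xs))\<^sup>2)"
  proof (rule integrableI_nonneg)
    show "(\<integral>\<^sup>+u. ennreal ((norm (gs i u y - gs i u xs))\<^sup>2) \<partial>\<D> i) < \<infinity>"
      using le by (rule le_less_trans) simp
    show "(\<lambda>u. (norm (gs i u y - gs i u xs))\<^sup>2) \<in> borel_measurable (\<D> i)"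
      using gs_measurable_D[measurable] by measurable
  qed simp
  show "(\<integral>u. (norm (gs i u y - gs i u xs))\<^sup>2 \<partial>\<D> i) \<le> 2 * \<L> * bregman (f_loc F i) y xs"
    using le cL_pos bregman_loc_nonneg by (intro integral_real_bounded) auto
qed

definition Var :: "'n \<Rightarrow> 'a \<Rightarrow> real" where
  "Var i y = (\<integral>u. (norm (gs i u y - gl i y))\<^sup>2 \<partial>\<D> i)"

lemma Var_nonneg: "0 \<le> Var i y"
  unfolding Var_def by simp

text \<open>Centering at the mean \<open>gl i y\<close> can only decrease the second moment, so the variance is bounded
  by the second moment around \<open>gl i xs\<close>; that one splits into the expected smoothness term and the
  variance at \<open>xs\<close>.\<close>

lemma Var_bound:
  "integrable (\<D> i) (\<lambda>u. (norm (gs i u y - gl i y))\<^sup>2)"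
  "Var i y \<le> 4 * \<L> * bregman (f_loc F i) y xs + 2 * Var i xs"
proof -
  interpret D: prob_space "\<D> i" by (rule prob_D)
  have split: "(norm (gs i u y - gl i xs))\<^sup>2
      \<le> 2 * (norm (gs i u y - gs i u xs))\<^sup>2 + 2 * (norm (gs i u xs - gl i xs))\<^sup>2" for u
    using norm_add_sq_le[of "gs i u y - gs i u xs" "gs i u xs - gl i xs"] by simp
  have int: "integrable (\<D> i)
      (\<lambda>u. 2 * (norm (gs i u y - gs i u xs))\<^sup>2 + 2 * (norm (gs i u xs - gl i xs))\<^sup>2)"
    using expected_smooth(1) fin_var by simp
  have meas: "(\<lambda>u. gs i u y - c) \<in> borel_measurable (\<D> i)" for c
    using gs_measurable_D by (intro borel_measurable_diff) auto
  have int_xs: "integrable (\<D> i) (\<lambda>u. (norm (gs i u y - gl i xs))\<^sup>2)"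
    by (rule Bochner_Integration.integrable_bound[OF int])
      (use split meas[measurable] in auto)
  show int_y: "integrable (\<D> i) (\<lambda>u. (norm (gs i u y - gl i y))\<^sup>2)"
  proof (rule Bochner_Integration.integrable_bound)
    show "integrable (\<D> i) (\<lambda>u. 2 * (norm (gs i u y - gl i xs))\<^sup>2 + 2 * (norm (gl i xs - gl i y))\<^sup>2)"
      using int_xs by simp
    show "AE u in \<D> i. norm ((norm (gs i u y - gl i y))\<^sup>2)
        \<le> norm (2 * (norm (gs i u y - gl i xs))\<^sup>2 + 2 * (norm (gl i xs - gl i y))\<^sup>2)"
      using norm_add_sq_le[of "gs i u y - gl i xs" "gl i xs - gl i y" for u] by simp
  qed (use meas[measurable] in measurable)
  have "Var i y \<le> (\<integral>u. (norm (- gl i xs + 1 *\<^sub>R gs i u y))\<^sup>2 \<partial>\<D> i)"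
    unfolding D.second_moment_affine(2)[OF mean_gs int_y] by (simp add: Var_def)
  also have "\<dots> = (\<integral>u. (norm (gs i u y - gl i xs))\<^sup>2 \<partial>\<D> i)" by simp
  also have "\<dots> \<le> (\<integral>u. 2 * (norm (gs i u y - gs i u xs))\<^sup>2 + 2 * (norm (gs i u xs - gl i xs))\<^sup>2 \<partial>\<D> i)"
    using split by (intro integral_mono int int_xs)
  also have "\<dots> = 2 * (\<integral>u. (norm (gs i u y - gs i u xs))\<^sup>2 \<partial>\<D> i) + 2 * Var i xs"
    using expected_smooth(1) fin_var by (simp add: Var_def)
  also have "\<dots> \<le> 2 * (2 * \<L> * bregman (f_loc F i) y xs) + 2 * Var i xs"
    using expected_smooth(2)[of i y] by simp
  finally show "Var i y \<le> 4 * \<L> * bregman (f_loc F i) y xs + 2 * Var i xs" by simp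
qed

definition Dvar :: real where
  "Dvar = 3 * mean (\<lambda>i. Var i xs)"

lemma Dvar_nonneg: "0 \<le> Dvar"
  unfolding Dvar_def by (simp add: mean_nonneg Var_nonneg)

end

section \<open>The randomness of one iteration\<close>

text \<open>\<open>Q v\<close> has mean \<open>v\<close>, so the second moment is the value at the mean plus \<open>t\<^sup>2\<close> times the quantization
  variance.\<close>

lemma integral_affine_quantization:
  fixes Q :: "'q \<Rightarrow> 'a::euclidean_space \<Rightarrow> 'a"
  assumes "quantization \<omega> SQ Q"
  shows "(\<integral>\<^sup>+q. ennreal ((norm (a + t *\<^sub>R Q q v))\<^sup>2) \<partial>SQ)
    \<le> ennreal ((norm (a + t *\<^sub>R v))\<^sup>2 + t\<^sup>2 * (\<omega> * (norm v)\<^sup>2))"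
proof -
  interpret SQ: prob_space SQ using assms by (simp add: quantization_def)
  have \<omega>: "0 < \<omega>" and mean: "has_bochner_integral SQ (\<lambda>q. Q q v) v"
    and le: "(\<integral>\<^sup>+q. ennreal ((norm (Q q v - v))\<^sup>2) \<partial>SQ) \<le> ennreal (\<omega> * (norm v)\<^sup>2)"
    using assms by (auto simp: quantization_def)
  have "(\<lambda>q. Q q v) \<in> borel_measurable SQ"
    using mean by (auto simp: has_bochner_integral_iff)
  note [measurable] = this
  have sq: "integrable SQ (\<lambda>q. (norm (Q q v - v))\<^sup>2)"
    using le by (intro integrableI_nonneg) (auto intro: le_less_trans)
  have "(\<integral>q. (norm (Q q v - v))\<^sup>2 \<partial>SQ) \<le> \<omega> * (norm v)\<^sup>2"
    using le \<omega> by (intro integral_real_bounded) auto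
  then have "t\<^sup>2 * (\<integral>q. (norm (Q q v - v))\<^sup>2 \<partial>SQ) \<le> t\<^sup>2 * (\<omega> * (norm v)\<^sup>2)"
    by (rule mult_left_mono) simp
  moreover have "(\<integral>\<^sup>+q. ennreal ((norm (a + t *\<^sub>R Q q v))\<^sup>2) \<partial>SQ)
      = ennreal (\<integral>q. (norm (a + t *\<^sub>R Q q v))\<^sup>2 \<partial>SQ)"
    using SQ.second_moment_affine(1)[OF mean sq] by (intro nn_integral_eq_integral) auto
  ultimately show ?thesis
    unfolding SQ.second_moment_affine(2)[OF mean sq] by (simp add: ennreal_leI del: ennreal_plus)
qed

text \<open>Here \<open>a\<close> is the old shift error and \<open>v\<close> the mean increment; the condition
  \<open>\<alpha> * (\<omega> + 1) \<le> 1\<close> makes the quadratic term in \<open>v\<close> small enough to complete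
  the square \<open>norm (a + v)\<close>.\<close>

lemma shift_contraction:
  fixes a v :: "'a::real_inner"
  assumes "0 < \<alpha>" "\<alpha> * (\<omega> + 1) \<le> 1"
  shows "(norm (a + \<alpha> *\<^sub>R v))\<^sup>2 + \<alpha>\<^sup>2 * (\<omega> * (norm v)\<^sup>2)
    \<le> (1 - \<alpha>) * (norm a)\<^sup>2 + \<alpha> * (norm (a + v))\<^sup>2"
proof -
  have "\<alpha> * ((\<alpha> * (\<omega> + 1)) * (norm v)\<^sup>2) \<le> \<alpha> * (1 * (norm v)\<^sup>2)"
    using assms by (intro mult_left_mono mult_right_mono) auto
  then have "\<alpha>\<^sup>2 * (norm v)\<^sup>2 + \<alpha>\<^sup>2 * (\<omega> * (norm v)\<^sup>2) \<le> \<alpha> * (norm v)\<^sup>2"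
    by (simp add: power2_eq_square algebra_simps)
  moreover have "(norm (a + \<alpha> *\<^sub>R v))\<^sup>2 = (norm a)\<^sup>2 + 2 * \<alpha> * (a \<bullet> v) + \<alpha>\<^sup>2 * (norm v)\<^sup>2"
    "(norm (a + v))\<^sup>2 = (norm a)\<^sup>2 + 2 * (a \<bullet> v) + (norm v)\<^sup>2"
    by (simp_all only: power2_norm_eq_inner)
      (simp_all add: inner_add_left inner_add_right inner_commute power2_eq_square)
  ultimately show ?thesis by (simp add: algebra_simps)
qed

text \<open>Young's inequality with parameter \<open>\<delta> / 2\<close>; the factor \<open>1 - \<delta>\<close> of the compressor absorbs
  the growth \<open>1 + \<delta> / 2\<close> down to \<open>1 - \<delta> / 2\<close>.\<close>

lemma compression_contraction:
  fixes a b :: "'a::real_inner"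
  assumes "0 < \<delta>" "\<delta> \<le> 1"
  shows "(1 - \<delta>) * (norm (a + b))\<^sup>2 \<le> (1 - \<delta> / 2) * (norm a)\<^sup>2 + 2 / \<delta> * (norm b)\<^sup>2"
proof -
  have "2 * (a \<bullet> b) \<le> \<delta> / 2 * (norm a)\<^sup>2 + (norm b)\<^sup>2 / (\<delta> / 2)"
    using assms by (intro young_inner) simp
  moreover have "(norm (a + b))\<^sup>2 = (norm a)\<^sup>2 + 2 * (a \<bullet> b) + (norm b)\<^sup>2"
    by (simp add: power2_norm_eq_inner inner_add_left inner_add_right inner_commute)
  ultimately have "(norm (a + b))\<^sup>2 \<le> (1 + \<delta> / 2) * (norm a)\<^sup>2 + (1 + 2 / \<delta>) * (norm b)\<^sup>2"
    by (simp add: algebra_simps)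
  then have "(1 - \<delta>) * (norm (a + b))\<^sup>2
      \<le> (1 - \<delta>) * ((1 + \<delta> / 2) * (norm a)\<^sup>2 + (1 + 2 / \<delta>) * (norm b)\<^sup>2)"
    using assms by (intro mult_left_mono) auto
  also have "\<dots> = ((1 - \<delta>) * (1 + \<delta> / 2)) * (norm a)\<^sup>2 + ((1 - \<delta>) * (1 + 2 / \<delta>)) * (norm b)\<^sup>2"
    by (simp add: algebra_simps)
  also have "\<dots> \<le> (1 - \<delta> / 2) * (norm a)\<^sup>2 + 2 / \<delta> * (norm b)\<^sup>2"
  proof (intro add_mono mult_right_mono)
    show "(1 - \<delta>) * (1 + \<delta> / 2) \<le> 1 - \<delta> / 2" using assms by (simp add: algebra_simps)
    show "(1 - \<delta>) * (1 + 2 / \<delta>) \<le> 2 / \<delta>" using assms by (simp add: field_simps)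
  qed auto
  finally show ?thesis .
qed

locale ec_draws = ec_problem F \<D> xs L \<L> \<mu> + prob_space M
  for F :: "'n::finite \<Rightarrow> 'm::finite \<Rightarrow> 'a::euclidean_space \<Rightarrow> real"
    and \<D> :: "'n \<Rightarrow> (real^'m) measure"
    and xs :: 'a and L \<L> \<mu> :: real and M :: "'z measure" +
  fixes SC :: "'c measure" and C :: "'c \<Rightarrow> 'a \<Rightarrow> 'a"
    and SQ :: "'q measure" and Q :: "'q \<Rightarrow> 'a \<Rightarrow> 'a"
    and \<xi> :: "nat \<Rightarrow> 'n \<Rightarrow> 'z \<Rightarrow> real^'m"
    and \<zeta> :: "nat \<Rightarrow> 'n \<Rightarrow> 'z \<Rightarrow> 'c"
    and \<theta> :: "nat \<Rightarrow> 'n \<Rightarrow> 'z \<Rightarrow> 'q"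
    and \<delta> \<omega> :: real
  assumes compr: "compression \<delta> SC C"
    and quant: "quantization \<omega> SQ Q"
    and fresh: "fresh_draws M \<D> SC SQ \<xi> \<zeta> \<theta>"
begin

abbreviation "DS \<equiv> draw_space \<D> SC SQ"
abbreviation "dr \<equiv> draw \<xi> \<zeta> \<theta>"

lemma delta: "0 < \<delta>" "\<delta> \<le> 1" and prob_SC: "prob_space SC"
  and C_bound: "(\<integral>\<^sup>+s. ennreal ((norm (C s v - v))\<^sup>2) \<partial>SC) \<le> ennreal ((1 - \<delta>) * (norm v)\<^sup>2)"
  using compr by (auto simp: compression_def)

lemma omega: "0 < \<omega>" and prob_SQ: "prob_space SQ"
  using quant by (auto simp: quantization_def)

lemma C_measurable:
  assumes "s \<in> A \<rightarrow>\<^sub>M SC" "v \<in> borel_measurable A"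
  shows "(\<lambda>z. C (s z) (v z)) \<in> borel_measurable A"
proof -
  have "(\<lambda>(s, x). C s x) \<in> SC \<Otimes>\<^sub>M borel \<rightarrow>\<^sub>M borel" using compr by (simp add: compression_def)
  from measurable_compose[OF measurable_Pair[OF assms] this] show ?thesis by simp
qed

lemma Q_measurable:
  assumes "s \<in> A \<rightarrow>\<^sub>M SQ" "v \<in> borel_measurable A"
  shows "(\<lambda>z. Q (s z) (v z)) \<in> borel_measurable A"
proof -
  have "(\<lambda>(s, x). Q s x) \<in> SQ \<Otimes>\<^sub>M borel \<rightarrow>\<^sub>M borel" using quant by (simp add: quantization_def)
  from measurable_compose[OF measurable_Pair[OF assms] this] show ?thesis by simp
qed

lemma indep_draws: "indep_vars (\<lambda>(k, i). DS i) (\<lambda>(k, i). dr k i) UNIV"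
  and distr_draw: "distr M (DS i) (dr k i) = DS i"
  using fresh by (auto simp: fresh_draws_def)

lemma draw_measurable: "dr k i \<in> M \<rightarrow>\<^sub>M DS i"
  using indep_draws unfolding indep_vars_def by (auto dest!: bspec[of _ _ "(k, i)"])

lemma draw_components:
  assumes "d \<in> A \<rightarrow>\<^sub>M DS i"
  shows "(\<lambda>z. fst (d z)) \<in> A \<rightarrow>\<^sub>M \<D> i"
    and "(\<lambda>z. fst (snd (d z))) \<in> A \<rightarrow>\<^sub>M SC" and "(\<lambda>z. snd (snd (d z))) \<in> A \<rightarrow>\<^sub>M SQ"
  using assms unfolding draw_space_def
  by (auto intro: measurable_compose[OF _ measurable_fst] measurable_compose[OF _ measurable_snd])

lemma nn_integral_draw:
  assumes \<phi>: "\<phi> \<in> borel_measurable (DS i)"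
  shows "(\<integral>\<^sup>+y. \<phi> (dr k i y) \<partial>M) = (\<integral>\<^sup>+u. (\<integral>\<^sup>+s. (\<integral>\<^sup>+q. \<phi> (u, s, q) \<partial>SQ) \<partial>SC) \<partial>\<D> i)"
proof -
  interpret SQ: prob_space SQ by (rule prob_SQ)
  interpret SC: prob_space SC by (rule prob_SC)
  interpret SCQ: pair_prob_space SC SQ ..
  have \<phi>': "\<phi> \<in> borel_measurable (\<D> i \<Otimes>\<^sub>M (SC \<Otimes>\<^sub>M SQ))" using \<phi> by (simp add: draw_space_def)
  have "(\<integral>\<^sup>+y. \<phi> (dr k i y) \<partial>M) = (\<integral>\<^sup>+w. \<phi> w \<partial>distr M (DS i) (dr k i))"
    using \<phi> draw_measurable by (subst nn_integral_distr) auto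
  also have "\<dots> = (\<integral>\<^sup>+w. \<phi> w \<partial>(\<D> i \<Otimes>\<^sub>M (SC \<Otimes>\<^sub>M SQ)))"
    by (simp only: distr_draw) (simp only: draw_space_def)
  also have "\<dots> = (\<integral>\<^sup>+u. (\<integral>\<^sup>+w. \<phi> (u, w) \<partial>(SC \<Otimes>\<^sub>M SQ)) \<partial>\<D> i)"
    by (rule SCQ.nn_integral_fst[OF \<phi>', symmetric])
  also have "\<dots> = (\<integral>\<^sup>+u. (\<integral>\<^sup>+s. (\<integral>\<^sup>+q. \<phi> (u, s, q) \<partial>SQ) \<partial>SC) \<partial>\<D> i)"
  proof (rule nn_integral_cong)
    fix u assume u: "u \<in> space (\<D> i)"
    have "(\<lambda>w. \<phi> (u, w)) \<in> borel_measurable (SC \<Otimes>\<^sub>M SQ)"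
      using measurable_compose[OF measurable_Pair1'[OF u] \<phi>'] by simp
    then show "(\<integral>\<^sup>+w. \<phi> (u, w) \<partial>(SC \<Otimes>\<^sub>M SQ)) = (\<integral>\<^sup>+s. (\<integral>\<^sup>+q. \<phi> (u, s, q) \<partial>SQ) \<partial>SC)"
      by (rule SQ.nn_integral_fst[symmetric])
  qed
  finally show ?thesis .
qed

lemma sample_measurable: "\<xi> k i \<in> M \<rightarrow>\<^sub>M \<D> i"
  using draw_components(1)[OF draw_measurable, of k i] by (simp add: draw_def)

lemma distr_sample: "distr M (\<D> i) (\<xi> k i) = \<D> i"
proof -
  interpret SQ: prob_space SQ by (rule prob_SQ)
  interpret SC: prob_space SC by (rule prob_SC)
  interpret SCQ: pair_prob_space SC SQ ..
  have "distr M (\<D> i) (\<xi> k i) = distr (distr M (DS i) (dr k i)) (\<D> i) fst"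
    using draw_measurable[of k i]
    by (subst distr_distr) (auto simp: draw_space_def comp_def draw_def)
  also have "\<dots> = distr (\<D> i \<Otimes>\<^sub>M (SC \<Otimes>\<^sub>M SQ)) (\<D> i) fst"
    by (simp only: distr_draw) (simp only: draw_space_def)
  also have "\<dots> = \<D> i" by (rule SCQ.distr_pair_fst)
  finally show ?thesis .
qed

lemma integral_sample:
  fixes f :: "real^'m \<Rightarrow> 'b::{banach, second_countable_topology}"
  assumes "integrable (\<D> i) f"
  shows "integrable M (\<lambda>z. f (\<xi> k i z))" "(\<integral>z. f (\<xi> k i z) \<partial>M) = (\<integral>u. f u \<partial>\<D> i)"
proof -
  have f: "f \<in> borel_measurable (\<D> i)" using assms by auto
  show "integrable M (\<lambda>z. f (\<xi> k i z))"
    using assms integrable_distr_eq[OF sample_measurable f, of k] by (simp add: distr_sample)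
  show "(\<integral>z. f (\<xi> k i z) \<partial>M) = (\<integral>u. f u \<partial>\<D> i)"
    using integral_distr[OF sample_measurable f, of k] by (simp add: distr_sample)
qed

subsection \<open>One step from a fixed state\<close>

text \<open>The quantization noise is integrated first, for a fixed sample, and the sampling noise second;
  each contributes by a bias-variance decomposition.\<close>

lemma one_step_shift:
  assumes \<alpha>: "0 < \<alpha>" "\<alpha> * (\<omega> + 1) \<le> 1"
  shows "(\<integral>\<^sup>+z. ennreal ((norm (b + \<alpha> *\<^sub>R Q (\<theta> k i z) (gs i (\<xi> k i z) y - b) - c))\<^sup>2) \<partial>M)
    \<le> ennreal ((1 - \<alpha>) * (norm (b - c))\<^sup>2 + \<alpha> * (norm (gl i y - c))\<^sup>2 + \<alpha>\<^sup>2 * (\<omega> + 1) * Var i y)"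
proof -
  interpret SC: prob_space SC by (rule prob_SC)
  interpret Di: prob_space "\<D> i" by (rule prob_D)
  define a where "a = b - c"
  define \<phi> where "\<phi> d = ennreal ((norm (a + \<alpha> *\<^sub>R Q (snd (snd d)) (gs i (fst d) y - b)))\<^sup>2)"
    for d :: "(real^'m) \<times> 'c \<times> 'q"
  define R where "R u = (norm (a + \<alpha> *\<^sub>R (gs i u y - b)))\<^sup>2 + \<alpha>\<^sup>2 * (\<omega> * (norm (gs i u y - b))\<^sup>2)" for u
  have "(\<lambda>d. Q (snd (snd d)) (gs i (fst d) y - b)) \<in> borel_measurable (DS i)"
    by (intro Q_measurable draw_components[where i = i] borel_measurable_diff gs_measurable) auto
  note [measurable] = this
  have \<phi>: "\<phi> \<in> borel_measurable (DS i)" unfolding \<phi>_def by measurable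
  have "(\<integral>\<^sup>+z. ennreal ((norm (b + \<alpha> *\<^sub>R Q (\<theta> k i z) (gs i (\<xi> k i z) y - b) - c))\<^sup>2) \<partial>M)
      = (\<integral>\<^sup>+z. \<phi> (dr k i z) \<partial>M)"
    by (simp add: \<phi>_def draw_def a_def algebra_simps)
  also have "\<dots> = (\<integral>\<^sup>+u. (\<integral>\<^sup>+s. (\<integral>\<^sup>+q. \<phi> (u, s, q) \<partial>SQ) \<partial>SC) \<partial>\<D> i)"
    by (rule nn_integral_draw[OF \<phi>])
  also have "\<dots> \<le> (\<integral>\<^sup>+u. (\<integral>\<^sup>+s. ennreal (R u) \<partial>SC) \<partial>\<D> i)"
    unfolding \<phi>_def R_def by (intro nn_integral_mono) (simp add: integral_affine_quantization[OF quant])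
  also have "\<dots> = (\<integral>\<^sup>+u. ennreal (R u) \<partial>\<D> i)"
    by (simp add: SC.emeasure_space_1)
  also have "\<dots> = ennreal (\<integral>u. R u \<partial>\<D> i)"
  proof (rule nn_integral_eq_integral)
    show "integrable (\<D> i) R"
      using Di.second_moment_affine(1)[OF mean_gs Var_bound(1), of "a - \<alpha> *\<^sub>R b" \<alpha> y]
        Di.second_moment_affine(1)[OF mean_gs Var_bound(1), of "- b" 1 y]
      unfolding R_def by (simp add: algebra_simps)
  qed (use omega in \<open>simp add: R_def\<close>)
  also have "(\<integral>u. R u \<partial>\<D> i) = (norm (a + \<alpha> *\<^sub>R (gl i y - b)))\<^sup>2 + \<alpha>\<^sup>2 * (\<omega> * (norm (gl i y - b))\<^sup>2)
      + \<alpha>\<^sup>2 * (\<omega> + 1) * Var i y"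
    using Di.second_moment_affine[OF mean_gs Var_bound(1), of "a - \<alpha> *\<^sub>R b" \<alpha> y]
      Di.second_moment_affine[OF mean_gs Var_bound(1), of "- b" 1 y]
    unfolding R_def Var_def by (simp add: algebra_simps)
  also have "\<dots> \<le> (1 - \<alpha>) * (norm (b - c))\<^sup>2 + \<alpha> * (norm (gl i y - c))\<^sup>2 + \<alpha>\<^sup>2 * (\<omega> + 1) * Var i y"
    using shift_contraction[OF \<alpha>, of a "gl i y - b"] by (simp add: a_def)
  finally show ?thesis by (simp add: ennreal_leI del: ennreal_plus)
qed

text \<open>The compressor is integrated first; the expected square of its input is the square at the mean
  plus \<open>\<gamma>\<^sup>2\<close> times the variance of the stochastic gradient.\<close>

lemma one_step_error:
  "(\<integral>\<^sup>+z. ennreal ((norm (e + \<gamma> *\<^sub>R (gs i (\<xi> k i z) y + b)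
        - C (\<zeta> k i z) (e + \<gamma> *\<^sub>R (gs i (\<xi> k i z) y + b))))\<^sup>2) \<partial>M)
    \<le> ennreal ((1 - \<delta> / 2) * (norm e)\<^sup>2 + \<gamma>\<^sup>2 * (2 / \<delta> * (norm (gl i y + b))\<^sup>2 + Var i y))"
proof -
  interpret SQ: prob_space SQ by (rule prob_SQ)
  interpret Di: prob_space "\<D> i" by (rule prob_D)
  define v where "v u = e + \<gamma> *\<^sub>R (gs i u y + b)" for u
  define \<phi> where "\<phi> d = ennreal ((norm (v (fst d) - C (fst (snd d)) (v (fst d))))\<^sup>2)"
    for d :: "(real^'m) \<times> 'c \<times> 'q"
  have v: "(\<lambda>d. v (fst d)) \<in> borel_measurable (DS i)"
    unfolding v_def
    by (intro borel_measurable_add borel_measurable_const borel_measurable_scaleR gs_measurable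
        draw_components) auto
  moreover have "(\<lambda>d. C (fst (snd d)) (v (fst d))) \<in> borel_measurable (DS i)"
    by (intro C_measurable v draw_components[where i = i]) auto
  ultimately have \<phi>: "\<phi> \<in> borel_measurable (DS i)" unfolding \<phi>_def by measurable
  have v_eq: "v u = (e + \<gamma> *\<^sub>R b) + \<gamma> *\<^sub>R gs i u y" for u
    by (simp add: v_def algebra_simps)
  have int: "integrable (\<D> i) (\<lambda>u. (norm (v u))\<^sup>2)"
    and val: "(\<integral>u. (norm (v u))\<^sup>2 \<partial>\<D> i) = (norm (e + \<gamma> *\<^sub>R (gl i y + b)))\<^sup>2 + \<gamma>\<^sup>2 * Var i y"
    using Di.second_moment_affine[OF mean_gs Var_bound(1), of "e + \<gamma> *\<^sub>R b" \<gamma> y]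
    unfolding v_eq Var_def by (simp_all add: algebra_simps)
  have "(\<integral>\<^sup>+z. ennreal ((norm (e + \<gamma> *\<^sub>R (gs i (\<xi> k i z) y + b)
        - C (\<zeta> k i z) (e + \<gamma> *\<^sub>R (gs i (\<xi> k i z) y + b))))\<^sup>2) \<partial>M) = (\<integral>\<^sup>+z. \<phi> (dr k i z) \<partial>M)"
    by (simp add: \<phi>_def draw_def v_def)
  also have "\<dots> = (\<integral>\<^sup>+u. (\<integral>\<^sup>+s. (\<integral>\<^sup>+q. \<phi> (u, s, q) \<partial>SQ) \<partial>SC) \<partial>\<D> i)"
    by (rule nn_integral_draw[OF \<phi>])
  also have "\<dots> \<le> (\<integral>\<^sup>+u. ennreal ((1 - \<delta>) * (norm (v u))\<^sup>2) \<partial>\<D> i)"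
    using C_bound
    by (intro nn_integral_mono) (simp add: \<phi>_def SQ.emeasure_space_1 norm_minus_commute)
  also have "\<dots> = ennreal (\<integral>u. (1 - \<delta>) * (norm (v u))\<^sup>2 \<partial>\<D> i)"
    using int delta by (intro nn_integral_eq_integral) auto
  also have "(\<integral>u. (1 - \<delta>) * (norm (v u))\<^sup>2 \<partial>\<D> i)
      = (1 - \<delta>) * (norm (e + \<gamma> *\<^sub>R (gl i y + b)))\<^sup>2 + (1 - \<delta>) * (\<gamma>\<^sup>2 * Var i y)"
    by (simp add: val distrib_left)
  also have "\<dots> \<le> (1 - \<delta> / 2) * (norm e)\<^sup>2 + \<gamma>\<^sup>2 * (2 / \<delta> * (norm (gl i y + b))\<^sup>2 + Var i y)"
  proof -
    have "(1 - \<delta>) * (norm (e + \<gamma> *\<^sub>R (gl i y + b)))\<^sup>2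
        \<le> (1 - \<delta> / 2) * (norm e)\<^sup>2 + 2 / \<delta> * (norm (\<gamma> *\<^sub>R (gl i y + b)))\<^sup>2"
      by (rule compression_contraction[OF delta])
    moreover have "(1 - \<delta>) * (\<gamma>\<^sup>2 * Var i y) \<le> 1 * (\<gamma>\<^sup>2 * Var i y)"
      using delta Var_nonneg by (intro mult_right_mono) auto
    moreover have "2 / \<delta> * (norm (\<gamma> *\<^sub>R (gl i y + b)))\<^sup>2 = \<gamma>\<^sup>2 * (2 / \<delta> * (norm (gl i y + b))\<^sup>2)"
      by (simp add: power_mult_distrib)
    ultimately show ?thesis unfolding distrib_left by linarith
  qed
  finally show ?thesis by (simp add: ennreal_leI del: ennreal_plus)
qed

text \<open>The deviations at \<open>xs\<close> are independent and centered, hence orthogonal: averaging over the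
  workers divides their variance by the number of workers.\<close>

lemma noise_variance:
  shows "integrable M (\<lambda>z. (norm (mean (\<lambda>i. gs i (\<xi> k i z) xs - gl i xs)))\<^sup>2)"
    and "(\<integral>z. (norm (mean (\<lambda>i. gs i (\<xi> k i z) xs - gl i xs)))\<^sup>2 \<partial>M) = Dvar / (3 * real CARD('n))"
proof -
  define b where "b i z = gs i (\<xi> k i z) xs - gl i xs" for i z
  have int_b: "integrable M (b i)" and mean_b: "(\<integral>z. b i z \<partial>M) = 0" for i
  proof -
    interpret Di: prob_space "\<D> i" by (rule prob_D)
    have gi: "integrable (\<D> i) (\<lambda>u. gs i u xs - gl i xs)" "(\<integral>u. gs i u xs - gl i xs \<partial>\<D> i) = 0"
      using mean_gs[of i xs] by (auto simp: has_bochner_integral_iff Di.prob_space)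
    show "integrable M (b i)" "(\<integral>z. b i z \<partial>M) = 0"
      unfolding b_def using integral_sample[OF gi(1), of k] gi(2) by auto
  qed
  have sq_b: "integrable M (\<lambda>z. (norm (b i z))\<^sup>2)" "(\<integral>z. (norm (b i z))\<^sup>2 \<partial>M) = Var i xs" for i
    unfolding b_def Var_def using integral_sample[OF fin_var] by auto
  have cross: "integrable M (\<lambda>z. b i z \<bullet> b j z) \<and> (\<integral>z. b i z \<bullet> b j z \<partial>M) = 0" if "i \<noteq> j" for i j
  proof -
    have "integrable M (\<lambda>z. (b i z \<bullet> c) * (b j z \<bullet> c)) \<and> (\<integral>z. (b i z \<bullet> c) * (b j z \<bullet> c) \<partial>M) = 0" for c
    proof -
      define Y where "Y p d = (gs (snd p) (fst d) xs - gl (snd p) xs) \<bullet> c"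
        for p :: "nat \<times> 'n" and d :: "(real^'m) \<times> 'c \<times> 'q"
      have Y_meas: "Y p \<in> borel_measurable (DS (snd p))" for p
        unfolding Y_def
        by (intro borel_measurable_inner borel_measurable_diff borel_measurable_const gs_measurable
            draw_components) auto
      have "indep_vars (\<lambda>_. borel) (\<lambda>p z. Y p ((\<lambda>(k, i). dr k i) p z)) {(k, i), (k, j)}"
        using Y_meas
        by (intro indep_vars_subset[OF indep_vars_compose2[OF indep_draws]]) (auto simp: case_prod_unfold)
      then have ind: "indep_vars (\<lambda>_. borel) (\<lambda>p z. Y p ((\<lambda>(k, i). dr k i) p z)) {(k, i), (k, j)}" .
      have Yb: "Y (k, l) (dr k l z) = b l z \<bullet> c" for l z
        by (simp add: Y_def b_def draw_def)
      have int: "integrable M (\<lambda>z. Y p ((\<lambda>(k, i). dr k i) p z))" if "p \<in> {(k, i), (k, j)}" for p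
        using that int_b by (auto simp: Yb)
      have ij: "(k, i) \<noteq> (k, j)" using \<open>i \<noteq> j\<close> by simp
      have "(\<integral>z. b l z \<bullet> c \<partial>M) = 0" for l
        using int_b mean_b by simp
      then show ?thesis
        using indep_vars_lebesgue_integral[OF _ ind int] indep_vars_integrable[OF _ ind int] ij
        by (simp add: Yb)
    qed
    then show ?thesis
      by (simp add: euclidean_inner[of "b i z" "b j z" for z])
  qed
  have expand: "(norm (mean (\<lambda>i. b i z)))\<^sup>2 = (\<Sum>i\<in>UNIV. \<Sum>j\<in>UNIV. b i z \<bullet> b j z) / (real CARD('n))\<^sup>2" for z
  proof -
    have "(norm (mean (\<lambda>i. b i z)))\<^sup>2 = (norm (\<Sum>i\<in>UNIV. b i z))\<^sup>2 / (real CARD('n))\<^sup>2"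
      by (simp add: mean_def power_divide)
    moreover have "(norm (\<Sum>i\<in>UNIV. b i z))\<^sup>2 = (\<Sum>i\<in>UNIV. \<Sum>j\<in>UNIV. b i z \<bullet> b j z)"
      unfolding power2_norm_eq_inner inner_sum_left by (simp add: inner_sum_right)
    ultimately show ?thesis by simp
  qed
  have int_ij: "integrable M (\<lambda>z. b i z \<bullet> b j z)" for i j
    using cross[of i j] sq_b(1)[of i] by (cases "i = j") (auto simp: power2_norm_eq_inner)
  have val_ij: "(\<integral>z. b i z \<bullet> b j z \<partial>M) = (if i = j then Var i xs else 0)" for i j
    using cross[of i j] sq_b(2)[of i] by (auto simp: power2_norm_eq_inner)
  show "integrable M (\<lambda>z. (norm (mean (\<lambda>i. gs i (\<xi> k i z) xs - gl i xs)))\<^sup>2)"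
    unfolding b_def[symmetric] expand using int_ij by simp
  show "(\<integral>z. (norm (mean (\<lambda>i. gs i (\<xi> k i z) xs - gl i xs)))\<^sup>2 \<partial>M) = Dvar / (3 * real CARD('n))"
    unfolding b_def[symmetric] expand using int_ij
    by (simp add: val_ij Dvar_def mean_def power2_eq_square)
qed

text \<open>Relative to the stochastic gradient at \<open>xs\<close>, with the same sample, the expected smoothness bounds the
  difference; what remains is the averaged noise at \<open>xs\<close>, since the gradients at \<open>xs\<close> average to zero.\<close>

lemma one_step_mean_gradient:
  "(\<integral>\<^sup>+z. ennreal ((norm (mean (\<lambda>i. gs i (\<xi> k i z) y)))\<^sup>2) \<partial>M)
    \<le> ennreal (4 * \<L> * gap y + 2 / (3 * real CARD('n)) * Dvar)"
proof -
  let ?a = "\<lambda>z. mean (\<lambda>i. (norm (gs i (\<xi> k i z) y - gs i (\<xi> k i z) xs))\<^sup>2)"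
  let ?b = "\<lambda>z. (norm (mean (\<lambda>i. gs i (\<xi> k i z) xs - gl i xs)))\<^sup>2"
  have int_i: "integrable M (\<lambda>z. (norm (gs i (\<xi> k i z) y - gs i (\<xi> k i z) xs))\<^sup>2)" for i
    using integral_sample(1)[OF expected_smooth(1)] .
  then have int_a: "integrable M ?a" unfolding mean_def by simp
  have "(\<integral>z. ?a z \<partial>M) = mean (\<lambda>i. \<integral>u. (norm (gs i u y - gs i u xs))\<^sup>2 \<partial>\<D> i)"
    unfolding mean_def using int_i integral_sample(2)[OF expected_smooth(1), of _ k y] by simp
  also have "\<dots> \<le> mean (\<lambda>i. 2 * \<L> * bregman (f_loc F i) y xs)"
    by (intro mean_mono expected_smooth)
  finally have val_a: "(\<integral>z. ?a z \<partial>M) \<le> 2 * \<L> * gap y"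
    by (simp add: mean_mult gap_eq_mean_bregman)
  have "(norm (mean (\<lambda>i. gs i (\<xi> k i z) y)))\<^sup>2 \<le> 2 * ?a z + 2 * ?b z" for z
  proof -
    let ?d = "mean (\<lambda>i. gs i (\<xi> k i z) y - gs i (\<xi> k i z) xs)"
    have "mean (\<lambda>i. gs i (\<xi> k i z) y) = ?d + mean (\<lambda>i. gs i (\<xi> k i z) xs - gl i xs)"
      by (simp add: mean_diff mean_gl_xs)
    then have "(norm (mean (\<lambda>i. gs i (\<xi> k i z) y)))\<^sup>2 \<le> 2 * (norm ?d)\<^sup>2 + 2 * ?b z"
      by (simp only: norm_add_sq_le)
    moreover have "(norm ?d)\<^sup>2 \<le> ?a z" by (rule norm_mean_sq_le)
    ultimately show ?thesis by linarith
  qed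
  then have "(\<integral>\<^sup>+z. ennreal ((norm (mean (\<lambda>i. gs i (\<xi> k i z) y)))\<^sup>2) \<partial>M)
      \<le> (\<integral>\<^sup>+z. ennreal (2 * ?a z + 2 * ?b z) \<partial>M)"
    by (intro nn_integral_mono ennreal_leI)
  also have "\<dots> = ennreal (\<integral>z. 2 * ?a z + 2 * ?b z \<partial>M)"
    using int_a noise_variance(1)
    by (intro nn_integral_eq_integral) (auto intro!: AE_I2 add_nonneg_nonneg mean_nonneg)
  also have "(\<integral>z. 2 * ?a z + 2 * ?b z \<partial>M) \<le> 4 * \<L> * gap y + 2 / (3 * real CARD('n)) * Dvar"
    using val_a int_a noise_variance[of k] by simp
  finally show ?thesis by (simp add: ennreal_leI del: ennreal_plus)
qed

end

section \<open>Square integrable random vectors\<close>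

lemma borel_measurable_mean:
  fixes X :: "'i::finite \<Rightarrow> 'z \<Rightarrow> 'b::euclidean_space"
  assumes "\<And>i. X i \<in> borel_measurable A"
  shows "(\<lambda>z. mean (\<lambda>i. X i z)) \<in> borel_measurable A"
  unfolding mean_def
  by (rule borel_measurable_scaleR[OF borel_measurable_const borel_measurable_sum]) (rule assms)

context prob_space
begin

definition sq_int :: "('a \<Rightarrow> 'b::euclidean_space) \<Rightarrow> bool" where
  "sq_int X \<longleftrightarrow> X \<in> borel_measurable M \<and> integrable M (\<lambda>z. (norm (X z))\<^sup>2)"

lemma sq_int_bound:
  assumes "X \<in> borel_measurable M" "integrable M r" "\<And>z. z \<in> space M \<Longrightarrow> (norm (X z))\<^sup>2 \<le> r z"
  shows "sq_int X"
proof -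
  have "integrable M (\<lambda>z. (norm (X z))\<^sup>2)"
  proof (rule Bochner_Integration.integrable_bound[OF assms(2)])
    show "(\<lambda>z. (norm (X z))\<^sup>2) \<in> borel_measurable M"
      using assms(1) by simp
    show "AE z in M. norm ((norm (X z))\<^sup>2) \<le> norm (r z)"
    proof (rule AE_I2)
      fix z assume "z \<in> space M"
      then have "(norm (X z))\<^sup>2 \<le> \<bar>r z\<bar>"
        by (rule order_trans[OF assms(3) abs_ge_self])
      then show "norm ((norm (X z))\<^sup>2) \<le> norm (r z)" by simp
    qed
  qed
  with assms(1) show ?thesis by (simp add: sq_int_def)
qed

lemma sq_int_integrable: "sq_int X \<Longrightarrow> integrable M X"
  unfolding sq_int_def by (rule integrable_of_square_integrable) auto

lemma sq_int_const: "sq_int (\<lambda>z. c)"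
  by (simp add: sq_int_def)

lemma sq_int_scaleR: "sq_int X \<Longrightarrow> sq_int (\<lambda>z. c *\<^sub>R X z)"
  by (auto simp: sq_int_def power_mult_distrib)

lemma sq_int_add:
  assumes "sq_int X" "sq_int Y"
  shows "sq_int (\<lambda>z. X z + Y z)"
proof (rule sq_int_bound)
  show "(\<lambda>z. X z + Y z) \<in> borel_measurable M" using assms by (auto simp: sq_int_def)
  show "integrable M (\<lambda>z. 2 * (norm (X z))\<^sup>2 + 2 * (norm (Y z))\<^sup>2)"
    using assms by (auto simp: sq_int_def)
qed (rule norm_add_sq_le)

lemma sq_int_diff: "sq_int X \<Longrightarrow> sq_int Y \<Longrightarrow> sq_int (\<lambda>z. X z - Y z)"
  using sq_int_add[of X "\<lambda>z. (- 1) *\<^sub>R Y z"] sq_int_scaleR[of Y "- 1"] by simp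

lemma integral_mean:
  fixes f :: "'i::finite \<Rightarrow> 'a \<Rightarrow> real"
  assumes "\<And>i. integrable M (f i)"
  shows "integrable M (\<lambda>z. mean (\<lambda>i. f i z))"
    and "(\<integral>z. mean (\<lambda>i. f i z) \<partial>M) = mean (\<lambda>i. \<integral>z. f i z \<partial>M)"
  using assms unfolding mean_def by simp_all

lemma sq_int_mean:
  fixes X :: "'i::finite \<Rightarrow> 'a \<Rightarrow> 'b::euclidean_space"
  assumes "\<And>i. sq_int (X i)"
  shows "sq_int (\<lambda>z. mean (\<lambda>i. X i z))"
proof (rule sq_int_bound)
  show "(\<lambda>z. mean (\<lambda>i. X i z)) \<in> borel_measurable M"
    using assms by (intro borel_measurable_mean) (simp add: sq_int_def)
  show "integrable M (\<lambda>z. mean (\<lambda>i. (norm (X i z))\<^sup>2))"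
    using assms by (intro integral_mean(1)) (simp add: sq_int_def)
qed (rule norm_mean_sq_le)

end

section \<open>The iterates and their history\<close>

locale ec_run = ec_draws F \<D> xs L \<L> \<mu> M SC C SQ Q \<xi> \<zeta> \<theta> \<delta> \<omega>
  for F :: "'n::finite \<Rightarrow> 'm::finite \<Rightarrow> 'a::euclidean_space \<Rightarrow> real"
    and \<D> :: "'n \<Rightarrow> (real^'m) measure"
    and xs :: 'a and L \<L> \<mu> :: real and M :: "'z measure"
    and SC :: "'c measure" and C :: "'c \<Rightarrow> 'a \<Rightarrow> 'a"
    and SQ :: "'q measure" and Q :: "'q \<Rightarrow> 'a \<Rightarrow> 'a"
    and \<xi> :: "nat \<Rightarrow> 'n \<Rightarrow> 'z \<Rightarrow> real^'m"
    and \<zeta> :: "nat \<Rightarrow> 'n \<Rightarrow> 'z \<Rightarrow> 'c"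
    and \<theta> :: "nat \<Rightarrow> 'n \<Rightarrow> 'z \<Rightarrow> 'q"
    and \<delta> \<omega> :: real +
  fixes \<gamma> \<alpha> :: real and x0 :: 'a and h0 :: "'n \<Rightarrow> 'a"
    and x :: "nat \<Rightarrow> 'z \<Rightarrow> 'a" and gh g v e h :: "nat \<Rightarrow> 'n \<Rightarrow> 'z \<Rightarrow> 'a"
  assumes method_run: "EC_SGDsr_DIANA F C Q \<gamma> \<alpha> x0 h0 M \<xi> \<zeta> \<theta> x gh g v e h"
    and gamma: "0 < \<gamma>"
      "\<gamma> \<le> min (1 / (4 * \<L>))
         (\<delta> / (4 * sqrt (6 * L * (4 * L + 3 * \<delta> * (\<L> + L) + 16 * (3 * \<L> + 4 * L) / (1 - \<alpha>)))))"
    and alpha: "0 < \<alpha>" "\<alpha> \<le> 1 / (\<omega> + 1)"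
begin

abbreviation Hk :: "nat \<Rightarrow> 'z measure" where
  "Hk \<equiv> history M DS dr"

abbreviation RS :: "nat \<Rightarrow> (nat \<times> 'n \<Rightarrow> (real^'m) \<times> 'c \<times> 'q) measure" where
  "RS \<equiv> round_space DS"

abbreviation RD :: "nat \<Rightarrow> 'z \<Rightarrow> nat \<times> 'n \<Rightarrow> (real^'m) \<times> 'c \<times> 'q" where
  "RD \<equiv> round_draws dr"

lemma alpha_le: "\<alpha> * (\<omega> + 1) \<le> 1" and alpha_less: "\<alpha> < 1"
proof -
  show "\<alpha> * (\<omega> + 1) \<le> 1" using alpha omega by (simp add: field_simps)
  moreover have "\<alpha> * 1 < \<alpha> * (\<omega> + 1)" using alpha omega by (intro mult_strict_left_mono) auto
  ultimately show "\<alpha> < 1" by simp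
qed

lemma gamma_cL: "4 * \<L> * \<gamma> \<le> 1"
  using gamma cL_pos by (simp add: field_simps)

text \<open>The second bound on \<open>\<gamma>\<close>, squared, with \<open>1 / (1 - \<alpha>)\<close> replaced by the smaller number \<open>1\<close>.\<close>

lemma gamma_sq: "96 * L * (4 * L + 3 * \<delta> * (\<L> + L) + 16 * (3 * \<L> + 4 * L)) * \<gamma>\<^sup>2 \<le> \<delta>\<^sup>2"
proof -
  define Y where "Y = 4 * L + 3 * \<delta> * (\<L> + L) + 16 * (3 * \<L> + 4 * L) / (1 - \<alpha>)"
  have "16 * (3 * \<L> + 4 * L) * (1 - \<alpha>) \<le> 16 * (3 * \<L> + 4 * L) * 1"
    using alpha cL_pos L_pos by (intro mult_left_mono) auto
  then have XY: "4 * L + 3 * \<delta> * (\<L> + L) + 16 * (3 * \<L> + 4 * L) \<le> Y"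
    using alpha_less unfolding Y_def
    by (intro add_left_mono, subst pos_le_divide_eq) (simp, simp only: mult_1_right)
  moreover have "0 < 4 * L + 3 * \<delta> * (\<L> + L) + 16 * (3 * \<L> + 4 * L)"
    using delta cL_pos L_pos by (intro add_pos_pos mult_pos_pos) auto
  ultimately have Y: "0 < Y" by simp
  have sq: "0 < sqrt (6 * L * Y)" using L_pos Y by simp
  have "\<gamma> \<le> \<delta> / (4 * sqrt (6 * L * Y))" using gamma(2) by (simp add: Y_def)
  then have "\<gamma> * (4 * sqrt (6 * L * Y)) \<le> \<delta>" using sq by (simp add: pos_le_divide_eq)
  then have "(\<gamma> * (4 * sqrt (6 * L * Y)))\<^sup>2 \<le> \<delta>\<^sup>2"
    using gamma(1) sq by (intro power_mono) auto
  then have "96 * L * Y * \<gamma>\<^sup>2 \<le> \<delta>\<^sup>2"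
    using L_pos Y by (simp add: power_mult_distrib mult_ac)
  moreover have "96 * L * (4 * L + 3 * \<delta> * (\<L> + L) + 16 * (3 * \<L> + 4 * L)) * \<gamma>\<^sup>2 \<le> 96 * L * Y * \<gamma>\<^sup>2"
    using XY L_pos by (intro mult_right_mono mult_left_mono) auto
  ultimately show ?thesis by linarith
qed

lemma gamma_L: "4 * (\<gamma> * L) \<le> \<delta>"
proof (rule power2_le_imp_le)
  have "4 * L \<le> 4 * L + 3 * \<delta> * (\<L> + L) + 16 * (3 * \<L> + 4 * L)"
    using delta cL_pos L_pos by (simp add: add_nonneg_nonneg)
  then have "96 * L * (4 * L) * \<gamma>\<^sup>2
      \<le> 96 * L * (4 * L + 3 * \<delta> * (\<L> + L) + 16 * (3 * \<L> + 4 * L)) * \<gamma>\<^sup>2"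
    using L_pos by (intro mult_right_mono mult_left_mono) auto
  moreover have "(4 * (\<gamma> * L))\<^sup>2 \<le> 96 * L * (4 * L) * \<gamma>\<^sup>2"
  proof -
    have "(4 * (\<gamma> * L))\<^sup>2 = 16 * (\<gamma> * L)\<^sup>2" "96 * L * (4 * L) * \<gamma>\<^sup>2 = 384 * (\<gamma> * L)\<^sup>2"
      by (simp_all add: power_mult_distrib power2_eq_square)
    then show ?thesis using zero_le_power2[of "\<gamma> * L"] by linarith
  qed
  ultimately show "(4 * (\<gamma> * L))\<^sup>2 \<le> \<delta>\<^sup>2" using gamma_sq by linarith
qed (use delta in simp)

text \<open>The conditional mean of \<open>g k i\<close> given the history, see \<open>cond_exp_g\<close>.\<close>

definition gb :: "nat \<Rightarrow> 'n \<Rightarrow> 'z \<Rightarrow> 'a" where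
  "gb k i z = gl i (x k z) - h k i z + mean (\<lambda>l. h k l z)"

definition \<sigma> :: "nat \<Rightarrow> 'z \<Rightarrow> real" where
  "\<sigma> k z = mean (\<lambda>i. (norm (h k i z - gl i xs))\<^sup>2)"

lemma run_init:
  assumes "z \<in> space M"
  shows "x 0 z = x0" "e 0 i z = 0" "h 0 i z = h0 i"
  using method_run assms by (auto simp: EC_SGDsr_DIANA_def)

lemma run_step:
  assumes "z \<in> space M"
  shows "gh k i z = gs i (\<xi> k i z) (x k z)"
    and "g k i z = gh k i z - h k i z + mean (\<lambda>l. h k l z)"
    and "v k i z = C (\<zeta> k i z) (e k i z + \<gamma> *\<^sub>R g k i z)"
    and "e (Suc k) i z = e k i z + \<gamma> *\<^sub>R g k i z - v k i z"
    and "h (Suc k) i z = h k i z + \<alpha> *\<^sub>R Q (\<theta> k i z) (gh k i z - h k i z)"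
    and "x (Suc k) z = x k z - mean (\<lambda>i. v k i z)"
  using method_run assms by (auto simp: EC_SGDsr_DIANA_def)

lemma mean_g:
  assumes "z \<in> space M"
  shows "mean (\<lambda>i. g k i z) = mean (\<lambda>i. gs i (\<xi> k i z) (x k z))"
  using assms by (simp add: run_step mean_add mean_diff)

text \<open>The averaged error measures by how much the transmitted steps lag behind plain SGD steps.\<close>

lemma virtual_iterate_step:
  assumes "z \<in> space M"
  shows "x (Suc k) z - mean (\<lambda>i. e (Suc k) i z)
    = (x k z - mean (\<lambda>i. e k i z)) - \<gamma> *\<^sub>R mean (\<lambda>i. gs i (\<xi> k i z) (x k z))"
  using assms unfolding mean_g[OF assms, symmetric]
  by (simp add: run_step(4,6) mean_add mean_diff mean_scaleR)

subsection \<open>Measurability with respect to the history\<close>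

lemma sub_Hk: "subalgebra M (Hk k)"
  by (rule subalgebra_history) (rule draw_measurable)

lemma indep_RD: "indep_of (Hk k) (RS k) (RD k)"
  by (rule indep_history_round[OF indep_draws])

lemma measurable_Hk_mono: "X \<in> borel_measurable (Hk k) \<Longrightarrow> X \<in> borel_measurable (Hk (Suc k))"
  for X :: "'z \<Rightarrow> 'b::topological_space"
  using measurable_mono[of borel borel "Hk k" "Hk (Suc k)"] history_mono[of k "Suc k" M DS dr]
  by auto

lemma Hk_imp_M: "X \<in> borel_measurable (Hk k) \<Longrightarrow> X \<in> borel_measurable M"
  for X :: "'z \<Rightarrow> 'b::topological_space"
  by (rule measurable_from_subalg[OF sub_Hk])

lemma measurable_on_space:
  assumes "\<And>z. z \<in> space M \<Longrightarrow> X z = Y z" "Y \<in> borel_measurable (Hk k)"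
  shows "X \<in> borel_measurable (Hk k)"
  using assms by (subst measurable_cong[where g = Y]) auto

lemma draw_Hk: "dr k i \<in> Hk (Suc k) \<rightarrow>\<^sub>M DS i"
  by (rule measurable_history) (auto intro: draw_measurable)

lemma sample_Hk: "\<xi> k i \<in> Hk (Suc k) \<rightarrow>\<^sub>M \<D> i" "\<zeta> k i \<in> Hk (Suc k) \<rightarrow>\<^sub>M SC"
    "\<theta> k i \<in> Hk (Suc k) \<rightarrow>\<^sub>M SQ"
  using draw_components[OF draw_Hk, of k i] by (simp_all add: draw_def)

text \<open>Iteration \<open>k\<close> uses draws that belong to the history up to \<open>Suc k\<close>.\<close>

lemma state_measurable:
  "x k \<in> borel_measurable (Hk k)" "e k i \<in> borel_measurable (Hk k)" "h k i \<in> borel_measurable (Hk k)"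
proof -
  have "x k \<in> borel_measurable (Hk k) \<and> (\<forall>i. e k i \<in> borel_measurable (Hk k) \<and> h k i \<in> borel_measurable (Hk k))"
  proof (induction k)
    case 0
    have "x 0 \<in> borel_measurable (Hk 0)"
      by (rule measurable_on_space[where Y = "\<lambda>_. x0"]) (auto simp: run_init)
    moreover have "e 0 i \<in> borel_measurable (Hk 0)" for i
      by (rule measurable_on_space[where Y = "\<lambda>_. 0"]) (auto simp: run_init)
    moreover have "h 0 i \<in> borel_measurable (Hk 0)" for i
      by (rule measurable_on_space[where Y = "\<lambda>_. h0 i"]) (auto simp: run_init)
    ultimately show ?case by blast
  next
    case (Suc k)
    let ?H = "Hk (Suc k)"
    have xk: "x k \<in> borel_measurable ?H" and ek: "e k i \<in> borel_measurable ?H"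
      and hk: "h k i \<in> borel_measurable ?H" for i
      using Suc measurable_Hk_mono by auto
    have ghm: "gh k i \<in> borel_measurable ?H" for i
      by (rule measurable_on_space[OF run_step(1)]) (simp, intro gs_measurable sample_Hk xk)
    have gm: "g k i \<in> borel_measurable ?H" for i
      by (rule measurable_on_space[OF run_step(2)])
        (simp, intro borel_measurable_add borel_measurable_diff borel_measurable_mean ghm hk)
    have pm: "(\<lambda>z. e k i z + \<gamma> *\<^sub>R g k i z) \<in> borel_measurable ?H" for i
      by (intro borel_measurable_add borel_measurable_scaleR borel_measurable_const ek gm)
    have vm: "v k i \<in> borel_measurable ?H" for i
      by (rule measurable_on_space[OF run_step(3)]) (simp, intro C_measurable sample_Hk pm)
    have "e (Suc k) i \<in> borel_measurable ?H" for i
      by (rule measurable_on_space[OF run_step(4)]) (simp, intro borel_measurable_diff pm vm)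
    moreover have "h (Suc k) i \<in> borel_measurable ?H" for i
      by (rule measurable_on_space[OF run_step(5)])
        (simp, intro borel_measurable_add borel_measurable_scaleR borel_measurable_const
          Q_measurable sample_Hk borel_measurable_diff ghm hk)
    moreover have "x (Suc k) \<in> borel_measurable ?H"
      by (rule measurable_on_space[OF run_step(6)])
        (simp, intro borel_measurable_diff borel_measurable_mean xk vm)
    ultimately show ?case by blast
  qed
  then show "x k \<in> borel_measurable (Hk k)" "e k i \<in> borel_measurable (Hk k)"
    "h k i \<in> borel_measurable (Hk k)" by auto
qed

text \<open>Measurability on the product of the history with the draws of round \<open>k\<close>, as needed for
  freezing.\<close>

lemma measurable_past: "X \<in> borel_measurable (Hk k) \<Longrightarrow> (\<lambda>w. X (fst w)) \<in> borel_measurable (Hk k \<Otimes>\<^sub>M RS k)"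
  for X :: "'z \<Rightarrow> 'b::topological_space"
  by (rule measurable_compose[OF measurable_fst])

lemma measurable_now: "(\<lambda>w. snd w (k, i)) \<in> Hk k \<Otimes>\<^sub>M RS k \<rightarrow>\<^sub>M DS i"
  by (rule measurable_compose[OF measurable_snd measurable_round_component])

lemma measurable_gs_now: "(\<lambda>w. gs i (fst (snd w (k, i))) (x k (fst w))) \<in> borel_measurable (Hk k \<Otimes>\<^sub>M RS k)"
  by (intro gs_measurable draw_components measurable_now measurable_past state_measurable)

subsection \<open>Conditional bounds for one iteration\<close>

text \<open>The bound of \<open>Var_bound\<close>, used in place of the variance because along the iterates its
  measurability and integrability are those of a Bregman divergence.\<close>

definition Var_ub :: "'n \<Rightarrow> 'a \<Rightarrow> real" where
  "Var_ub i y = 4 * \<L> * bregman (f_loc F i) y xs + 2 * Var i xs"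

lemma Var_ub: "Var i y \<le> Var_ub i y" "0 \<le> Var_ub i y"
  using Var_bound(2)[of i y] Var_nonneg[of i y] by (auto simp: Var_ub_def)

lemma mean_Var_ub: "mean (\<lambda>i. Var_ub i y) = 4 * \<L> * gap y + 2 / 3 * Dvar"
  by (simp add: Var_ub_def mean_add mean_mult Dvar_def gap_eq_mean_bregman)

lemma one_step_deviation:
  "(\<integral>\<^sup>+z. ennreal ((norm (gs i (\<xi> k i z) y - gl i y))\<^sup>2) \<partial>M) = ennreal (Var i y)"
  using integral_sample[OF Var_bound(1)[of i y], of k]
  by (subst nn_integral_eq_integral) (auto simp: Var_def)

text \<open>The first part holds because the bound dominates the expectation of a square; integration over the
  past needs it.\<close>

lemma one_step_virtual:
  defines "r \<equiv> \<lambda>b y. (norm b)\<^sup>2 - 2 * \<gamma> * (b \<bullet> grad (f_glob F) y)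
      + \<gamma>\<^sup>2 * (4 * \<L> * gap y + 2 / (3 * real CARD('n)) * Dvar)"
  shows "0 \<le> r b y"
    and "(\<integral>\<^sup>+z. ennreal ((norm (b - \<gamma> *\<^sub>R mean (\<lambda>i. gs i (\<xi> k i z) y)))\<^sup>2) \<partial>M) \<le> ennreal (r b y)"
proof -
  define G where "G z = mean (\<lambda>i. gs i (\<xi> k i z) y)" for z
  let ?d = "grad (f_glob F) y" and ?B = "4 * \<L> * gap y + 2 / (3 * real CARD('n)) * Dvar"
  have int_i: "integrable M (\<lambda>z. gs i (\<xi> k i z) y)" "(\<integral>z. gs i (\<xi> k i z) y \<partial>M) = gl i y" for i
    using integral_sample[of i "\<lambda>u. gs i u y" k] mean_gs[of i y]
    by (auto simp: has_bochner_integral_iff)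
  have mean: "has_bochner_integral M G ?d"
    using int_i unfolding G_def has_bochner_integral_iff grad_glob mean_def by simp
  have G_meas: "G \<in> borel_measurable M"
    using mean by (auto simp: has_bochner_integral_iff)
  note [measurable] = G_meas
  have B: "0 \<le> ?B" using gap_nonneg cL_pos Dvar_nonneg by simp
  have nn: "(\<integral>\<^sup>+z. ennreal ((norm (G z))\<^sup>2) \<partial>M) \<le> ennreal ?B"
    unfolding G_def by (rule one_step_mean_gradient)
  have sq: "integrable M (\<lambda>z. (norm (G z))\<^sup>2)"
    using nn by (intro integrableI_nonneg) (auto intro: le_less_trans)
  have le: "(\<integral>z. (norm (G z))\<^sup>2 \<partial>M) \<le> ?B"
    by (rule integral_real_bounded[OF B nn])
  have dev: "integrable M (\<lambda>z. (norm (G z - ?d))\<^sup>2)"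
    using sq_int_diff[of G "\<lambda>_. ?d"] sq_int_const sq G_meas by (auto simp: sq_int_def)
  have nn_eq: "(\<integral>\<^sup>+z. ennreal ((norm (b - \<gamma> *\<^sub>R G z))\<^sup>2) \<partial>M)
      = ennreal (\<integral>z. (norm (b + (- \<gamma>) *\<^sub>R G z))\<^sup>2 \<partial>M)"
    using second_moment_affine(1)[OF mean dev, of b "- \<gamma>"] by (subst nn_integral_eq_integral) auto
  have "(\<integral>z. (norm (b + (- \<gamma>) *\<^sub>R G z))\<^sup>2 \<partial>M)
      = (norm b)\<^sup>2 - 2 * \<gamma> * (b \<bullet> ?d) + \<gamma>\<^sup>2 * (\<integral>z. (norm (G z))\<^sup>2 \<partial>M)"
  proof -
    have "(\<integral>z. (norm (G z))\<^sup>2 \<partial>M) = (norm ?d)\<^sup>2 + (\<integral>z. (norm (G z - ?d))\<^sup>2 \<partial>M)"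
      using second_moment_affine(2)[OF mean dev, of 0 1] by simp
    moreover have "(norm (b + (- \<gamma>) *\<^sub>R ?d))\<^sup>2 = (norm b)\<^sup>2 - 2 * \<gamma> * (b \<bullet> ?d) + \<gamma>\<^sup>2 * (norm ?d)\<^sup>2"
      by (simp only: power2_norm_eq_inner)
        (simp add: inner_diff_left inner_diff_right inner_commute power2_eq_square algebra_simps)
    ultimately show ?thesis
      unfolding second_moment_affine(2)[OF mean dev] by (simp add: distrib_left)
  qed
  also have "\<dots> \<le> (norm b)\<^sup>2 - 2 * \<gamma> * (b \<bullet> ?d) + \<gamma>\<^sup>2 * ?B"
    using le by (intro add_left_mono mult_left_mono) auto
  finally have le_r: "(\<integral>z. (norm (b + (- \<gamma>) *\<^sub>R G z))\<^sup>2 \<partial>M) \<le> r b y" by (simp add: r_def)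
  have "0 \<le> (\<integral>z. (norm (b + (- \<gamma>) *\<^sub>R G z))\<^sup>2 \<partial>M)" by simp
  with le_r show "0 \<le> r b y" by linarith
  show "(\<integral>\<^sup>+z. ennreal ((norm (b - \<gamma> *\<^sub>R mean (\<lambda>i. gs i (\<xi> k i z) y)))\<^sup>2) \<partial>M) \<le> ennreal (r b y)"
    using nn_eq le_r unfolding G_def by (simp add: ennreal_leI)
qed

section \<open>One iteration of the method\<close>

lemma gl_lipschitz: "norm (gl i y - gl i z) \<le> L * norm (y - z)"
  using smooth[of i] lipschitz_onD[of L UNIV "gl i" y z] by (auto simp: L_smooth_def dist_norm)

lemma bregman_loc_meas: "(\<lambda>y. bregman (f_loc F i) y xs) \<in> borel_measurable borel"
proof -
  have "f_loc F i \<in> borel_measurable borel"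
    using smooth[of i] by (intro differentiable_imp_borel_measurable) (simp add: L_smooth_def)
  then show ?thesis unfolding bregman_def by simp
qed

definition state_sq :: "nat \<Rightarrow> bool" where
  "state_sq k \<longleftrightarrow> sq_int (x k) \<and> (\<forall>i. sq_int (e k i) \<and> sq_int (h k i))"

lemma sq_gl:
  assumes "state_sq k"
  shows "sq_int (\<lambda>z. gl i (x k z))"
proof -
  have "sq_int (\<lambda>z. gl i (x k z) - gl i xs)"
  proof (rule sq_int_bound)
    show "(\<lambda>z. gl i (x k z) - gl i xs) \<in> borel_measurable M"
      using measurable_compose[OF Hk_imp_M[OF state_measurable(1)] gl_meas]
      by (intro borel_measurable_diff) auto
    have "sq_int (\<lambda>z. L *\<^sub>R (x k z - xs))"
      using assms by (intro sq_int_scaleR sq_int_diff sq_int_const) (simp add: state_sq_def)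
    then show "integrable M (\<lambda>z. (norm (L *\<^sub>R (x k z - xs)))\<^sup>2)" by (simp add: sq_int_def)
    show "(norm (gl i (x k z) - gl i xs))\<^sup>2 \<le> (norm (L *\<^sub>R (x k z - xs)))\<^sup>2" for z
      using gl_lipschitz[of i "x k z" xs] L_pos by (intro power_mono) auto
  qed
  from sq_int_add[OF this sq_int_const[of "gl i xs"]] show ?thesis by simp
qed

lemma sq_gb: "state_sq k \<Longrightarrow> sq_int (gb k i)"
  unfolding gb_def
  by (intro sq_int_add sq_int_diff sq_int_mean sq_gl) (auto simp: state_sq_def)

lemma integrable_Var_ub:
  assumes "state_sq k"
  shows "integrable M (\<lambda>z. Var_ub i (x k z))"
proof -
  have "integrable M (\<lambda>z. bregman (f_loc F i) (x k z) xs)"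
  proof (rule Bochner_Integration.integrable_bound)
    have "sq_int (\<lambda>z. x k z - xs)"
      using assms by (intro sq_int_diff sq_int_const) (simp add: state_sq_def)
    then show "integrable M (\<lambda>z. L / 2 * (norm (x k z - xs))\<^sup>2)" by (simp add: sq_int_def)
    show "(\<lambda>z. bregman (f_loc F i) (x k z) xs) \<in> borel_measurable M"
      by (rule measurable_compose[OF Hk_imp_M[OF state_measurable(1)] bregman_loc_meas])
    show "AE z in M. norm (bregman (f_loc F i) (x k z) xs) \<le> norm (L / 2 * (norm (x k z - xs))\<^sup>2)"
      using bregman_loc_nonneg bregman_le[OF smooth] L_pos by (intro AE_I2) simp
  qed
  then show ?thesis by (simp add: Var_ub_def)
qed

lemma round_draw_components:
  "fst (RD k z (k, i)) = \<xi> k i z" "fst (snd (RD k z (k, i))) = \<zeta> k i z"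
  "snd (snd (RD k z (k, i))) = \<theta> k i z"
  by (simp_all add: draw_def)

lemma error_step:
  fixes i :: 'n and k :: nat
  assumes sq: "state_sq k"
  defines "r \<equiv> \<lambda>z. (1 - \<delta> / 2) * (norm (e k i z))\<^sup>2 + \<gamma>\<^sup>2 * (2 / \<delta> * (norm (gb k i z))\<^sup>2 + Var_ub i (x k z))"
  shows "integrable M r" and "integrable M (\<lambda>z. (norm (e (Suc k) i z))\<^sup>2)"
    and "(\<integral>z. (norm (e (Suc k) i z))\<^sup>2 \<partial>M) \<le> (\<integral>z. r z \<partial>M)"
proof -
  define b where "b z = mean (\<lambda>l. h k l z) - h k i z" for z
  define w where "w z u = e k i z + \<gamma> *\<^sub>R (gs i (fst (u (k, i))) (x k z) + b z)"
    for z and u :: "nat \<times> 'n \<Rightarrow> (real^'m) \<times> 'c \<times> 'q"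
  define \<phi> where "\<phi> z u = (norm (w z u - C (fst (snd (u (k, i)))) (w z u)))\<^sup>2"
    for z and u :: "nat \<times> 'n \<Rightarrow> (real^'m) \<times> 'c \<times> 'q"
  show r: "integrable M r"
    unfolding r_def using sq sq_gb[OF sq, of i] integrable_Var_ub[OF sq, of i]
    by (simp add: state_sq_def sq_int_def)
  have b_meas: "b \<in> borel_measurable (Hk k)"
    unfolding b_def by (intro borel_measurable_diff borel_measurable_mean state_measurable)
  have w_meas: "(\<lambda>p. w (fst p) (snd p)) \<in> borel_measurable (Hk k \<Otimes>\<^sub>M RS k)"
    unfolding w_def
    by (intro borel_measurable_add borel_measurable_scaleR borel_measurable_const measurable_gs_now
        measurable_past[OF b_meas] measurable_past state_measurable)
  have "(\<lambda>p. w (fst p) (snd p) - C (fst (snd (snd p (k, i)))) (w (fst p) (snd p)))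
      \<in> borel_measurable (Hk k \<Otimes>\<^sub>M RS k)"
    by (intro borel_measurable_diff w_meas C_measurable draw_components[where i = i] measurable_now)
  then have \<phi>_meas: "case_prod \<phi> \<in> borel_measurable (Hk k \<Otimes>\<^sub>M RS k)"
    by (simp add: \<phi>_def case_prod_unfold)
  have X: "(norm (e (Suc k) i z))\<^sup>2 = \<phi> z (RD k z)" if "z \<in> space M" for z
    using that by (simp add: \<phi>_def w_def b_def run_step draw_def algebra_simps)
  have bound: "(\<integral>\<^sup>+y. ennreal (\<phi> z (RD k y)) \<partial>M) \<le> ennreal (r z)" if "z \<in> space M" for z
  proof -
    have "(\<integral>\<^sup>+y. ennreal (\<phi> z (RD k y)) \<partial>M)
        \<le> ennreal ((1 - \<delta> / 2) * (norm (e k i z))\<^sup>2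
            + \<gamma>\<^sup>2 * (2 / \<delta> * (norm (gl i (x k z) + b z))\<^sup>2 + Var i (x k z)))"
      unfolding \<phi>_def w_def round_draw_components by (rule one_step_error)
    also have "\<dots> \<le> ennreal (r z)"
    proof (rule ennreal_leI)
      have "gl i (x k z) + b z = gb k i z" by (simp add: b_def gb_def)
      moreover have "\<gamma>\<^sup>2 * Var i (x k z) \<le> \<gamma>\<^sup>2 * Var_ub i (x k z)"
        by (intro mult_left_mono Var_ub) simp
      ultimately show "(1 - \<delta> / 2) * (norm (e k i z))\<^sup>2
            + \<gamma>\<^sup>2 * (2 / \<delta> * (norm (gl i (x k z) + b z))\<^sup>2 + Var i (x k z)) \<le> r z"
        by (simp add: r_def distrib_left)
    qed
    finally show ?thesis .
  qed
  have nonneg: "0 \<le> r z" for z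
    unfolding r_def using delta Var_ub(2) by (intro add_nonneg_nonneg mult_nonneg_nonneg) auto
  have \<phi>0: "0 \<le> \<phi> z u" for z u by (simp add: \<phi>_def)
  note fb = freeze_bound[OF sub_Hk indep_RD \<phi>_meas, OF X \<phi>0 r nonneg bound]
  show "integrable M (\<lambda>z. (norm (e (Suc k) i z))\<^sup>2)"
    by (rule fb(1))
  show "(\<integral>z. (norm (e (Suc k) i z))\<^sup>2 \<partial>M) \<le> (\<integral>z. r z \<partial>M)"
    by (rule fb(3))
qed

lemma shift_step:
  fixes i :: 'n and k :: nat
  assumes sq: "state_sq k"
  defines "r \<equiv> \<lambda>z. (1 - \<alpha>) * (norm (h k i z - gl i xs))\<^sup>2 + \<alpha> * (norm (gl i (x k z) - gl i xs))\<^sup>2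
      + \<alpha>\<^sup>2 * (\<omega> + 1) * Var_ub i (x k z)"
  shows "integrable M r" and "integrable M (\<lambda>z. (norm (h (Suc k) i z - gl i xs))\<^sup>2)"
    and "AE z in M. real_cond_exp M (Hk k) (\<lambda>z. (norm (h (Suc k) i z - gl i xs))\<^sup>2) z \<le> r z"
    and "(\<integral>z. (norm (h (Suc k) i z - gl i xs))\<^sup>2 \<partial>M) \<le> (\<integral>z. r z \<partial>M)"
proof -
  define \<phi> where "\<phi> z u = (norm (h k i z + \<alpha> *\<^sub>R Q (snd (snd (u (k, i))))
      (gs i (fst (u (k, i))) (x k z) - h k i z) - gl i xs))\<^sup>2"
    for z and u :: "nat \<times> 'n \<Rightarrow> (real^'m) \<times> 'c \<times> 'q"
  have "sq_int (\<lambda>z. h k i z - gl i xs)" "sq_int (\<lambda>z. gl i (x k z) - gl i xs)"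
    using sq sq_gl[OF sq, of i] by (auto intro!: sq_int_diff sq_int_const simp: state_sq_def)
  then show r: "integrable M r"
    unfolding r_def using integrable_Var_ub[OF sq, of i] by (simp add: sq_int_def)
  have "(\<lambda>p. h k i (fst p) + \<alpha> *\<^sub>R Q (snd (snd (snd p (k, i))))
      (gs i (fst (snd p (k, i))) (x k (fst p)) - h k i (fst p)) - gl i xs)
      \<in> borel_measurable (Hk k \<Otimes>\<^sub>M RS k)"
    by (intro borel_measurable_diff borel_measurable_add borel_measurable_scaleR
        borel_measurable_const Q_measurable draw_components[where i = i] measurable_now
        measurable_gs_now measurable_past state_measurable)
  then have \<phi>_meas: "case_prod \<phi> \<in> borel_measurable (Hk k \<Otimes>\<^sub>M RS k)"
    by (simp add: \<phi>_def case_prod_unfold)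
  have X: "(norm (h (Suc k) i z - gl i xs))\<^sup>2 = \<phi> z (RD k z)" if "z \<in> space M" for z
    using that by (simp add: \<phi>_def run_step draw_def)
  have bound: "(\<integral>\<^sup>+y. ennreal (\<phi> z (RD k y)) \<partial>M) \<le> ennreal (r z)" if "z \<in> space M" for z
  proof -
    have "(\<integral>\<^sup>+y. ennreal (\<phi> z (RD k y)) \<partial>M)
        \<le> ennreal ((1 - \<alpha>) * (norm (h k i z - gl i xs))\<^sup>2 + \<alpha> * (norm (gl i (x k z) - gl i xs))\<^sup>2
            + \<alpha>\<^sup>2 * (\<omega> + 1) * Var i (x k z))"
      unfolding \<phi>_def round_draw_components by (rule one_step_shift[OF alpha(1) alpha_le])
    also have "\<dots> \<le> ennreal (r z)"
      unfolding r_def using omega Var_ub(1)[of i "x k z"]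
      by (intro ennreal_leI add_left_mono mult_left_mono) auto
    finally show ?thesis .
  qed
  have nonneg: "0 \<le> r z" for z
    unfolding r_def using alpha alpha_less omega Var_ub(2)
    by (intro add_nonneg_nonneg mult_nonneg_nonneg) auto
  have \<phi>0: "0 \<le> \<phi> z u" for z u by (simp add: \<phi>_def)
  note fb = freeze_bound[OF sub_Hk indep_RD \<phi>_meas, OF X \<phi>0 r nonneg bound]
  show "integrable M (\<lambda>z. (norm (h (Suc k) i z - gl i xs))\<^sup>2)"
    by (rule fb(1))
  show "AE z in M. real_cond_exp M (Hk k) (\<lambda>z. (norm (h (Suc k) i z - gl i xs))\<^sup>2) z \<le> r z"
    by (rule fb(2))
  show "(\<integral>z. (norm (h (Suc k) i z - gl i xs))\<^sup>2 \<partial>M) \<le> (\<integral>z. r z \<partial>M)"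
    by (rule fb(3))
qed

lemma deviation_step:
  assumes sq: "state_sq k"
  shows "integrable M (\<lambda>z. (norm (gh k i z - gl i (x k z)))\<^sup>2)"
    and "AE z in M. real_cond_exp M (Hk k) (\<lambda>z. (norm (gh k i z - gl i (x k z)))\<^sup>2) z \<le> Var_ub i (x k z)"
proof -
  define \<phi> where "\<phi> z u = (norm (gs i (fst (u (k, i))) (x k z) - gl i (x k z)))\<^sup>2"
    for z and u :: "nat \<times> 'n \<Rightarrow> (real^'m) \<times> 'c \<times> 'q"
  have "(\<lambda>p. gs i (fst (snd p (k, i))) (x k (fst p)) - gl i (x k (fst p)))
      \<in> borel_measurable (Hk k \<Otimes>\<^sub>M RS k)"
    by (intro borel_measurable_diff measurable_gs_now measurable_compose[OF measurable_past[OF state_measurable(1)] gl_meas])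
  then have \<phi>_meas: "case_prod \<phi> \<in> borel_measurable (Hk k \<Otimes>\<^sub>M RS k)"
    by (simp add: \<phi>_def case_prod_unfold)
  have X: "(norm (gh k i z - gl i (x k z)))\<^sup>2 = \<phi> z (RD k z)" if "z \<in> space M" for z
    using that by (simp add: \<phi>_def run_step draw_def)
  have bound: "(\<integral>\<^sup>+y. ennreal (\<phi> z (RD k y)) \<partial>M) \<le> ennreal (Var_ub i (x k z))" if "z \<in> space M" for z
    unfolding \<phi>_def round_draw_components one_step_deviation by (intro ennreal_leI Var_ub)
  have \<phi>0: "0 \<le> \<phi> z u" for z u by (simp add: \<phi>_def)
  note fb = freeze_bound[OF sub_Hk indep_RD \<phi>_meas, OF X \<phi>0 integrable_Var_ub[OF sq] Var_ub(2) bound]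
  show "integrable M (\<lambda>z. (norm (gh k i z - gl i (x k z)))\<^sup>2)"
    by (rule fb(1))
  show "AE z in M. real_cond_exp M (Hk k) (\<lambda>z. (norm (gh k i z - gl i (x k z)))\<^sup>2) z \<le> Var_ub i (x k z)"
    by (rule fb(2))
qed

lemma gh_meas: "gh k i \<in> borel_measurable M"
proof -
  have "gh k i \<in> borel_measurable (Hk (Suc k))"
    by (rule measurable_on_space[OF run_step(1)])
      (simp, intro gs_measurable sample_Hk measurable_Hk_mono state_measurable)
  then show ?thesis by (rule Hk_imp_M)
qed

lemma sq_cong:
  assumes "sq_int Y" "\<And>z. z \<in> space M \<Longrightarrow> X z = Y z"
  shows "sq_int X"
proof (rule sq_int_bound)
  show "X \<in> borel_measurable M"
    using assms by (subst measurable_cong[OF assms(2)]) (auto simp: sq_int_def)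
  show "integrable M (\<lambda>z. (norm (Y z))\<^sup>2)" using assms(1) by (simp add: sq_int_def)
qed (simp add: assms(2))

lemma sq_gh: assumes "state_sq k" shows "sq_int (gh k i)"
proof -
  have "(\<lambda>z. gh k i z - gl i (x k z)) \<in> borel_measurable M"
    by (intro borel_measurable_diff gh_meas measurable_compose[OF Hk_imp_M[OF state_measurable(1)] gl_meas])
  then have "sq_int (\<lambda>z. gh k i z - gl i (x k z))"
    using deviation_step(1)[OF assms] by (simp add: sq_int_def)
  from sq_int_add[OF this sq_gl[OF assms, where i = i]] show ?thesis by simp
qed

lemma sq_g: assumes "state_sq k" shows "sq_int (g k i)"
proof (rule sq_cong)
  show "sq_int (\<lambda>z. gh k i z - h k i z + mean (\<lambda>l. h k l z))"
    using assms by (intro sq_int_add sq_int_diff sq_int_mean sq_gh) (auto simp: state_sq_def)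
qed (rule run_step(2))

text \<open>The bounds for one iteration presuppose square integrability at \<open>k\<close> and return it at \<open>Suc k\<close>. For \<open>x\<close>,
  the transmitted vectors are expressed through the errors: \<open>v k i = e k i + \<gamma> *\<^sub>R g k i - e (Suc k) i\<close>.\<close>

lemma state_sq: "state_sq k"
proof (induction k)
  case 0
  have "sq_int (x 0)" by (rule sq_cong[OF sq_int_const[of x0]]) (rule run_init)
  moreover have "sq_int (e 0 i)" for i by (rule sq_cong[OF sq_int_const[of 0]]) (rule run_init)
  moreover have "sq_int (h 0 i)" for i by (rule sq_cong[OF sq_int_const[of "h0 i"]]) (rule run_init)
  ultimately show ?case by (simp add: state_sq_def)
next
  case (Suc k)
  have e: "sq_int (e (Suc k) i)" for i
    using error_step(2)[OF Suc, of i] Hk_imp_M[OF state_measurable(2)] by (simp add: sq_int_def)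
  have h: "sq_int (h (Suc k) i)" for i
  proof -
    have "sq_int (\<lambda>z. h (Suc k) i z - gl i xs)"
      using shift_step(2)[OF Suc, of i] Hk_imp_M[OF state_measurable(3)]
      by (simp add: sq_int_def)
    from sq_int_add[OF this sq_int_const[of "gl i xs"]] show ?thesis by simp
  qed
  have "sq_int (x (Suc k))"
  proof (rule sq_cong)
    show "sq_int (\<lambda>z. x k z - mean (\<lambda>i. e k i z + \<gamma> *\<^sub>R g k i z - e (Suc k) i z))"
      using Suc e
      by (intro sq_int_diff sq_int_mean sq_int_add sq_int_scaleR sq_g) (auto simp: state_sq_def)
    show "x (Suc k) z = x k z - mean (\<lambda>i. e k i z + \<gamma> *\<^sub>R g k i z - e (Suc k) i z)"
      if "z \<in> space M" for z
      using that by (simp add: run_step(4,6))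
  qed
  with e h show ?case by (simp add: state_sq_def)
qed

lemma sq_x: "sq_int (x k)" and sq_e: "sq_int (e k i)" and sq_h: "sq_int (h k i)"
  using state_sq[of k] by (auto simp: state_sq_def)

lemma integrable_gap: "integrable M (\<lambda>z. gap (x k z))"
proof (rule Bochner_Integration.integrable_bound)
  have "sq_int (\<lambda>z. x k z - xs)" by (intro sq_int_diff sq_int_const sq_x)
  then show "integrable M (\<lambda>z. L / 2 * (norm (x k z - xs))\<^sup>2)" by (simp add: sq_int_def)
  show "(\<lambda>z. gap (x k z)) \<in> borel_measurable M"
    by (rule measurable_compose[OF Hk_imp_M[OF state_measurable(1)] gap_meas])
  show "AE z in M. norm (gap (x k z)) \<le> norm (L / 2 * (norm (x k z - xs))\<^sup>2)"
    using gap_nonneg gap_le L_pos by (intro AE_I2) simp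
qed

lemma integrable_h_dev: "integrable M (\<lambda>z. (norm (h k i z - gl i xs))\<^sup>2)"
  using sq_int_diff[OF sq_h sq_int_const] by (simp add: sq_int_def)

lemma integrable_\<sigma>: "integrable M (\<sigma> k)"
  unfolding \<sigma>_def by (rule integral_mean(1)) (rule integrable_h_dev)

lemma mean_gradient_step:
  shows "integrable M (\<lambda>z. (norm (mean (\<lambda>i. g k i z)))\<^sup>2)"
    and "AE z in M. real_cond_exp M (Hk k) (\<lambda>z. (norm (mean (\<lambda>i. g k i z)))\<^sup>2) z
      \<le> 4 * \<L> * gap (x k z) + 2 / (3 * real CARD('n)) * Dvar"
proof -
  define \<phi> where "\<phi> z u = (norm (mean (\<lambda>i. gs i (fst (u (k, i))) (x k z))))\<^sup>2"
    for z and u :: "nat \<times> 'n \<Rightarrow> (real^'m) \<times> 'c \<times> 'q"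
  have "(\<lambda>p. mean (\<lambda>i. gs i (fst (snd p (k, i))) (x k (fst p)))) \<in> borel_measurable (Hk k \<Otimes>\<^sub>M RS k)"
    by (intro borel_measurable_mean measurable_gs_now)
  then have \<phi>_meas: "case_prod \<phi> \<in> borel_measurable (Hk k \<Otimes>\<^sub>M RS k)"
    by (simp add: \<phi>_def case_prod_unfold)
  have X: "(norm (mean (\<lambda>i. g k i z)))\<^sup>2 = \<phi> z (RD k z)" if "z \<in> space M" for z
    using that by (simp add: \<phi>_def mean_g draw_def)
  have bound: "(\<integral>\<^sup>+y. ennreal (\<phi> z (RD k y)) \<partial>M)
      \<le> ennreal (4 * \<L> * gap (x k z) + 2 / (3 * real CARD('n)) * Dvar)" if "z \<in> space M" for z
    unfolding \<phi>_def round_draw_components by (rule one_step_mean_gradient)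
  have r: "integrable M (\<lambda>z. 4 * \<L> * gap (x k z) + 2 / (3 * real CARD('n)) * Dvar)"
    using integrable_gap by simp
  have nonneg: "0 \<le> 4 * \<L> * gap (x k z) + 2 / (3 * real CARD('n)) * Dvar" for z
    using gap_nonneg cL_pos Dvar_nonneg by (intro add_nonneg_nonneg mult_nonneg_nonneg) auto
  have \<phi>0: "0 \<le> \<phi> z u" for z u by (simp add: \<phi>_def)
  note fb = freeze_bound[OF sub_Hk indep_RD \<phi>_meas, OF X \<phi>0 r nonneg bound]
  show "integrable M (\<lambda>z. (norm (mean (\<lambda>i. g k i z)))\<^sup>2)"
    by (rule fb(1))
  show "AE z in M. real_cond_exp M (Hk k) (\<lambda>z. (norm (mean (\<lambda>i. g k i z)))\<^sup>2) z
      \<le> 4 * \<L> * gap (x k z) + 2 / (3 * real CARD('n)) * Dvar"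
    by (rule fb(2))
qed

lemma cond_exp_g: "AE z in M. vec_cond_exp M (Hk k) (g k i) z = gb k i z"
proof -
  define \<phi> where "\<phi> z u = gs i (fst (u (k, i))) (x k z) - h k i z + mean (\<lambda>l. h k l z)"
    for z and u :: "nat \<times> 'n \<Rightarrow> (real^'m) \<times> 'c \<times> 'q"
  have hm: "(\<lambda>z. mean (\<lambda>l. h k l z)) \<in> borel_measurable (Hk k)"
    by (intro borel_measurable_mean state_measurable)
  have "(\<lambda>p. gs i (fst (snd p (k, i))) (x k (fst p)) - h k i (fst p) + mean (\<lambda>l. h k l (fst p)))
      \<in> borel_measurable (Hk k \<Otimes>\<^sub>M RS k)"
    by (intro borel_measurable_add borel_measurable_diff measurable_gs_now measurable_past[OF hm] measurable_past state_measurable)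
  then have \<phi>_meas: "case_prod \<phi> \<in> borel_measurable (Hk k \<Otimes>\<^sub>M RS k)"
    by (simp add: \<phi>_def case_prod_unfold)
  have X: "g k i z = \<phi> z (RD k z)" if "z \<in> space M" for z
    using that by (simp add: \<phi>_def run_step draw_def)
  have m: "has_bochner_integral M (\<lambda>y. \<phi> z (RD k y)) (gb k i z)" if "z \<in> space M" for z
    using integral_sample[of i "\<lambda>u. gs i u (x k z)" k] mean_gs[of i "x k z"]
    unfolding \<phi>_def round_draw_components gb_def
    by (simp add: has_bochner_integral_iff prob_space)
  show ?thesis
    using vec_cond_exp_freeze[OF sub_Hk indep_RD \<phi>_meas, OF X sq_int_integrable[OF sq_g[OF state_sq]] m] by simp
qed

lemma cond_exp_mean_g:
  "AE z in M. vec_cond_exp M (Hk k) (\<lambda>z. mean (\<lambda>i. g k i z)) z = grad (f_glob F) (x k z)"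
proof -
  define \<phi> where "\<phi> z u = mean (\<lambda>i. gs i (fst (u (k, i))) (x k z))"
    for z and u :: "nat \<times> 'n \<Rightarrow> (real^'m) \<times> 'c \<times> 'q"
  have "(\<lambda>p. mean (\<lambda>i. gs i (fst (snd p (k, i))) (x k (fst p)))) \<in> borel_measurable (Hk k \<Otimes>\<^sub>M RS k)"
    by (intro borel_measurable_mean measurable_gs_now)
  then have \<phi>_meas: "case_prod \<phi> \<in> borel_measurable (Hk k \<Otimes>\<^sub>M RS k)"
    by (simp add: \<phi>_def case_prod_unfold)
  have X: "mean (\<lambda>i. g k i z) = \<phi> z (RD k z)" if "z \<in> space M" for z
    using that by (simp add: \<phi>_def mean_g draw_def)
  have m: "has_bochner_integral M (\<lambda>y. \<phi> z (RD k y)) (grad (f_glob F) (x k z))" if "z \<in> space M" for z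
  proof -
    have "integrable M (\<lambda>y. gs i (\<xi> k i y) (x k z))"
      "(\<integral>y. gs i (\<xi> k i y) (x k z) \<partial>M) = gl i (x k z)" for i
      using integral_sample[of i "\<lambda>u. gs i u (x k z)" k] mean_gs[of i "x k z"]
      by (auto simp: has_bochner_integral_iff)
    then show ?thesis
      unfolding \<phi>_def round_draw_components has_bochner_integral_iff grad_glob mean_def by simp
  qed
  have "integrable M (\<lambda>z. mean (\<lambda>i. g k i z))"
    by (intro sq_int_integrable sq_int_mean sq_g state_sq)
  from vec_cond_exp_freeze[OF sub_Hk indep_RD \<phi>_meas, OF X this m] show ?thesis by simp
qed

lemma virtual_step:
  defines "X \<equiv> \<lambda>k z. (norm (x k z - mean (\<lambda>i. e k i z) - xs))\<^sup>2"
  shows "integrable M (X k)"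
    and "integrable M (\<lambda>z. X k z
      - 2 * \<gamma> * ((x k z - mean (\<lambda>i. e k i z) - xs) \<bullet> grad (f_glob F) (x k z))
      + \<gamma>\<^sup>2 * (4 * \<L> * gap (x k z) + 2 / (3 * real CARD('n)) * Dvar))"
    and "(\<integral>z. X (Suc k) z \<partial>M) \<le> (\<integral>z. X k z
      - 2 * \<gamma> * ((x k z - mean (\<lambda>i. e k i z) - xs) \<bullet> grad (f_glob F) (x k z))
      + \<gamma>\<^sup>2 * (4 * \<L> * gap (x k z) + 2 / (3 * real CARD('n)) * Dvar) \<partial>M)"
proof -
  define b where "b z = x k z - mean (\<lambda>i. e k i z) - xs" for z
  have "sq_int (\<lambda>z. x k z - mean (\<lambda>i. e k i z) - xs)" for k
    by (intro sq_int_diff sq_int_mean sq_int_const sq_x sq_e)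
  then show "integrable M (X k)" by (simp add: X_def sq_int_def)
  have b: "sq_int b" unfolding b_def by (intro sq_int_diff sq_int_mean sq_int_const sq_x sq_e)
  have d: "sq_int (\<lambda>z. grad (f_glob F) (x k z))"
    unfolding grad_glob by (intro sq_int_mean sq_gl state_sq)
  define r where "r z = (norm (b z))\<^sup>2 - 2 * \<gamma> * (b z \<bullet> grad (f_glob F) (x k z))
      + \<gamma>\<^sup>2 * (4 * \<L> * gap (x k z) + 2 / (3 * real CARD('n)) * Dvar)" for z
  have inner: "integrable M (\<lambda>z. b z \<bullet> grad (f_glob F) (x k z))"
  proof (rule Bochner_Integration.integrable_bound)
    show "integrable M (\<lambda>z. (norm (b z))\<^sup>2 + (norm (grad (f_glob F) (x k z)))\<^sup>2)"
      using b d by (simp add: sq_int_def)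
    show "(\<lambda>z. b z \<bullet> grad (f_glob F) (x k z)) \<in> borel_measurable M"
      using b d by (auto simp: sq_int_def)
    have "\<bar>p \<bullet> q\<bar> \<le> (norm p)\<^sup>2 + (norm q)\<^sup>2" for p q :: 'a
      using young_inner[of 1 p q] young_inner[of 1 p "- q"] zero_le_power2[of "norm p"]
        zero_le_power2[of "norm q"]
      by (simp add: abs_le_iff)
    then show "AE z in M. norm (b z \<bullet> grad (f_glob F) (x k z))
        \<le> norm ((norm (b z))\<^sup>2 + (norm (grad (f_glob F) (x k z)))\<^sup>2)"
      by (intro AE_I2) simp
  qed
  have r: "integrable M r"
    unfolding r_def using b inner integrable_gap by (simp add: sq_int_def)
  then show "integrable M (\<lambda>z. X k z
      - 2 * \<gamma> * ((x k z - mean (\<lambda>i. e k i z) - xs) \<bullet> grad (f_glob F) (x k z))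
      + \<gamma>\<^sup>2 * (4 * \<L> * gap (x k z) + 2 / (3 * real CARD('n)) * Dvar))"
    unfolding r_def X_def b_def .
  define \<phi> where "\<phi> z u = (norm (b z - \<gamma> *\<^sub>R mean (\<lambda>i. gs i (fst (u (k, i))) (x k z))))\<^sup>2"
    for z and u :: "nat \<times> 'n \<Rightarrow> (real^'m) \<times> 'c \<times> 'q"
  have b_meas: "b \<in> borel_measurable (Hk k)"
    unfolding b_def by (intro borel_measurable_diff borel_measurable_mean borel_measurable_const state_measurable)
  have "(\<lambda>p. b (fst p) - \<gamma> *\<^sub>R mean (\<lambda>i. gs i (fst (snd p (k, i))) (x k (fst p))))
      \<in> borel_measurable (Hk k \<Otimes>\<^sub>M RS k)"
    by (intro borel_measurable_diff borel_measurable_scaleR borel_measurable_const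
        borel_measurable_mean measurable_gs_now measurable_past[OF b_meas])
  then have \<phi>_meas: "case_prod \<phi> \<in> borel_measurable (Hk k \<Otimes>\<^sub>M RS k)"
    by (simp add: \<phi>_def case_prod_unfold)
  have X: "X (Suc k) z = \<phi> z (RD k z)" if "z \<in> space M" for z
    unfolding X_def \<phi>_def b_def round_draw_components virtual_iterate_step[OF that]
    by (simp add: algebra_simps)
  have bound: "(\<integral>\<^sup>+y. ennreal (\<phi> z (RD k y)) \<partial>M) \<le> ennreal (r z)" if "z \<in> space M" for z
    unfolding \<phi>_def round_draw_components r_def by (rule one_step_virtual)
  have r0: "0 \<le> r z" for z
    unfolding r_def by (rule one_step_virtual)
  have \<phi>0: "0 \<le> \<phi> z u" for z u by (simp add: \<phi>_def)
  note fb = freeze_bound[OF sub_Hk indep_RD \<phi>_meas, OF X \<phi>0 r r0 bound]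
  have "(\<integral>z. X (Suc k) z \<partial>M) \<le> (\<integral>z. r z \<partial>M)"
    by (rule fb(3))
  then show "(\<integral>z. X (Suc k) z \<partial>M) \<le> (\<integral>z. X k z
      - 2 * \<gamma> * ((x k z - mean (\<lambda>i. e k i z) - xs) \<bullet> grad (f_glob F) (x k z))
      + \<gamma>\<^sup>2 * (4 * \<L> * gap (x k z) + 2 / (3 * real CARD('n)) * Dvar) \<partial>M)"
    by (simp add: r_def X_def b_def)
qed

section \<open>The conditional inequalities of the parametric assumption\<close>

text \<open>The shifts enter \<open>gb\<close> only through the deviation of \<open>h k i - gl i xs\<close> from its average over the
  workers, and centering does not increase the mean square.\<close>

lemma mean_gb_sq_le: "mean (\<lambda>i. (norm (gb k i z))\<^sup>2) \<le> 4 * L * gap (x k z) + 2 * \<sigma> k z"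
proof -
  let ?a = "\<lambda>i. gl i (x k z) - gl i xs" and ?b = "\<lambda>i. h k i z - gl i xs"
  have "gb k i z = ?a i + - (?b i - mean ?b)" for i
    by (simp add: gb_def mean_diff mean_gl_xs)
  then have "(norm (gb k i z))\<^sup>2 \<le> 2 * (norm (?a i))\<^sup>2 + 2 * (norm (?b i - mean ?b))\<^sup>2" for i
    using norm_add_sq_le[of "?a i" "- (?b i - mean ?b)"] by (simp only: norm_minus_cancel)
  then have "mean (\<lambda>i. (norm (gb k i z))\<^sup>2)
      \<le> mean (\<lambda>i. 2 * (norm (?a i))\<^sup>2 + 2 * (norm (?b i - mean ?b))\<^sup>2)"
    by (rule mean_mono)
  also have "\<dots> = 2 * mean (\<lambda>i. (norm (?a i))\<^sup>2) + 2 * mean (\<lambda>i. (norm (?b i - mean ?b))\<^sup>2)"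
    by (simp only: mean_add mean_mult)
  also have "\<dots> \<le> 2 * (2 * L * gap (x k z)) + 2 * \<sigma> k z"
    unfolding \<sigma>_def by (intro add_mono mult_left_mono gl_diff_sq_le mean_sq_centered_le) auto
  finally show ?thesis by simp
qed

text \<open>The shifts are known given the history, so the noise of \<open>g k i\<close> is that of the stochastic gradient.\<close>

lemma noise_of_g:
  shows "integrable M (\<lambda>z. (norm (g k i z - vec_cond_exp M (Hk k) (g k i) z))\<^sup>2)"
    and "AE z in M. real_cond_exp M (Hk k) (\<lambda>z. (norm (g k i z - vec_cond_exp M (Hk k) (g k i) z))\<^sup>2) z
      \<le> Var_ub i (x k z)"
proof -
  interpret S: sigma_finite_subalgebra M "Hk k" by (rule subalgebra_sigma_finite[OF sub_Hk])
  let ?X = "\<lambda>z. (norm (g k i z - vec_cond_exp M (Hk k) (g k i) z))\<^sup>2"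
    and ?Y = "\<lambda>z. (norm (gh k i z - gl i (x k z)))\<^sup>2"
  have eq: "AE z in M. ?X z = ?Y z"
    using cond_exp_g[of k i] AE_space
  proof eventually_elim
    case (elim z)
    have "g k i z - gb k i z = gh k i z - gl i (x k z)"
      unfolding run_step(2)[OF elim(2)] gb_def by simp
    then show ?case by (simp only: elim(1))
  qed
  have "(\<lambda>z. g k i z - vec_cond_exp M (Hk k) (g k i) z) \<in> borel_measurable M"
    using sq_g[OF state_sq, of k i] by (intro borel_measurable_diff vec_cond_exp_measurable)
      (simp add: sq_int_def)
  then have X: "?X \<in> borel_measurable M" by simp
  have Y: "?Y \<in> borel_measurable M" using deviation_step(1)[OF state_sq] by auto
  show "integrable M ?X"
    using deviation_step(1)[OF state_sq, of k i] integrable_cong_AE[OF X Y eq] by simp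
  show "AE z in M. real_cond_exp M (Hk k) ?X z \<le> Var_ub i (x k z)"
    using S.real_cond_exp_cong[OF eq X Y] deviation_step(2)[OF state_sq, of k i]
    by eventually_elim simp
qed

text \<open>The condition \<open>\<alpha> * (\<omega> + 1) \<le> 1\<close> is spent on the gap part of the variance only; its constant part keeps
  the factor \<open>\<alpha>\<^sup>2 * (\<omega> + 1)\<close>, as \<open>D2\<close> requires.\<close>

lemma mean_shift_bound:
  "mean (\<lambda>i. (1 - \<alpha>) * (norm (h k i z - gl i xs))\<^sup>2 + \<alpha> * (norm (gl i (x k z) - gl i xs))\<^sup>2
      + \<alpha>\<^sup>2 * (\<omega> + 1) * Var_ub i (x k z))
    \<le> (1 - \<alpha>) * \<sigma> k z + (2 * \<alpha> * L + 4 * \<alpha> * \<L>) * gap (x k z) + 2 / 3 * (\<alpha>\<^sup>2 * (\<omega> + 1) * Dvar)"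
proof -
  have "\<alpha> * mean (\<lambda>i. (norm (gl i (x k z) - gl i xs))\<^sup>2) \<le> \<alpha> * (2 * L * gap (x k z))"
    using alpha by (intro mult_left_mono gl_diff_sq_le) auto
  moreover have "\<alpha>\<^sup>2 * (\<omega> + 1) * (4 * \<L> * gap (x k z)) \<le> \<alpha> * (4 * \<L> * gap (x k z))"
  proof (rule mult_right_mono)
    show "\<alpha>\<^sup>2 * (\<omega> + 1) \<le> \<alpha>"
      using mult_left_mono[OF alpha_le, of \<alpha>] alpha(1) by (simp add: power2_eq_square mult.assoc)
  qed (use cL_pos gap_nonneg in simp)
  moreover have "\<alpha>\<^sup>2 * (\<omega> + 1) * mean (\<lambda>i. Var_ub i (x k z))
      = \<alpha>\<^sup>2 * (\<omega> + 1) * (4 * \<L> * gap (x k z)) + 2 / 3 * (\<alpha>\<^sup>2 * (\<omega> + 1) * Dvar)"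
    unfolding mean_Var_ub by (simp add: algebra_simps)
  ultimately show ?thesis
    by (simp only: mean_add mean_mult \<sigma>_def[symmetric] distrib_right)
qed

lemma conditional_shift:
  "AE z in M. real_cond_exp M (Hk k) (\<sigma> (Suc k)) z
    \<le> (1 - \<alpha>) * \<sigma> k z + (2 * \<alpha> * L + 4 * \<alpha> * \<L>) * gap (x k z) + 2 / 3 * (\<alpha>\<^sup>2 * (\<omega> + 1) * Dvar)"
proof -
  let ?X = "\<lambda>i z. (norm (h (Suc k) i z - gl i xs))\<^sup>2"
  have "AE z in M. \<forall>i\<in>UNIV. real_cond_exp M (Hk k) (?X i) z
      \<le> (1 - \<alpha>) * (norm (h k i z - gl i xs))\<^sup>2 + \<alpha> * (norm (gl i (x k z) - gl i xs))\<^sup>2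
        + \<alpha>\<^sup>2 * (\<omega> + 1) * Var_ub i (x k z)"
    by (intro AE_finite_allI shift_step(3) state_sq) auto
  moreover have "AE z in M. real_cond_exp M (Hk k) (\<lambda>z. mean (\<lambda>i. ?X i z)) z
      = mean (\<lambda>i. real_cond_exp M (Hk k) (?X i) z)"
    by (rule real_cond_exp_mean[OF sub_Hk integrable_h_dev])
  ultimately show ?thesis
  proof eventually_elim
    case (elim z)
    have "real_cond_exp M (Hk k) (\<sigma> (Suc k)) z = mean (\<lambda>i. real_cond_exp M (Hk k) (?X i) z)"
      using elim(2) by (simp add: \<sigma>_def[abs_def])
    also have "\<dots> \<le> mean (\<lambda>i. (1 - \<alpha>) * (norm (h k i z - gl i xs))\<^sup>2
        + \<alpha> * (norm (gl i (x k z) - gl i xs))\<^sup>2 + \<alpha>\<^sup>2 * (\<omega> + 1) * Var_ub i (x k z))"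
      using elim(1) by (intro mean_mono) blast
    finally show ?case using mean_shift_bound[of k z] by linarith
  qed
qed

lemma conditional_bounds:
  "AE z in M.
     vec_cond_exp M (Hk k) (\<lambda>z. mean (\<lambda>i. g k i z)) z = grad (f_glob F) (x k z) \<and>
     mean (\<lambda>i. (norm (vec_cond_exp M (Hk k) (g k i) z))\<^sup>2) \<le> 4 * L * gap (x k z) + 2 * \<sigma> k z \<and>
     mean (\<lambda>i. real_cond_exp M (Hk k) (\<lambda>z. (norm (g k i z - vec_cond_exp M (Hk k) (g k i) z))\<^sup>2) z)
       \<le> 6 * (\<L> + L) * gap (x k z) + Dvar \<and>
     real_cond_exp M (Hk k) (\<lambda>z. (norm (mean (\<lambda>i. g k i z)))\<^sup>2) z
       \<le> 4 * \<L> * gap (x k z) + 2 / (3 * real CARD('n)) * Dvar \<and>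
     real_cond_exp M (Hk k) (\<sigma> (Suc k)) z
       \<le> (1 - \<alpha>) * \<sigma> k z + 4 * \<alpha> * (3 * \<L> + 4 * L) * gap (x k z) + \<alpha>\<^sup>2 * (\<omega> + 1) * Dvar"
proof -
  have "AE z in M. \<forall>i\<in>UNIV. vec_cond_exp M (Hk k) (g k i) z = gb k i z"
    by (intro AE_finite_allI cond_exp_g) auto
  moreover have "AE z in M. \<forall>i\<in>UNIV.
      real_cond_exp M (Hk k) (\<lambda>z. (norm (g k i z - vec_cond_exp M (Hk k) (g k i) z))\<^sup>2) z
        \<le> Var_ub i (x k z)"
    by (intro AE_finite_allI noise_of_g(2)) auto
  ultimately show ?thesis
    using cond_exp_mean_g[of k] mean_gradient_step(2)[of k] conditional_shift[of k]
  proof eventually_elim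
    case (elim z)
    have "mean (\<lambda>i. (norm (vec_cond_exp M (Hk k) (g k i) z))\<^sup>2) = mean (\<lambda>i. (norm (gb k i z))\<^sup>2)"
      using elim(1) by simp
    moreover have "mean (\<lambda>i. real_cond_exp M (Hk k) (\<lambda>z. (norm (g k i z - vec_cond_exp M (Hk k) (g k i) z))\<^sup>2) z)
        \<le> 4 * \<L> * gap (x k z) + 2 / 3 * Dvar"
      unfolding mean_Var_ub[symmetric] using elim(2) by (intro mean_mono) blast
    moreover have "4 * \<L> * gap (x k z) + 2 / 3 * Dvar \<le> 6 * (\<L> + L) * gap (x k z) + Dvar"
      using gap_nonneg[of "x k z"] cL_pos L_pos Dvar_nonneg by (intro add_mono mult_right_mono) auto
    moreover have "(2 * \<alpha> * L + 4 * \<alpha> * \<L>) * gap (x k z) + 2 / 3 * (\<alpha>\<^sup>2 * (\<omega> + 1) * Dvar)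
        \<le> 4 * \<alpha> * (3 * \<L> + 4 * L) * gap (x k z) + \<alpha>\<^sup>2 * (\<omega> + 1) * Dvar"
    proof (intro add_mono mult_right_mono)
      have "0 \<le> \<alpha> * \<L>" "0 \<le> \<alpha> * L" using alpha cL_pos L_pos by auto
      then show "2 * \<alpha> * L + 4 * \<alpha> * \<L> \<le> 4 * \<alpha> * (3 * \<L> + 4 * L)" by (simp add: algebra_simps)
      have "0 \<le> \<alpha>\<^sup>2 * (\<omega> + 1) * Dvar" using omega Dvar_nonneg by simp
      then show "2 / 3 * (\<alpha>\<^sup>2 * (\<omega> + 1) * Dvar) \<le> \<alpha>\<^sup>2 * (\<omega> + 1) * Dvar" by linarith
    qed (rule gap_nonneg)
    ultimately show ?case
      using elim(3-5) mean_gb_sq_le[of k z] by linarith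
  qed
qed

section \<open>Accumulated compression error\<close>

definition exp_gap :: "nat \<Rightarrow> real" where "exp_gap k = (\<integral>z. gap (x k z) \<partial>M)"
definition exp_shift :: "nat \<Rightarrow> real" where "exp_shift k = (\<integral>z. \<sigma> k z \<partial>M)"
definition exp_err :: "nat \<Rightarrow> real" where "exp_err k = (\<integral>z. mean (\<lambda>i. (norm (e k i z))\<^sup>2) \<partial>M)"
definition exp_dist :: "nat \<Rightarrow> real" where
  "exp_dist k = (\<integral>z. (norm (x k z - mean (\<lambda>i. e k i z) - xs))\<^sup>2 \<partial>M)"

lemma exp_gap_nonneg: "0 \<le> exp_gap k" and exp_shift_nonneg: "0 \<le> exp_shift k" and exp_dist_nonneg: "0 \<le> exp_dist k"
  unfolding exp_gap_def exp_shift_def exp_dist_def \<sigma>_def by (simp_all add: gap_nonneg mean_nonneg)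

lemma integrable_e: "integrable M (\<lambda>z. (norm (e k i z))\<^sup>2)"
  using sq_e by (simp add: sq_int_def)

lemma integrable_mean_e: "integrable M (\<lambda>z. mean (\<lambda>i. (norm (e k i z))\<^sup>2))"
  by (rule integral_mean(1)) (rule integrable_e)

lemma exp_err_step:
  "exp_err (Suc k) \<le> (1 - \<delta> / 2) * exp_err k + \<gamma>\<^sup>2 * (8 * L / \<delta> + 4 * \<L>) * exp_gap k + \<gamma>\<^sup>2 * (4 / \<delta>) * exp_shift k
    + 2 / 3 * \<gamma>\<^sup>2 * Dvar"
proof -
  let ?r = "\<lambda>i z. (1 - \<delta> / 2) * (norm (e k i z))\<^sup>2 + \<gamma>\<^sup>2 * (2 / \<delta> * (norm (gb k i z))\<^sup>2 + Var_ub i (x k z))"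
  let ?R = "\<lambda>z. (1 - \<delta> / 2) * mean (\<lambda>i. (norm (e k i z))\<^sup>2)
    + \<gamma>\<^sup>2 * (8 * L / \<delta> + 4 * \<L>) * gap (x k z) + \<gamma>\<^sup>2 * (4 / \<delta>) * \<sigma> k z + 2 / 3 * \<gamma>\<^sup>2 * Dvar"
  have r: "integrable M (?r i)" for i by (rule error_step(1)[OF state_sq])
  have R: "integrable M ?R"
    using integrable_mean_e integrable_gap integrable_\<sigma> by simp
  have "exp_err (Suc k) = mean (\<lambda>i. \<integral>z. (norm (e (Suc k) i z))\<^sup>2 \<partial>M)"
    unfolding exp_err_def by (rule integral_mean(2)) (rule integrable_e)
  also have "\<dots> \<le> mean (\<lambda>i. \<integral>z. ?r i z \<partial>M)"
    by (intro mean_mono error_step(3) state_sq)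
  also have "\<dots> = (\<integral>z. mean (\<lambda>i. ?r i z) \<partial>M)"
    by (rule integral_mean(2)[symmetric]) (rule r)
  also have "\<dots> \<le> (\<integral>z. ?R z \<partial>M)"
  proof (rule integral_mono[OF integral_mean(1)[OF r] R])
    fix z
    have "2 / \<delta> * mean (\<lambda>i. (norm (gb k i z))\<^sup>2) \<le> 2 / \<delta> * (4 * L * gap (x k z) + 2 * \<sigma> k z)"
      using delta by (intro mult_left_mono mean_gb_sq_le) auto
    then have "\<gamma>\<^sup>2 * (2 / \<delta> * mean (\<lambda>i. (norm (gb k i z))\<^sup>2) + (4 * \<L> * gap (x k z) + 2 / 3 * Dvar))
        \<le> \<gamma>\<^sup>2 * (2 / \<delta> * (4 * L * gap (x k z) + 2 * \<sigma> k z) + (4 * \<L> * gap (x k z) + 2 / 3 * Dvar))"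
      by (intro mult_left_mono) auto
    moreover have "mean (\<lambda>i. ?r i z) = (1 - \<delta> / 2) * mean (\<lambda>i. (norm (e k i z))\<^sup>2)
        + \<gamma>\<^sup>2 * (2 / \<delta> * mean (\<lambda>i. (norm (gb k i z))\<^sup>2) + (4 * \<L> * gap (x k z) + 2 / 3 * Dvar))"
      by (simp only: mean_add mean_mult mean_Var_ub)
    moreover have "?R z = (1 - \<delta> / 2) * mean (\<lambda>i. (norm (e k i z))\<^sup>2)
        + \<gamma>\<^sup>2 * (2 / \<delta> * (4 * L * gap (x k z) + 2 * \<sigma> k z) + (4 * \<L> * gap (x k z) + 2 / 3 * Dvar))"
      by (simp add: algebra_simps add_divide_distrib)
    ultimately show "mean (\<lambda>i. ?r i z) \<le> ?R z" by linarith
  qed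
  also have "\<dots> = (1 - \<delta> / 2) * exp_err k + \<gamma>\<^sup>2 * (8 * L / \<delta> + 4 * \<L>) * exp_gap k + \<gamma>\<^sup>2 * (4 / \<delta>) * exp_shift k
    + 2 / 3 * \<gamma>\<^sup>2 * Dvar"
    using integrable_mean_e[of k] integrable_gap[of k] integrable_\<sigma>[of k]
    by (simp add: exp_err_def exp_gap_def exp_shift_def prob_space)
  finally show ?thesis .
qed

lemma exp_shift_step:
  "exp_shift (Suc k) \<le> (1 - \<alpha>) * exp_shift k + (2 * \<alpha> * L + 4 * \<alpha> * \<L>) * exp_gap k + 2 / 3 * (\<alpha>\<^sup>2 * (\<omega> + 1) * Dvar)"
proof -
  interpret S: sigma_finite_subalgebra M "Hk k" by (rule subalgebra_sigma_finite[OF sub_Hk])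
  have "exp_shift (Suc k) = (\<integral>z. real_cond_exp M (Hk k) (\<sigma> (Suc k)) z \<partial>M)"
    unfolding exp_shift_def by (rule S.real_cond_exp_int(2)[symmetric]) (rule integrable_\<sigma>)
  also have "\<dots> \<le> (\<integral>z. (1 - \<alpha>) * \<sigma> k z + (2 * \<alpha> * L + 4 * \<alpha> * \<L>) * gap (x k z)
      + 2 / 3 * (\<alpha>\<^sup>2 * (\<omega> + 1) * Dvar) \<partial>M)"
    by (rule integral_mono_AE[OF S.real_cond_exp_int(1)[OF integrable_\<sigma>] _ conditional_shift])
      (use integrable_\<sigma> integrable_gap in simp)
  also have "\<dots> = (1 - \<alpha>) * exp_shift k + (2 * \<alpha> * L + 4 * \<alpha> * \<L>) * exp_gap k + 2 / 3 * (\<alpha>\<^sup>2 * (\<omega> + 1) * Dvar)"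
    using integrable_gap[of k] integrable_\<sigma>[of k] by (simp add: exp_gap_def exp_shift_def prob_space)
  finally show ?thesis .
qed

text \<open>The value of \<open>rate\<close> at the parameters of the theorem.\<close>

definition eta :: real where "eta = min (\<gamma> * \<mu> / 2) (\<alpha> / 4)"

text \<open>The weights must not outgrow the contraction of the errors: \<open>eta \<le> \<delta> / 4\<close> comes from \<open>\<mu> \<le> L\<close> and from
  \<open>4 * \<gamma> * L \<le> \<delta>\<close>.\<close>

lemma eta: "0 \<le> eta" "eta \<le> \<gamma> * \<mu> / 2" "eta \<le> \<alpha> / 4" "eta \<le> \<delta> / 4" "eta < 1"
proof -
  show "0 \<le> eta" "eta \<le> \<gamma> * \<mu> / 2" "eta \<le> \<alpha> / 4" using gamma(1) mu alpha(1) by (auto simp: eta_def)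
  then show "eta < 1" using alpha_less by simp
  have "\<gamma> * \<mu> \<le> \<gamma> * L" using mu_le_L gamma(1) by (intro mult_left_mono) auto
  then show "eta \<le> \<delta> / 4" using \<open>eta \<le> \<gamma> * \<mu> / 2\<close> gamma_L delta by simp
qed

text \<open>The constants \<open>F1\<close>, \<open>D3\<close>, \<open>D1'\<close> and the initial value of \<open>\<sigma>\<close>.\<close>

definition F1_const :: real where "F1_const = 96 * L * \<gamma>\<^sup>2 / (\<delta>\<^sup>2 * \<alpha> * (1 - eta))"
definition D3_const :: real where "D3_const = 6 * L * \<gamma> / \<delta> * (4 * \<alpha> * (\<omega> + 1) / \<delta> + 1) * Dvar"
definition D1_const :: real where "D1_const = 2 / (3 * real CARD('n)) * Dvar"
definition shift0 :: real where "shift0 = mean (\<lambda>i. (norm (h0 i - gl i xs))\<^sup>2)"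

lemma constants_nonneg: "0 \<le> F1_const" "0 \<le> D3_const" "0 \<le> D1_const" "0 \<le> shift0"
  using L_pos gamma(1) delta alpha eta omega Dvar_nonneg
  by (auto simp: F1_const_def D3_const_def D1_const_def shift0_def mean_nonneg)

lemma \<sigma>_0: "z \<in> space M \<Longrightarrow> \<sigma> 0 z = shift0"
  by (simp add: \<sigma>_def shift0_def run_init)

lemma initial_values: "exp_err 0 = 0" "exp_shift 0 = shift0" "exp_dist 0 = (norm (x0 - xs))\<^sup>2"
proof -
  have "exp_err 0 = (\<integral>z. 0 \<partial>M)"
    unfolding exp_err_def by (rule Bochner_Integration.integral_cong) (simp_all add: run_init)
  then show "exp_err 0 = 0" by simp
  have "exp_shift 0 = (\<integral>z. shift0 \<partial>M)"
    unfolding exp_shift_def by (rule Bochner_Integration.integral_cong) (simp_all add: \<sigma>_0)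
  then show "exp_shift 0 = shift0" by (simp add: prob_space)
  have "exp_dist 0 = (\<integral>z. (norm (x0 - xs))\<^sup>2 \<partial>M)"
    unfolding exp_dist_def by (rule Bochner_Integration.integral_cong) (simp_all add: run_init)
  then show "exp_dist 0 = (norm (x0 - xs))\<^sup>2" by (simp add: prob_space)
qed

lemma sum_exp_gap_nonneg: "0 \<le> (\<Sum>k\<le>K. wt eta k * exp_gap k)"
  using wt_pos[OF eta(5)] exp_gap_nonneg by (intro sum_nonneg) (simp add: less_imp_le)

text \<open>The constants of \<open>weighted_sum_coupled\<close> for the two recursions. The coefficient of the gap is
  at most \<open>6 * L * \<gamma>\<^sup>2 / \<delta>\<^sup>2\<close> times the factor \<open>4 * L + 3 * \<delta> * (\<L> + L) + 16 * (3 * \<L> + 4 * L)\<close> of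
  \<open>gamma_sq\<close>, hence at most \<open>1 / 16\<close>.\<close>

lemma accumulated_error:
  "3 * L * (\<Sum>k\<le>K. wt eta k * exp_err k)
    \<le> 1 / 16 * (\<Sum>k\<le>K. wt eta k * exp_gap k) + 2 / 3 * (F1_const * shift0) + 2 / 3 * (\<gamma> * D3_const * Wt eta K)"
proof -
  define P where "P = \<gamma>\<^sup>2 * (8 * L / \<delta> + 4 * \<L>)"
  define R where "R = \<gamma>\<^sup>2 * (4 / \<delta>)"
  define B where "B = 2 * \<alpha> * L + 4 * \<alpha> * \<L>"
  define c where "c = 2 / 3 * \<gamma>\<^sup>2 * Dvar"
  define d where "d = 2 / 3 * (\<alpha>\<^sup>2 * (\<omega> + 1) * Dvar)"
  note pos = delta alpha alpha_less L_pos cL_pos gamma(1) omega Dvar_nonneg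
  have "(\<Sum>k\<le>K. wt eta k * exp_err k)
    \<le> 4 / \<delta> * ((P + R * (4 / (3 * \<alpha>) * B)) * (\<Sum>k\<le>K. wt eta k * exp_gap k) + R * (4 / (3 * \<alpha>)) * exp_shift 0)
      + 2 / \<delta> * (c + R * (d / \<alpha>)) * Wt eta K"
  proof (rule weighted_sum_coupled)
    show "exp_err (Suc k) \<le> (1 - \<delta> / 2) * exp_err k + P * exp_gap k + R * exp_shift k + c" for k
      unfolding P_def R_def c_def by (rule exp_err_step)
    show "exp_shift (Suc k) \<le> (1 - \<alpha>) * exp_shift k + B * exp_gap k + d" for k
      unfolding B_def d_def by (rule exp_shift_step)
  qed (use pos eta exp_gap_nonneg exp_shift_nonneg initial_values constants_nonneg(4) in \<open>auto simp: P_def R_def B_def c_def d_def\<close>)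
  then have "3 * L * (\<Sum>k\<le>K. wt eta k * exp_err k) \<le> 3 * L *
    (4 / \<delta> * ((P + R * (4 / (3 * \<alpha>) * B)) * (\<Sum>k\<le>K. wt eta k * exp_gap k) + R * (4 / (3 * \<alpha>)) * shift0)
      + 2 / \<delta> * (c + R * (d / \<alpha>)) * Wt eta K)"
    unfolding initial_values(2) using L_pos by (intro mult_left_mono) auto
  also have "\<dots> = (3 * L * (4 / \<delta>) * (P + R * (4 / (3 * \<alpha>) * B))) * (\<Sum>k\<le>K. wt eta k * exp_gap k)
      + (3 * L * (4 / \<delta>) * (R * (4 / (3 * \<alpha>)))) * shift0
      + (3 * L * (2 / \<delta> * (c + R * (d / \<alpha>)))) * Wt eta K"
    by (simp add: algebra_simps)
  also have "\<dots> \<le> 1 / 16 * (\<Sum>k\<le>K. wt eta k * exp_gap k) + (2 / 3 * F1_const) * shift0 + (2 / 3 * (\<gamma> * D3_const)) * Wt eta K"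
  proof (intro add_mono mult_right_mono)
    define X where "X = 4 * L + 3 * \<delta> * (\<L> + L) + 16 * (3 * \<L> + 4 * L)"
    have "3 * L * (4 / \<delta>) * (P + R * (4 / (3 * \<alpha>) * B))
        = 12 * L * \<gamma>\<^sup>2 / \<delta>\<^sup>2 * (8 * L + 4 * \<delta> * \<L> + 16 / 3 * (2 * L + 4 * \<L>))"
      using pos by (simp add: P_def R_def B_def field_simps power2_eq_square)
    also have "\<dots> \<le> 12 * L * \<gamma>\<^sup>2 / \<delta>\<^sup>2 * (X / 2)"
    proof (rule mult_left_mono)
      have "8 * L + 4 * p + 16 / 3 * (2 * L + 4 * \<L>) \<le> (4 * L + (3 * p + 3 * q) + 16 * (3 * \<L> + 4 * L)) / 2"
        if "p \<le> \<L>" "0 \<le> q" for p q :: real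
        using that L_pos cL_pos by argo
      moreover have "\<delta> * \<L> \<le> \<L>" "0 \<le> \<delta> * L" using pos by (auto simp: mult_left_le_one_le)
      ultimately have "8 * L + 4 * (\<delta> * \<L>) + 16 / 3 * (2 * L + 4 * \<L>)
          \<le> (4 * L + (3 * (\<delta> * \<L>) + 3 * (\<delta> * L)) + 16 * (3 * \<L> + 4 * L)) / 2"
        by blast
      then show "8 * L + 4 * \<delta> * \<L> + 16 / 3 * (2 * L + 4 * \<L>) \<le> X / 2"
        unfolding X_def by (simp only: mult.assoc distrib_left)
    qed (use pos in simp)
    also have "\<dots> = 96 * L * X * \<gamma>\<^sup>2 / (16 * \<delta>\<^sup>2)" by (simp add: field_simps)
    also have "\<dots> \<le> 1 / 16"
      using gamma_sq delta unfolding X_def[symmetric] by (simp add: divide_le_eq)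
    finally show "3 * L * (4 / \<delta>) * (P + R * (4 / (3 * \<alpha>) * B)) \<le> 1 / 16" .
    have "3 * L * (4 / \<delta>) * (R * (4 / (3 * \<alpha>))) = 2 / 3 * (96 * L * \<gamma>\<^sup>2 / (\<delta>\<^sup>2 * \<alpha>))"
      using pos by (simp add: R_def field_simps power2_eq_square)
    also have "96 * L * \<gamma>\<^sup>2 / (\<delta>\<^sup>2 * \<alpha>) \<le> F1_const"
      unfolding F1_const_def using pos eta by (intro divide_left_mono mult_left_le mult_pos_pos) auto
    finally show "3 * L * (4 / \<delta>) * (R * (4 / (3 * \<alpha>))) \<le> 2 / 3 * F1_const" by simp
    show "3 * L * (2 / \<delta> * (c + R * (d / \<alpha>))) \<le> 2 / 3 * (\<gamma> * D3_const)"
      using pos by (simp add: R_def c_def d_def D3_const_def field_simps power2_eq_square)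
  qed (use sum_exp_gap_nonneg constants_nonneg Wt_pos[OF eta(5)] in \<open>auto simp: less_imp_le\<close>)
  finally show ?thesis by simp
qed

section \<open>Convergence of the averaged iterate\<close>

text \<open>Of the \<open>3 / 2\<close> of the gap that \<open>descent_perturbed\<close> gains, the second moment of the stochastic
  gradient takes \<open>4 * \<L> * \<gamma> \<le> 1\<close>.\<close>

lemma exp_dist_step:
  "exp_dist (Suc k) \<le> (1 - eta) * exp_dist k - \<gamma> / 2 * exp_gap k + (5 * \<gamma> * L * exp_err k + \<gamma>\<^sup>2 * D1_const)"
proof -
  let ?T = "\<lambda>z. (norm (x k z - mean (\<lambda>i. e k i z) - xs))\<^sup>2"
  let ?R = "\<lambda>z. (1 - eta) * ?T z - \<gamma> / 2 * gap (x k z)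
    + (5 * \<gamma> * L * mean (\<lambda>i. (norm (e k i z))\<^sup>2) + \<gamma>\<^sup>2 * D1_const)"
  let ?r = "\<lambda>z. ?T z - 2 * \<gamma> * ((x k z - mean (\<lambda>i. e k i z) - xs) \<bullet> grad (f_glob F) (x k z))
      + \<gamma>\<^sup>2 * (4 * \<L> * gap (x k z) + D1_const)"
  have T: "integrable M ?T" by (rule virtual_step(1))
  have R: "integrable M ?R"
    using T integrable_gap[of k] integrable_mean_e[of k] by simp
  have pointwise: "?r z \<le> ?R z" for z
  proof -
    have "\<gamma> * (- 2 * ((x k z - mean (\<lambda>i. e k i z) - xs) \<bullet> grad (f_glob F) (x k z)))
        \<le> \<gamma> * (- \<mu> / 2 * ?T z - 3 / 2 * gap (x k z) + 5 * L * (norm (mean (\<lambda>i. e k i z)))\<^sup>2)"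
      using gamma(1) by (intro mult_left_mono descent_perturbed) auto
    moreover have "\<gamma> * (5 * L * (norm (mean (\<lambda>i. e k i z)))\<^sup>2)
        \<le> \<gamma> * (5 * L * mean (\<lambda>i. (norm (e k i z))\<^sup>2))"
      using gamma(1) L_pos by (intro mult_left_mono norm_mean_sq_le) auto
    moreover have "\<gamma> * (4 * \<L> * \<gamma>) * gap (x k z) \<le> \<gamma> * 1 * gap (x k z)"
      using gamma(1) gamma_cL gap_nonneg by (intro mult_right_mono mult_left_mono) auto
    moreover have "eta * ?T z \<le> \<gamma> * \<mu> / 2 * ?T z"
      using eta(2) by (rule mult_right_mono) simp
    ultimately show ?thesis by (simp add: algebra_simps power2_eq_square)
  qed
  have "exp_dist (Suc k) \<le> (\<integral>z. ?r z \<partial>M)"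
    unfolding exp_dist_def D1_const_def by (rule virtual_step(3))
  also have "\<dots> \<le> (\<integral>z. ?R z \<partial>M)"
    using virtual_step(2)[of k] R pointwise unfolding D1_const_def by (intro integral_mono)
  also have "\<dots> = (1 - eta) * exp_dist k - \<gamma> / 2 * exp_gap k + (5 * \<gamma> * L * exp_err k + \<gamma>\<^sup>2 * D1_const)"
    using T integrable_gap[of k] integrable_mean_e[of k]
    by (simp add: exp_dist_def exp_gap_def exp_err_def prob_space)
  finally show ?thesis .
qed

text \<open>The error sum enters the telescoped descent with the factor \<open>5 / 3\<close> relative to \<open>3 * L\<close>. It takes
  \<open>5 / 48\<close> from the coefficient \<open>1 / 2\<close> of the gap and leaves \<open>19 / 48\<close>; dividing by this turns \<open>10 / 9\<close> into
  \<open>160 / 57 < 4\<close>.\<close>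

lemma weighted_gap_bound:
  "(\<Sum>k\<le>K. wt eta k * exp_gap k) / Wt eta K
    \<le> 4 * ((norm (x0 - xs))\<^sup>2 + \<gamma> * F1_const * shift0) / (\<gamma> * Wt eta K) + 4 * \<gamma> * (D1_const + D3_const)"
proof -
  define A where "A = (\<Sum>k\<le>K. wt eta k * exp_gap k)"
  define E where "E = (\<Sum>k\<le>K. wt eta k * exp_err k)"
  define W where "W = Wt eta K"
  define T where "T = (norm (x0 - xs))\<^sup>2"
  have W: "0 < W" unfolding W_def by (rule Wt_pos[OF eta(5)])
  have A: "0 \<le> A" unfolding A_def by (rule sum_exp_gap_nonneg)
  have "(\<Sum>k\<le>K. wt eta k * (\<gamma> / 2 * exp_gap k))
      \<le> exp_dist 0 + (\<Sum>k\<le>K. wt eta k * (5 * \<gamma> * L * exp_err k + \<gamma>\<^sup>2 * D1_const))"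
    by (intro weighted_telescope eta(5) exp_dist_nonneg exp_dist_step)
  moreover have "(\<Sum>k\<le>K. wt eta k * (\<gamma> / 2 * exp_gap k)) = \<gamma> / 2 * A"
    by (simp add: A_def sum_distrib_left mult_ac)
  moreover have "(\<Sum>k\<le>K. wt eta k * (5 * \<gamma> * L * exp_err k + \<gamma>\<^sup>2 * D1_const)) = 5 * \<gamma> * L * E + \<gamma>\<^sup>2 * D1_const * W"
    by (simp add: E_def W_def Wt_def sum_distrib_left sum.distrib algebra_simps)
  ultimately have main: "\<gamma> / 2 * A \<le> T + 5 * \<gamma> * L * E + \<gamma>\<^sup>2 * D1_const * W"
    by (simp add: initial_values T_def)
  have "5 / 3 * \<gamma> * (3 * L * E) \<le> 5 / 3 * \<gamma> * (1 / 16 * A + 2 / 3 * (F1_const * shift0) + 2 / 3 * (\<gamma> * D3_const * W))"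
    unfolding A_def E_def W_def using gamma(1) by (intro mult_left_mono accumulated_error) auto
  then have "5 * \<gamma> * L * E \<le> 5 / 48 * (\<gamma> * A) + 10 / 9 * (\<gamma> * F1_const * shift0) + 10 / 9 * (\<gamma>\<^sup>2 * D3_const * W)"
    by (simp add: algebra_simps power2_eq_square)
  with main have "19 / 48 * (\<gamma> * A) \<le> T + 10 / 9 * (\<gamma> * F1_const * shift0) + 10 / 9 * (\<gamma>\<^sup>2 * D3_const * W) + \<gamma>\<^sup>2 * D1_const * W"
    by linarith
  moreover have "0 \<le> T" "0 \<le> \<gamma> * F1_const * shift0" "0 \<le> \<gamma>\<^sup>2 * D3_const * W" "0 \<le> \<gamma>\<^sup>2 * D1_const * W"
    using constants_nonneg gamma(1) W by (auto simp: T_def)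
  moreover have "p \<le> 4 * (t + q) + 4 * r + 4 * s"
    if "19 / 48 * p \<le> t + 10 / 9 * q + 10 / 9 * r + s" "0 \<le> t" "0 \<le> q" "0 \<le> r" "0 \<le> s"
    for p q r s t :: real
    using that by argo
  ultimately have "\<gamma> * A \<le> 4 * (T + \<gamma> * F1_const * shift0) + 4 * (\<gamma>\<^sup>2 * D3_const * W) + 4 * (\<gamma>\<^sup>2 * D1_const * W)"
    by blast
  then have "\<gamma> * A / (\<gamma> * W) \<le> (4 * (T + \<gamma> * F1_const * shift0) + 4 * (\<gamma>\<^sup>2 * D3_const * W) + 4 * (\<gamma>\<^sup>2 * D1_const * W)) / (\<gamma> * W)"
    using gamma(1) W by (intro divide_right_mono) auto
  also have "\<dots> = 4 * (T + \<gamma> * F1_const * shift0) / (\<gamma> * W) + 4 * \<gamma> * (D1_const + D3_const)"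
    using gamma(1) W by (simp add: field_simps power2_eq_square)
  finally show ?thesis using gamma(1) by (simp add: A_def W_def T_def)
qed

text \<open>Jensen's inequality for the convex function \<open>f_glob F\<close> and the normalized weights.\<close>

lemma average_iterate:
  shows "integrable M (\<lambda>z. gap (wavg eta x K z))"
    and "(\<integral>z. gap (wavg eta x K z) \<partial>M) \<le> (\<Sum>k\<le>K. wt eta k * exp_gap k) / Wt eta K"
proof -
  have W: "0 < Wt eta K" by (rule Wt_pos[OF eta(5)])
  let ?J = "\<lambda>z. (\<Sum>k\<le>K. wt eta k * gap (x k z)) / Wt eta K"
  have J: "integrable M ?J" using integrable_gap by simp
  have jensen: "gap (wavg eta x K z) \<le> ?J z" for z
  proof -
    have "f_glob F (\<Sum>k\<le>K. (wt eta k / Wt eta K) *\<^sub>R x k z)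
        \<le> (\<Sum>k\<le>K. wt eta k / Wt eta K * f_glob F (x k z))"
    proof (rule convex_on_sum[OF _ _ convex_glob])
      show "(\<Sum>k\<le>K. wt eta k / Wt eta K) = 1"
        using W by (simp add: sum_divide_distrib[symmetric] Wt_def)
    qed (use wt_pos[OF eta(5)] W in \<open>auto simp: less_imp_le\<close>)
    moreover have "(\<Sum>k\<le>K. (wt eta k / Wt eta K) *\<^sub>R x k z) = wavg eta x K z"
      by (simp add: wavg_def scaleR_sum_right)
    moreover have "?J z = (\<Sum>k\<le>K. wt eta k / Wt eta K * f_glob F (x k z)) - f_glob F xs"
    proof -
      have "(\<Sum>k\<le>K. wt eta k * gap (x k z)) = (\<Sum>k\<le>K. wt eta k * f_glob F (x k z)) - Wt eta K * f_glob F xs"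
        by (simp add: gap_def Wt_def sum_distrib_left sum_subtractf algebra_simps)
      then show ?thesis
        using W by (simp add: diff_divide_distrib sum_divide_distrib)
    qed
    ultimately show ?thesis by (simp add: gap_def)
  qed
  have "(\<lambda>z. wavg eta x K z) \<in> borel_measurable M"
    unfolding wavg_def
    by (intro borel_measurable_scaleR borel_measurable_const borel_measurable_sum
        Hk_imp_M[OF state_measurable(1)])
  note m = measurable_compose[OF this gap_meas]
  show int: "integrable M (\<lambda>z. gap (wavg eta x K z))"
  proof (rule Bochner_Integration.integrable_bound[OF J m])
    show "AE z in M. norm (gap (wavg eta x K z)) \<le> norm (?J z)"
    proof (rule AE_I2)
      fix z
      have "norm (gap (wavg eta x K z)) = gap (wavg eta x K z)" using gap_nonneg by simp
      also have "\<dots> \<le> norm (?J z)"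
        unfolding real_norm_def by (rule order_trans[OF jensen abs_ge_self])
      finally show "norm (gap (wavg eta x K z)) \<le> norm (?J z)" .
    qed
  qed
  have "(\<integral>z. gap (wavg eta x K z) \<partial>M) \<le> (\<integral>z. ?J z \<partial>M)"
    using jensen by (intro integral_mono int J)
  also have "\<dots> = (\<Sum>k\<le>K. wt eta k * exp_gap k) / Wt eta K"
    using integrable_gap by (simp add: exp_gap_def)
  finally show "(\<integral>z. gap (wavg eta x K z) \<partial>M) \<le> (\<Sum>k\<le>K. wt eta k * exp_gap k) / Wt eta K" .
qed

text \<open>The last weight alone gives \<open>Wt eta K \<ge> 1 / (1 - eta) ^ (K + 1)\<close>; for \<open>\<mu> = 0\<close> all weights are \<open>1\<close> and
  \<open>Wt eta K = K + 1\<close>.\<close>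

lemma convergence:
  shows "(\<integral>z. gap (wavg eta x K z) \<partial>M)
      \<le> (1 - eta) ^ K * (4 * ((norm (x0 - xs))\<^sup>2 + \<gamma> * F1_const * shift0) / \<gamma>) + 4 * \<gamma> * (D1_const + D3_const)"
    and "\<mu> = 0 \<Longrightarrow> 0 < K \<Longrightarrow> (\<integral>z. gap (wavg eta x K z) \<partial>M)
      \<le> 4 * ((norm (x0 - xs))\<^sup>2 + \<gamma> * F1_const * shift0) / (\<gamma> * real K) + 4 * \<gamma> * (D1_const + D3_const)"
proof -
  define c where "c = 4 * ((norm (x0 - xs))\<^sup>2 + \<gamma> * F1_const * shift0) / \<gamma>"
  have c: "0 \<le> c" using gamma(1) constants_nonneg by (simp add: c_def)
  have W: "0 < Wt eta K" by (rule Wt_pos[OF eta(5)])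
  have bound: "(\<integral>z. gap (wavg eta x K z) \<partial>M) \<le> c / Wt eta K + 4 * \<gamma> * (D1_const + D3_const)"
    using average_iterate(2)[of K] weighted_gap_bound[of K] by (simp add: c_def)
  have "1 / Wt eta K \<le> 1 / wt eta K"
    using wt_le_Wt[OF eta(5), of K] wt_pos[OF eta(5), of K] W by (intro divide_left_mono) auto
  also have "1 / wt eta K = (1 - eta) ^ (K + 1)" by (simp add: wt_def)
  also have "\<dots> \<le> (1 - eta) ^ K" using eta by (intro power_decreasing) auto
  finally have "c * (1 / Wt eta K) \<le> c * (1 - eta) ^ K" using c by (rule mult_left_mono)
  with bound show "(\<integral>z. gap (wavg eta x K z) \<partial>M) \<le> (1 - eta) ^ K
      * (4 * ((norm (x0 - xs))\<^sup>2 + \<gamma> * F1_const * shift0) / \<gamma>) + 4 * \<gamma> * (D1_const + D3_const)"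
    unfolding c_def[symmetric] by (simp add: mult.commute)
  assume "\<mu> = 0" "0 < K"
  then have "\<gamma> * \<mu> / 2 = 0" by simp
  then have "eta = 0" using alpha(1) by (simp only: eta_def)
  then have "Wt eta K = real K + 1" by (simp add: Wt_def wt_def)
  then have "c / Wt eta K \<le> c / real K" using c \<open>0 < K\<close> by (intro divide_left_mono) auto
  with bound show "(\<integral>z. gap (wavg eta x K z) \<partial>M)
      \<le> 4 * ((norm (x0 - xs))\<^sup>2 + \<gamma> * F1_const * shift0) / (\<gamma> * real K) + 4 * \<gamma> * (D1_const + D3_const)"
    by (simp add: c_def)
qed

end

theorem theoremJ5:
  fixes F :: "'n::finite \<Rightarrow> 'm::finite \<Rightarrow> 'a::euclidean_space \<Rightarrow> real"
    and \<D> :: "'n \<Rightarrow> (real^'m) measure"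
    and SC :: "'c measure" and C :: "'c \<Rightarrow> 'a \<Rightarrow> 'a"
    and SQ :: "'q measure" and Q :: "'q \<Rightarrow> 'a \<Rightarrow> 'a"
    and M :: "'z measure"
    and \<xi> :: "nat \<Rightarrow> 'n \<Rightarrow> 'z \<Rightarrow> real^'m"
    and \<zeta> :: "nat \<Rightarrow> 'n \<Rightarrow> 'z \<Rightarrow> 'c"
    and \<theta> :: "nat \<Rightarrow> 'n \<Rightarrow> 'z \<Rightarrow> 'q"
    and x :: "nat \<Rightarrow> 'z \<Rightarrow> 'a"
    and gh g v e h :: "nat \<Rightarrow> 'n \<Rightarrow> 'z \<Rightarrow> 'a"
    and x0 xs :: 'a and h0 :: "'n \<Rightarrow> 'a"
    and L \<L> \<mu> \<delta> \<omega> \<gamma> \<alpha> \<sigma>sq0 Dt1 F1 D3 :: real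
    and p :: ec_params
  assumes diff: "\<And>i j y. F i j differentiable (at y)"
    and conv: "\<And>i. convex_on UNIV (f_loc F i)"
    and smooth: "\<And>i. L_smooth L (f_loc F i)"
    and qsc: "quasi_strongly_convex \<mu> (f_glob F) xs" "\<mu> \<ge> 0"
    and sampling: "sampling_distr \<D>"
    and exp_smooth: "expected_smoothness \<L> F \<D> xs"
    and fin_var: "\<And>i. integrable (\<D> i)
          (\<lambda>u. (norm (grad (f_smp F i u) xs - grad (f_loc F i) xs))\<^sup>2)"
    and compr: "compression \<delta> SC C"
    and quant: "quantization \<omega> SQ Q"
    and prob: "prob_space M"
    and fresh: "fresh_draws M \<D> SC SQ \<xi> \<zeta> \<theta>"
    and method_run: "EC_SGDsr_DIANA F C Q \<gamma> \<alpha> x0 h0 M \<xi> \<zeta> \<theta> x gh g v e h"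
    and gamma: "0 < \<gamma>"
      "\<gamma> \<le> min (1 / (4 * \<L>))
         (\<delta> / (4 * sqrt (6 * L * (4 * L + 3 * \<delta> * (\<L> + L) + 16 * (3 * \<L> + 4 * L) / (1 - \<alpha>)))))"
    and alpha: "0 < \<alpha>" "\<alpha> \<le> 1 / (\<omega> + 1)"
    and \<sigma>sq0: "\<sigma>sq0 = mean (\<lambda>i. (norm (h0 i - grad (f_loc F i) xs))\<^sup>2)"
    and Dt1: "Dt1 = 3 / real CARD('n) *
          (\<Sum>i\<in>UNIV. \<integral>u. (norm (grad (f_smp F i u) xs - grad (f_loc F i) xs))\<^sup>2 \<partial>\<D> i)"
    and F1: "F1 = 96 * L * \<gamma>\<^sup>2 / (\<delta>\<^sup>2 * \<alpha> * (1 - min (\<gamma> * \<mu> / 2) (\<alpha> / 4)))"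
    and D3: "D3 = 6 * L * \<gamma> / \<delta> * (4 * \<alpha> * (\<omega> + 1) / \<delta> + 1) * Dt1"
    and p: "p = \<lparr> pA = 2 * L, pAt = 3 * (\<L> + L), pA' = 2 * \<L>,
                 pB1 = 2, pB2 = 0, pB1t = 0, pB2t = 0, pB1' = 0, pB2' = 0,
                 pC1 = 2 * \<alpha> * (3 * \<L> + 4 * L), pC2 = 0,
                 pD1 = 0, pD1t = Dt1, pD1' = 2 / (3 * real CARD('n)) * Dt1,
                 pD2 = \<alpha>\<^sup>2 * (\<omega> + 1) * Dt1, pD3 = D3,
                 pF1 = F1, pF2 = 0, pG = 0, p\<rho>1 = \<alpha>, p\<rho>2 = 1 \<rparr>"
  shows "parametric_assumption M
           (history M (draw_space \<D> SC SQ) (draw \<xi> \<zeta> \<theta>))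
           (f_glob F) xs L \<mu> \<gamma> x g e
           (\<lambda>k z. mean (\<lambda>i. (norm (h k i z - grad (f_loc F i) xs))\<^sup>2))
           (\<lambda>k z. 0) p
    \<and> M1 p = 0 \<and> M2 p = 0
    \<and> (\<forall>K. integrable M (\<lambda>z. f_glob F (wavg (rate \<gamma> \<mu> p) x K z) - f_glob F xs))
    \<and> (\<mu> > 0 \<longrightarrow> (\<forall>K.
           (\<integral>z. f_glob F (wavg (rate \<gamma> \<mu> p) x K z) - f_glob F xs \<partial>M)
             \<le> (1 - min (\<gamma> * \<mu> / 2) (\<alpha> / 4)) ^ K
                 * (4 * ((norm (x0 - xs))\<^sup>2 + \<gamma> * F1 * \<sigma>sq0) / \<gamma>)
               + 4 * \<gamma> * (pD1' p + D3)))
    \<and> (\<mu> = 0 \<longrightarrow> (\<forall>K>0.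
           (\<integral>z. f_glob F (wavg (rate \<gamma> \<mu> p) x K z) - f_glob F xs \<partial>M)
             \<le> 4 * ((norm (x0 - xs))\<^sup>2 + \<gamma> * F1 * \<sigma>sq0) / (\<gamma> * real K)
               + 4 * \<gamma> * (pD1' p + D3)))"
proof -
  \<comment> \<open>A positive step size forces both constants to be positive: for \<open>L = 0\<close> the second bound is
    \<open>\<delta> / 0 = 0\<close>.\<close>
  have L0: "0 \<le> L" using smooth by (auto simp: L_smooth_def dest: lipschitz_on_nonneg)
  have "\<gamma> \<le> 1 / (4 * \<L>)" using gamma(2) by simp
  with gamma(1) have "0 < 1 / (4 * \<L>)" by (rule less_le_trans)
  then have cL: "0 < \<L>" by (simp add: zero_less_divide_iff)
  have "L \<noteq> 0"
  proof
    assume "L = 0"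
    then have "\<gamma> \<le> \<delta> / (4 * sqrt 0)" using gamma(2) by simp
    then show False using gamma(1) by simp
  qed
  with L0 have L: "0 < L" by simp
  interpret R: ec_run F \<D> xs L \<L> \<mu> M SC C SQ Q \<xi> \<zeta> \<theta> \<delta> \<omega> \<gamma> \<alpha> x0 h0 x gh g v e h
    by (intro ec_run.intro ec_draws.intro ec_problem.intro ec_draws_axioms.intro ec_run_axioms.intro
        diff conv smooth qsc sampling exp_smooth fin_var compr quant prob fresh method_run gamma alpha L cL)
  have dvar: "Dt1 = R.Dvar"
    unfolding Dt1 R.Dvar_def R.Var_def mean_def by simp
  have eta: "rate \<gamma> \<mu> p = R.eta"
    using R.alpha_less by (simp add: rate_def p R.eta_def)
  have F1_const: "F1 = R.F1_const" by (simp add: F1 R.F1_const_def R.eta_def)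
  have D3_const: "D3 = R.D3_const" by (simp add: D3 R.D3_const_def dvar)
  have D1_const: "pD1' p = R.D1_const" by (simp add: p R.D1_const_def dvar)
  have shift0: "\<sigma>sq0 = R.shift0" by (simp add: \<sigma>sq0 R.shift0_def)
  have sg: "(\<lambda>k z. mean (\<lambda>i. (norm (h k i z - grad (f_loc F i) xs))\<^sup>2)) = R.\<sigma>"
    by (simp add: fun_eq_iff R.\<sigma>_def)
  have param: "parametric_assumption M (history M (draw_space \<D> SC SQ) (draw \<xi> \<zeta> \<theta>))
      (f_glob F) xs L \<mu> \<gamma> x g e R.\<sigma> (\<lambda>k z. 0) p"
    unfolding parametric_assumption_def Let_def eta R.gap_def[symmetric]
  proof (intro conjI allI)
    fix k i
    show "integrable M (g k i)" by (intro R.sq_int_integrable R.sq_g R.state_sq)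
    show "integrable M (\<lambda>z. (norm (g k i z - vec_cond_exp M (R.Hk k) (g k i) z))\<^sup>2)"
      by (rule R.noise_of_g(1))
  next
    fix k
    show "integrable M (\<lambda>z. (norm (mean (\<lambda>i. g k i z)))\<^sup>2)" by (rule R.mean_gradient_step(1))
    have "R.sq_int (\<lambda>z. mean (\<lambda>i. e k i z))" by (intro R.sq_int_mean R.sq_e)
    then show "integrable M (\<lambda>z. (norm (mean (\<lambda>i. e k i z)))\<^sup>2)" by (simp add: R.sq_int_def)
    show "integrable M (\<lambda>z. R.gap (x k z))" by (rule R.integrable_gap)
    show "integrable M (R.\<sigma> k)" by (rule R.integrable_\<sigma>)
    show "integrable M (\<lambda>z. 0 :: real)" by simp
  next
    fix k
    interpret S: sigma_finite_subalgebra M "R.Hk k" by (rule R.subalgebra_sigma_finite[OF R.sub_Hk])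
    have "AE z in M. real_cond_exp M (R.Hk k) (\<lambda>z. 0) z = 0"
      by (rule S.real_cond_exp_F_meas) auto
    with R.conditional_bounds[of k]
    show "AE z in M.
        vec_cond_exp M (R.Hk k) (\<lambda>z. mean (\<lambda>i. g k i z)) z = grad (f_glob F) (x k z) \<and>
        mean (\<lambda>i. (norm (vec_cond_exp M (R.Hk k) (g k i) z))\<^sup>2)
          \<le> 2 * pA p * R.gap (x k z) + pB1 p * R.\<sigma> k z + pB2 p * 0 + pD1 p \<and>
        mean (\<lambda>i. real_cond_exp M (R.Hk k)
            (\<lambda>z. (norm (g k i z - vec_cond_exp M (R.Hk k) (g k i) z))\<^sup>2) z)
          \<le> 2 * pAt p * R.gap (x k z) + pB1t p * R.\<sigma> k z + pB2t p * 0 + pD1t p \<and>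
        real_cond_exp M (R.Hk k) (\<lambda>z. (norm (mean (\<lambda>i. g k i z)))\<^sup>2) z
          \<le> 2 * pA' p * R.gap (x k z) + pB1' p * R.\<sigma> k z + pB2' p * 0 + pD1' p \<and>
        real_cond_exp M (R.Hk k) (R.\<sigma> (Suc k)) z
          \<le> (1 - p\<rho>1 p) * R.\<sigma> k z + 2 * pC1 p * R.gap (x k z) + pG p * p\<rho>1 p * 0 + pD2 p \<and>
        real_cond_exp M (R.Hk k) (\<lambda>z. 0) z
          \<le> (1 - p\<rho>2 p) * 0 + 2 * pC2 p * R.gap (x k z)"
      by eventually_elim (simp add: p dvar algebra_simps)
  next
    fix K
    have em: "(\<integral>y. (norm (mean (\<lambda>i. e k i y)))\<^sup>2 \<partial>M) \<le> R.exp_err k" for k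
    proof -
      have "R.sq_int (\<lambda>z. mean (\<lambda>i. e k i z))" by (intro R.sq_int_mean R.sq_e)
      then show ?thesis
        unfolding R.exp_err_def
        by (intro integral_mono R.integrable_mean_e norm_mean_sq_le) (simp add: R.sq_int_def)
    qed
    have "3 * L * (\<Sum>k\<le>K. wt R.eta k * (\<integral>y. (norm (mean (\<lambda>i. e k i y)))\<^sup>2 \<partial>M))
        \<le> 3 * L * (\<Sum>k\<le>K. wt R.eta k * R.exp_err k)"
      using L em wt_pos[OF R.eta(5)]
      by (intro mult_left_mono sum_mono) (auto simp: less_imp_le)
    also have "\<dots> \<le> 1 / 16 * (\<Sum>k\<le>K. wt R.eta k * R.exp_gap k) + 2 / 3 * (R.F1_const * R.shift0)
        + 2 / 3 * (\<gamma> * R.D3_const * Wt R.eta K)"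
      by (rule R.accumulated_error)
    also have "\<dots> \<le> 1 / 4 * (\<Sum>k\<le>K. wt R.eta k * R.exp_gap k) + R.F1_const * R.shift0 + \<gamma> * R.D3_const * Wt R.eta K"
    proof (intro add_mono)
      have "0 \<le> R.F1_const * R.shift0" "0 \<le> \<gamma> * R.D3_const * Wt R.eta K"
        using R.constants_nonneg gamma(1) Wt_pos[OF R.eta(5), of K] by simp_all
      then show "2 / 3 * (R.F1_const * R.shift0) \<le> R.F1_const * R.shift0"
        "2 / 3 * (\<gamma> * R.D3_const * Wt R.eta K) \<le> \<gamma> * R.D3_const * Wt R.eta K" by linarith+
      show "1 / 16 * (\<Sum>k\<le>K. wt R.eta k * R.exp_gap k) \<le> 1 / 4 * (\<Sum>k\<le>K. wt R.eta k * R.exp_gap k)"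
        using R.sum_exp_gap_nonneg[of K] by linarith
    qed
    finally have le: "3 * L * (\<Sum>k\<le>K. wt R.eta k * (\<integral>y. (norm (mean (\<lambda>i. e k i y)))\<^sup>2 \<partial>M))
        \<le> 1 / 4 * (\<Sum>k\<le>K. wt R.eta k * R.exp_gap k) + R.F1_const * R.shift0 + \<gamma> * R.D3_const * Wt R.eta K" .
    show "AE z in M. 3 * L * (\<Sum>k\<le>K. wt R.eta k * (\<integral>y. (norm (mean (\<lambda>i. e k i y)))\<^sup>2 \<partial>M))
        \<le> 1 / 4 * (\<Sum>k\<le>K. wt R.eta k * (\<integral>y. R.gap (x k y) \<partial>M))
          + pF1 p * R.\<sigma> 0 z + pF2 p * 0 + \<gamma> * pD3 p * Wt R.eta K"
    proof (rule AE_I2)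
      fix z assume "z \<in> space M"
      then show "3 * L * (\<Sum>k\<le>K. wt R.eta k * (\<integral>y. (norm (mean (\<lambda>i. e k i y)))\<^sup>2 \<partial>M))
          \<le> 1 / 4 * (\<Sum>k\<le>K. wt R.eta k * (\<integral>y. R.gap (x k y) \<partial>M))
            + pF1 p * R.\<sigma> 0 z + pF2 p * 0 + \<gamma> * pD3 p * Wt R.eta K"
        using le by (simp add: p F1_const D3_const R.\<sigma>_0 R.exp_gap_def)
    qed
  qed
  have M: "M1 p = 0" "M2 p = 0" by (simp_all add: M1_def M2_def p)
  show ?thesis
    unfolding sg eta R.gap_def[symmetric] F1_const D3_const D1_const shift0 R.eta_def[symmetric]
    using param M R.average_iterate(1) R.convergence by blast
qed

end
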